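(* Let $0<\alpha<2$ and let $\mathbf{Y}=\{Y(t)\}_{t\in\mathbb{Z}^d}$ be a stationary $S\alpha S$ random field with integral representation $$Y(t)\stackrel{d}{=}\int_S f_t(s)\,M(ds)=\int_S c_t(s)\left(\frac{d\mu\circ\phi_t}{d\mu}(s)\right)^{1/\alpha} f\circ\phi_t(s)\,M(ds),\qquad t\in\mathbb{Z}^d,$$ where $M$ is an $S\alpha S$ random measure on a standard Borel space $(S,\mathcal{S})$ with $\sigma$-finite control measure $\mu$, $f\in L^\alpha(S,\mu)$, $\{\phi_t\}_{t\in\mathbb{Z}^d}$ is a nonsingular $\mathbb{Z}^d$-action on $(S,\mathcal{S},\mu)$ and $\{c_t\}_{t\in\mathbb{Z}^d}$ is a $\{\pm1\}$-valued measurable cocycle for $\{\phi_t\}$. Let $M_n=\max_{\mathbf{0}\le t\le (n-1)\mathbf{1}}|Y(t)|$. (1) If $\mathbf{Y}$ is generated by a dissipative action, or equivalently $\mathbf{Y}$ has a mixed moving average representation $$\mathbf{Y}\stackrel{d}{=}\left\{\int_{W\times\mathbb{Z}^d} f(v,t+s)\,M(dv,ds)\right\}_{t\in\mathbb{Z}^d},$$ then for every $0<\beta<\alpha$, $$n^{-d\beta/\alpha}\,\mathbb{E}\big[M_n^\beta\big]\to C\quad\text{as } n\to\infty,$$ where $C=\tilde c_{\mathbf{Y}}^{\,\beta}\,C_\alpha^{\beta/\alpha}\,\mathbb{E}[Z_{\alpha/\beta}]$. Here $Z_{\alpha/\beta}$ is a Fréchet random variable with $\mathbb{P}(Z_{\alpha/\beta}\le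 x)=e^{-x^{-\alpha/\beta}}$ for $x>0$, $\tilde c_{\mathbf{Y}}=\lim_{n\to\infty}n^{-d/\alpha}b_n$ with $$b_n=\left(\int_S\max_{\mathbf{0}\le t\le(n-1)\mathbf{1}}|f_t(s)|^\alpha\,\mu(ds)\right)^{1/\alpha},$$ and $$C_\alpha=\begin{cases}\dfrac{1-\alpha}{\Gamma(2-\alpha)\cos(\pi\alpha/2)},&\alpha\ne1,\\[2mm] \dfrac{2}{\pi},&\alpha=1.\end{cases}$$ (2) If $\mathbf{Y}$ is generated by a conservative action, then for every $0<\beta<\alpha$, $$n^{-d\beta/\alpha}\,\mathbb{E}\big[M_n^\beta\big]\to0\quad\text{as } n\to\infty.$$
   Context: $d\ge1$ is an integer. For $u,v\in\mathbb{Z}^d$, $u\le v$ means coordinatewise inequality; $\mathbf{0}=(0,\dots,0)$, $\mathbf{1}=(1,\dots,1)$; the maxima defining $M_n$ and $b_n$ are over $t\in\mathbb{Z}^d$. $\stackrel{d}{=}$ between fields means equality of finite-dimensional distributions. A real-valued field is $S\alpha S$ (symmetric $\alpha$-stable) if every finite linear combination of its values has a symmetric $\alpha$-stable distribution. An $S\alpha S$ random measure $M$ with $\sigma$-finite control measure $\mu$ is an independently scattered, $\sigma$-additive random set function on sets of finite $\mu$-measure with $\mathbb{E}e^{i\theta M(A)}=e^{-|\theta|^\alpha\mu(A)}$; for $g\in L^\alpha(S,\mu)$ (i.e. $\|g\|_\alpha^\alpha=\int|g|^\alpha d\mu<\infty$), $\mathbb{E}\exp(i\theta\int g\,dM)=\exp(-|\theta|^\alpha\|g\|_\alpha^\alpha)$.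 A nonsingular $\mathbb{Z}^d$-action $\{\phi_t\}_{t\in\mathbb{Z}^d}$ on $(S,\mathcal{S},\mu)$: each $\phi_t:S\to S$ is measurable, $\phi_0=\mathrm{id}_S$, $\phi_{u+v}=\phi_u\circ\phi_v$, and each $\mu\circ\phi_t$ is equivalent to $\mu$. A $\{\pm1\}$-valued measurable cocycle: measurable maps $c_t:S\to\{\pm1\}$ with $c_{u+v}(s)=c_u(\phi_v(s))c_v(s)$ for all $u,v\in\mathbb{Z}^d$, $s\in S$. $\mathbf{Y}$ is said to be generated by $\{\phi_t\}$ if it has an integral representation of the form $$Y(t)\stackrel{d}{=}\int_S c_t(s)\left(\frac{d\mu\circ\phi_t}{d\mu}(s)\right)^{1/\alpha} f\circ\phi_t(s)\,M(ds),\qquad t\in\mathbb{Z}^d,$$ with $M$ an $S\alpha S$ random measure on $(S,\mathcal{S})$ with control measure $\mu$, $f\in L^\alpha(S,\mu)$ and $\{c_t\}_{t\in\mathbb{Z}^d}$ a $\{\pm1\}$-valued measurable cocycle for $\{\phi_t\}$, together with the full support condition $\bigcup_{t\in\mathbb{Z}^d}\mathrm{Support}(f\circ\phi_t)=S$; this condition is assumed throughout. A measurable set $W\subseteq S$ is wandering if $\{\phi_t(W):t\in\mathbb{Z}^d\}$ is a pairwise disjoint collection. There is a decomposition (Hopf decomposition) $S=\mathcal{C}\cup\mathcal{D}$ into disjoint invariant sets with $\mathcal{D}=\bigcup_{t}\phi_t(W^* )$ for some wandering set $W^*$, and $\mathcal{C}$ having no wandering subset of positive $\mu$-measure. The action is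 conservative if $S=\mathcal{C}$ and dissipative if $S=\mathcal{D}$ (mod $\mu$). In a mixed moving average representation, $(W,\nu)$ is a $\sigma$-finite standard measure space, $M$ is an $S\alpha S$ random measure on $W\times\mathbb{Z}^d$ with control measure $\nu\otimes$(counting measure), and $f\in L^\alpha(W\times\mathbb{Z}^d,\nu\otimes\text{counting})$. For dissipative actions the limit $\tilde c_{\mathbf{Y}}$ is known to exist and to be a finite constant. *)

theory Defs
  imports "HOL-Probability.Probability"
begin

text \<open>
  The group \<open>\<int>\<^sup>d\<close> is the type \<open>int ^ 'd\<close> with \<open>d = CARD('d) \<ge> 1\<close>; the order \<open>\<le>\<close> of the library
  on this type is the coordinatewise one. The exponent \<open>\<alpha>\<close> is always an explicit parameter.
\<close>

definition cube :: "nat \<Rightarrow> (int ^ 'd) set" where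
  "cube n = {t. 0 \<le> t \<and> t \<le> (int n - 1) *s 1}"

text \<open>A standard Borel space carries the Borel \<open>\<sigma>\<close>-algebra of some Polish topology.\<close>

definition standard_borel :: "'s measure \<Rightarrow> bool" where
  "standard_borel M \<longleftrightarrow>
     (\<exists>X. completely_metrizable_space X \<and> second_countable X \<and> topspace X = space M \<and>
          sets M = sigma_sets (topspace X) {U. openin X U})"

definition in_Lp :: "real \<Rightarrow> 's measure \<Rightarrow> ('s \<Rightarrow> real) \<Rightarrow> bool" where
  "in_Lp \<alpha> \<mu> g \<longleftrightarrow> g \<in> borel_measurable \<mu> \<and> integrable \<mu> (\<lambda>s. \<bar>g s\<bar> powr \<alpha>)"


section \<open>Random fields\<close>

definition fdd :: "'a measure \<Rightarrow> ('t \<Rightarrow> 'a \<Rightarrow> real) \<Rightarrow> 't set \<Rightarrow> ('t \<Rightarrow> real) measure" where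
  "fdd P Y T = distr P (PiM T (\<lambda>_. borel)) (\<lambda>\<omega>. \<lambda>t\<in>T. Y t \<omega>)"

definition fdd_eq ::
    "'a measure \<Rightarrow> ('t \<Rightarrow> 'a \<Rightarrow> real) \<Rightarrow> 'b measure \<Rightarrow> ('t \<Rightarrow> 'b \<Rightarrow> real) \<Rightarrow> bool" where
  "fdd_eq P Y Q Z \<longleftrightarrow> (\<forall>T. finite T \<longrightarrow> fdd P Y T = fdd Q Z T)"

definition random_field :: "'a measure \<Rightarrow> ('t \<Rightarrow> 'a \<Rightarrow> real) \<Rightarrow> bool" where
  "random_field P Y \<longleftrightarrow> prob_space P \<and> (\<forall>t. Y t \<in> borel_measurable P)"

definition stationary_field :: "'a measure \<Rightarrow> ('t::ab_group_add \<Rightarrow> 'a \<Rightarrow> real) \<Rightarrow> bool" where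
  "stationary_field P Y \<longleftrightarrow> (\<forall>h. fdd_eq P (\<lambda>t. Y (t + h)) P Y)"

text \<open>The degenerate law (\<open>\<sigma> = 0\<close>) is included, as is usual.\<close>

definition SaS_distribution :: "real \<Rightarrow> real measure \<Rightarrow> bool" where
  "SaS_distribution \<alpha> D \<longleftrightarrow>
     (\<exists>\<sigma>\<ge>0. \<forall>\<theta>. char D \<theta> = of_real (exp (- (\<sigma> powr \<alpha> * \<bar>\<theta>\<bar> powr \<alpha>))))"

definition SaS_field :: "real \<Rightarrow> 'a measure \<Rightarrow> ('t \<Rightarrow> 'a \<Rightarrow> real) \<Rightarrow> bool" where
  "SaS_field \<alpha> P Y \<longleftrightarrow> random_field P Y \<and>
     (\<forall>T a. finite T \<longrightarrow> SaS_distribution \<alpha> (distr P borel (\<lambda>\<omega>. \<Sum>t\<in>T. a t * Y t \<omega>)))"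

definition max_abs :: "(int ^ 'd \<Rightarrow> 'a \<Rightarrow> real) \<Rightarrow> nat \<Rightarrow> 'a \<Rightarrow> real" where
  "max_abs Y n \<omega> = Max ((\<lambda>t. \<bar>Y t \<omega>\<bar>) ` cube n)"


section \<open>Stable random measures and stable integrals\<close>

text \<open>
  \<open>N A\<close> is meaningful only for measurable \<open>A\<close> of finite \<open>\<mu>\<close>-measure. Finite disjoint families are
  covered by sequences that are eventually empty.
\<close>

definition SaS_random_measure ::
    "real \<Rightarrow> 'b measure \<Rightarrow> 's measure \<Rightarrow> ('s set \<Rightarrow> 'b \<Rightarrow> real) \<Rightarrow> bool" where
  "SaS_random_measure \<alpha> Q \<mu> N \<longleftrightarrow>
     prob_space Q \<and>
     (\<forall>A\<in>sets \<mu>. emeasure \<mu> A < \<infinity> \<longrightarrow>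
        N A \<in> borel_measurable Q \<and>
        (\<forall>\<theta>. char (distr Q borel (N A)) \<theta> = of_real (exp (- (\<bar>\<theta>\<bar> powr \<alpha> * measure \<mu> A))))) \<and>
     (\<forall>A :: nat \<Rightarrow> 's set.
        disjoint_family A \<and> (\<forall>i. A i \<in> sets \<mu> \<and> emeasure \<mu> (A i) < \<infinity>) \<longrightarrow>
        prob_space.indep_vars Q (\<lambda>_. borel) (\<lambda>i. N (A i)) UNIV \<and>
        (emeasure \<mu> (\<Union>i. A i) < \<infinity> \<longrightarrow>
           (AE \<omega> in Q. (\<lambda>i. N (A i) \<omega>) sums N (\<Union>i. A i) \<omega>)))"

text \<open>
  The integral of a simple function vanishing off a set of finite measure. The level set of the
  value \<open>0\<close>, which may have infinite measure, contributes nothing.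
\<close>

definition simple_stable_integral ::
    "'s measure \<Rightarrow> ('s set \<Rightarrow> 'b \<Rightarrow> real) \<Rightarrow> ('s \<Rightarrow> real) \<Rightarrow> 'b \<Rightarrow> real" where
  "simple_stable_integral \<mu> N g \<omega> =
     (\<Sum>y\<in>g ` space \<mu>. y * N {s \<in> space \<mu>. g s = y} \<omega>)"

text \<open>
  \<open>X\<close> is (a version of) \<open>\<integral> g dN\<close>: the limit in probability of the integrals of simple functions
  converging to \<open>g\<close> in \<open>L\<^sup>\<alpha>\<close>.
\<close>

definition is_stable_integral ::
    "real \<Rightarrow> 'b measure \<Rightarrow> 's measure \<Rightarrow> ('s set \<Rightarrow> 'b \<Rightarrow> real) \<Rightarrow> ('s \<Rightarrow> real) \<Rightarrow> ('b \<Rightarrow> real) \<Rightarrow> bool"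
  where
  "is_stable_integral \<alpha> Q \<mu> N g X \<longleftrightarrow>
     in_Lp \<alpha> \<mu> g \<and> X \<in> borel_measurable Q \<and>
     (\<exists>G :: nat \<Rightarrow> 's \<Rightarrow> real.
        (\<forall>k. simple_function \<mu> (G k) \<and> emeasure \<mu> {s \<in> space \<mu>. G k s \<noteq> 0} < \<infinity>) \<and>
        (\<lambda>k. \<integral>\<^sup>+ s. ennreal (\<bar>G k s - g s\<bar> powr \<alpha>) \<partial>\<mu>) \<longlonglongrightarrow> 0 \<and>
        (\<forall>\<epsilon>>0. (\<lambda>k. measure Q {\<omega> \<in> space Q. \<bar>simple_stable_integral \<mu> N (G k) \<omega> - X \<omega>\<bar> > \<epsilon>})
                  \<longlonglongrightarrow> 0))"

definition integral_representation ::
    "real \<Rightarrow> 'a measure \<Rightarrow> ('t \<Rightarrow> 'a \<Rightarrow> real) \<Rightarrow>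
     'b measure \<Rightarrow> 's measure \<Rightarrow> ('s set \<Rightarrow> 'b \<Rightarrow> real) \<Rightarrow> ('t \<Rightarrow> 's \<Rightarrow> real) \<Rightarrow> bool" where
  "integral_representation \<alpha> P Y Q \<mu> N F \<longleftrightarrow>
     SaS_random_measure \<alpha> Q \<mu> N \<and>
     (\<exists>X. (\<forall>t. is_stable_integral \<alpha> Q \<mu> N (F t) (X t)) \<and> fdd_eq P Y Q X)"


section \<open>Nonsingular actions\<close>

text \<open>The measure \<open>\<mu> \<circ> \<phi>\<^sub>t\<close>, that is \<open>A \<mapsto> \<mu> (\<phi>\<^sub>t(A))\<close> (direct image of the set).\<close>

definition shifted_measure ::
    "'s measure \<Rightarrow> ('t \<Rightarrow> 's \<Rightarrow> 's) \<Rightarrow> 't \<Rightarrow> 's measure" where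
  "shifted_measure \<mu> \<phi> t = measure_of (space \<mu>) (sets \<mu>) (\<lambda>A. emeasure \<mu> (\<phi> t ` A))"

definition nonsingular_action ::
    "'s measure \<Rightarrow> ('t::ab_group_add \<Rightarrow> 's \<Rightarrow> 's) \<Rightarrow> bool" where
  "nonsingular_action \<mu> \<phi> \<longleftrightarrow>
     (\<forall>t. \<phi> t \<in> measurable \<mu> \<mu>) \<and>
     (\<forall>s\<in>space \<mu>. \<phi> 0 s = s) \<and>
     (\<forall>u v. \<forall>s\<in>space \<mu>. \<phi> (u + v) s = \<phi> u (\<phi> v s)) \<and>
     (\<forall>t. absolutely_continuous \<mu> (shifted_measure \<mu> \<phi> t) \<and>
          absolutely_continuous (shifted_measure \<mu> \<phi> t) \<mu>)"

definition sign_cocycle ::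
    "'s measure \<Rightarrow> ('t::ab_group_add \<Rightarrow> 's \<Rightarrow> 's) \<Rightarrow> ('t \<Rightarrow> 's \<Rightarrow> real) \<Rightarrow> bool" where
  "sign_cocycle \<mu> \<phi> c \<longleftrightarrow>
     (\<forall>t. c t \<in> borel_measurable \<mu>) \<and>
     (\<forall>t. \<forall>s\<in>space \<mu>. c t s \<in> {1, -1}) \<and>
     (\<forall>u v. \<forall>s\<in>space \<mu>. c (u + v) s = c u (\<phi> v s) * c v s)"

definition full_support ::
    "'s measure \<Rightarrow> ('t \<Rightarrow> 's \<Rightarrow> 's) \<Rightarrow> ('s \<Rightarrow> real) \<Rightarrow> bool" where
  "full_support \<mu> \<phi> f \<longleftrightarrow> (\<Union>t. {s \<in> space \<mu>. f (\<phi> t s) \<noteq> 0}) = space \<mu>"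

definition action_kernel ::
    "real \<Rightarrow> 's measure \<Rightarrow> ('t \<Rightarrow> 's \<Rightarrow> 's) \<Rightarrow> ('t \<Rightarrow> 's \<Rightarrow> real) \<Rightarrow> ('s \<Rightarrow> real) \<Rightarrow>
     't \<Rightarrow> 's \<Rightarrow> real" where
  "action_kernel \<alpha> \<mu> \<phi> c f t s =
     c t s * enn2real (RN_deriv \<mu> (shifted_measure \<mu> \<phi> t) s) powr (1 / \<alpha>) * f (\<phi> t s)"

definition wandering :: "'s measure \<Rightarrow> ('t \<Rightarrow> 's \<Rightarrow> 's) \<Rightarrow> 's set \<Rightarrow> bool" where
  "wandering \<mu> \<phi> W \<longleftrightarrow> W \<in> sets \<mu> \<and> disjoint_family (\<lambda>t. \<phi> t ` W)"

definition hopf_decomposition ::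
    "'s measure \<Rightarrow> ('t \<Rightarrow> 's \<Rightarrow> 's) \<Rightarrow> 's set \<Rightarrow> 's set \<Rightarrow> bool" where
  "hopf_decomposition \<mu> \<phi> C D \<longleftrightarrow>
     C \<in> sets \<mu> \<and> D \<in> sets \<mu> \<and> C \<union> D = space \<mu> \<and> C \<inter> D = {} \<and>
     (\<forall>t. \<phi> t ` C = C \<and> \<phi> t ` D = D) \<and>
     (\<exists>W. wandering \<mu> \<phi> W \<and> D = (\<Union>t. \<phi> t ` W)) \<and>
     (\<forall>W. wandering \<mu> \<phi> W \<and> W \<subseteq> C \<longrightarrow> emeasure \<mu> W = 0)"

definition conservative_action :: "'s measure \<Rightarrow> ('t \<Rightarrow> 's \<Rightarrow> 's) \<Rightarrow> bool" where
  "conservative_action \<mu> \<phi> \<longleftrightarrow> (\<exists>C D. hopf_decomposition \<mu> \<phi> C D \<and> D \<in> null_sets \<mu>)"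

definition dissipative_action :: "'s measure \<Rightarrow> ('t \<Rightarrow> 's \<Rightarrow> 's) \<Rightarrow> bool" where
  "dissipative_action \<mu> \<phi> \<longleftrightarrow> (\<exists>C D. hopf_decomposition \<mu> \<phi> C D \<and> C \<in> null_sets \<mu>)"


section \<open>Mixed moving averages and the constants of the limit theorem\<close>

definition mixed_moving_average ::
    "real \<Rightarrow> 'a measure \<Rightarrow> (int ^ 'd \<Rightarrow> 'a \<Rightarrow> real) \<Rightarrow>
     'b measure \<Rightarrow> 'w measure \<Rightarrow> (('w \<times> (int ^ 'd)) set \<Rightarrow> 'b \<Rightarrow> real) \<Rightarrow>
     ('w \<times> (int ^ 'd) \<Rightarrow> real) \<Rightarrow> bool" where
  "mixed_moving_average \<alpha> P Y Q \<nu> N g \<longleftrightarrow>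
     standard_borel \<nu> \<and> sigma_finite_measure \<nu> \<and>
     in_Lp \<alpha> (\<nu> \<Otimes>\<^sub>M count_space UNIV) g \<and>
     integral_representation \<alpha> P Y Q (\<nu> \<Otimes>\<^sub>M count_space UNIV) N (\<lambda>t (v, s). g (v, t + s))"

definition b_seq ::
    "real \<Rightarrow> 's measure \<Rightarrow> (int ^ 'd \<Rightarrow> 's \<Rightarrow> real) \<Rightarrow> nat \<Rightarrow> real" where
  "b_seq \<alpha> \<mu> F n = (\<integral>s. Max ((\<lambda>t. \<bar>F t s\<bar> powr \<alpha>) ` cube n) \<partial>\<mu>) powr (1 / \<alpha>)"

definition stable_const :: "real \<Rightarrow> real" where
  "stable_const \<alpha> =
     (if \<alpha> = 1 then 2 / pi else (1 - \<alpha>) / (Gamma (2 - \<alpha>) * cos (pi * \<alpha> / 2)))"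

text \<open>The law with distribution function \<open>exp (- x\<^sup>-\<^sup>\<gamma>)\<close> on \<open>x > 0\<close>.\<close>

definition frechet :: "real \<Rightarrow> real measure" where
  "frechet \<gamma> = interval_measure (\<lambda>x. if x > 0 then exp (- (x powr (- \<gamma>))) else 0)"

end

theory Submission
  imports Defs "HOL-Real_Asymp.Real_Asymp"
begin

text \<open>
  The proof rests on the principle of one large jump. Let \<open>F\<^sub>t\<close> be the kernel, \<open>V = n\<^sup>d\<close> the number of
  points of the cube, \<open>L = V\<^sup>1\<^sup>/\<^sup>\<alpha>\<close> the order of magnitude of the maximum and
  \<open>B = \<integral> max |F\<^sub>t|\<^sup>\<alpha> d\<mu> = b\<^sub>n\<^sup>\<alpha>\<close>. Approximating the kernels by simple functions turns the field on the cube
  into finite sums \<open>S\<^sub>t = \<Sum>\<^sub>j a\<^sub>t\<^sub>j Z\<^sub>j\<close> with independent symmetric stable \<open>Z\<^sub>j\<close>, whose tails satisfy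
  \<open>x\<^sup>\<alpha> P(|Z\<^sub>j| > x) \<rightarrow> C\<^sub>\<alpha> m\<^sub>j\<close>. Two things can prevent \<open>S\<^sub>t\<close> from being close to its largest summand.
  Two summands may exceed \<open>\<kappa>L\<close> at the same \<open>t\<close>: for fixed \<open>t\<close> this has probability of order \<open>V\<^sup>-\<^sup>2\<close>, so for some \<open>t\<close>
  it has probability of order \<open>V\<^sup>-\<^sup>1\<close>. Or the summands below \<open>\<kappa>L\<close> may add up to more than \<open>\<delta>L\<close>: by Chebyshev's
  inequality this has probability at most a multiple of \<open>\<kappa>\<^sup>2\<^sup>-\<^sup>\<alpha>/\<delta>\<^sup>2\<close>, uniformly in \<open>n\<close>. Hence the maximum of
  \<open>|S\<^sub>t|\<close> is within \<open>\<delta>L\<close> of the largest \<open>|a\<^sub>t\<^sub>j Z\<^sub>j|\<close>, and independence gives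
  \<open>P(max |a\<^sub>t\<^sub>j Z\<^sub>j| \<le> xL) \<approx> exp (- C\<^sub>\<alpha> (B/V) x\<^sup>-\<^sup>\<alpha>)\<close> (\<open>prob_large_sum_bounds\<close>, \<open>max_stable_tail_limit\<close>).

  The limit \<open>l\<close> of \<open>B/V = n\<^sup>-\<^sup>d b\<^sub>n\<^sup>\<alpha>\<close> exists because \<open>\<integral> max |F\<^sub>t|\<^sup>\<alpha> d\<mu>\<close> over finite sets of points is subadditive and
  does not increase under translation (\<open>max_integral_cube_limit\<close>). So \<open>L\<^sup>-\<^sup>1 M\<^sub>n\<close> converges in law to a Frechet variable of
  scale \<open>(C\<^sub>\<alpha> l)\<^sup>1\<^sup>/\<^sup>\<alpha>\<close>, or to \<open>0\<close> if \<open>l = 0\<close>. A union bound gives \<open>P(M\<^sub>n > xL) \<le> K x\<^sup>-\<^sup>\<alpha>\<close> for all \<open>n\<close> and \<open>x\<close>, which is the domination that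
  carries convergence in law over to the moments of order \<open>\<beta> < \<alpha>\<close> (\<open>moment_limit\<close>).

  If the action is conservative then \<open>l = 0\<close>. Indeed \<open>max |F\<^sub>t|\<^sup>\<alpha>\<close> is the sum of the \<open>|F\<^sub>t|\<^sup>\<alpha>\<close> restricted to the
  set where \<open>t\<close> is the lexicographically last point at which the maximum is attained. Away from the boundary of
  the cube each of these integrals is at most the integral of \<open>|F\<^sub>0|\<^sup>\<alpha>\<close> over the set where \<open>0\<close> is such a
  point for a large box around it. For the whole lattice in place of the box this set is wandering
  up to a null set, since an orbit has at most one last maximum; hence it is itself a null set (\<open>peak_null_if_conservative\<close>).

  The tail constant of a stable law is found from its characteristic function alone: the measures
  \<open>r\<^sup>\<alpha> P(Z/r \<in> dx)\<close>, multiplied by \<open>1 - sinc x\<close> to make their mass near \<open>0\<close> bounded, converge weakly by Levy's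
  continuity theorem (\<open>stable_law_tail_at_2\<close>).
\<close>

section \<open>Gamma integrals and the constant of the stable tail\<close>

lemma nn_integral_exp_Gamma:
  fixes s a :: real assumes s: "s > 0" and a: "a > 0"
  shows "(\<integral>\<^sup>+x. ennreal (x powr (s - 1) * exp (- (a * x))) * indicator {0<..} x \<partial>lborel)
     = ennreal (Gamma s * a powr (- s))"
proof -
  have "ennreal (Gamma s) = (\<integral>\<^sup>+t. ennreal (indicator {0..} t * t powr (s - 1) / exp t) \<partial>lborel)"
    by (rule Gamma_conv_nn_integral_real[OF s])
  also have "\<dots> = ennreal \<bar>a\<bar> * (\<integral>\<^sup>+t. ennreal (indicator {0..} (0 + a * t) * (0 + a * t) powr (s - 1) / exp (0 + a * t)) \<partial>lborel)"
    by (rule nn_integral_real_affine) (use a in auto)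
  also have "\<dots> = (\<integral>\<^sup>+t. ennreal \<bar>a\<bar> * ennreal (indicator {0..} (0 + a * t) * (0 + a * t) powr (s - 1) / exp (0 + a * t)) \<partial>lborel)"
    by (subst nn_integral_cmult) auto
  also have "\<dots> = (\<integral>\<^sup>+t. ennreal (a powr s) * (ennreal (t powr (s - 1) * exp (- (a * t))) * indicator {0<..} t) \<partial>lborel)"
    by (rule nn_integral_cong_AE, rule eventually_mono[OF AE_lborel_singleton[of 0]])
       (use a in \<open>auto simp: indicator_def powr_mult powr_diff exp_minus field_simps zero_less_mult_iff zero_le_mult_iff simp flip: ennreal_mult'\<close>)
  also have "\<dots> = ennreal (a powr s) * (\<integral>\<^sup>+t. ennreal (t powr (s - 1) * exp (- (a * t))) * indicator {0<..} t \<partial>lborel)"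
    by (subst nn_integral_cmult) auto
  finally have "ennreal (a powr (-s)) * ennreal (Gamma s) = ennreal (a powr (-s)) * (ennreal (a powr s) * (\<integral>\<^sup>+t. ennreal (t powr (s - 1) * exp (- (a * t))) * indicator {0<..} t \<partial>lborel))"
    by simp
  also have "\<dots> = (\<integral>\<^sup>+t. ennreal (t powr (s - 1) * exp (- (a * t))) * indicator {0<..} t \<partial>lborel)"
    using a by (simp add: mult.assoc[symmetric] ennreal_mult'[symmetric] powr_add[symmetric])
  finally show ?thesis using s by (simp add: ennreal_mult'[symmetric] mult.commute)
qed

lemma nn_integral_exp_square_Gamma:
  fixes s :: real assumes s: "s > 0"
  shows "(\<integral>\<^sup>+x. ennreal (x powr (s - 1) * exp (- x\<^sup>2)) * indicator {0<..} x \<partial>lborel)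
     = ennreal (Gamma (s / 2) / 2)"
proof -
  have 0: "((\<lambda>t. t powr (s/2 - 1) / exp t) has_integral Gamma (s/2)) {0<..}"
  proof -
    have "((\<lambda>t. t powr (s/2 - 1) / exp t) has_integral Gamma (s/2)) {0..}"
      by (rule Gamma_integral_real) (use s in auto)
    then have "((\<lambda>t. if t \<in> {0<..} then t powr (s/2 - 1) / exp t else 0) has_integral Gamma (s/2)) {0..}"
      by (rule has_integral_spike[of "{0}", rotated 2]) auto
    then show ?thesis
      by (subst (asm) has_integral_restrict) auto
  qed
  have ai: "(\<lambda>t. t powr (s/2 - 1) / exp t) absolutely_integrable_on {0<..}"
    by (rule nonnegative_absolutely_integrable_1) (use 0 in auto)
  have im: "(\<lambda>x. x\<^sup>2) ` {0<..} = {0::real<..}"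
  proof safe
    fix x :: real assume "x > 0"
    then show "x \<in> (\<lambda>x. x\<^sup>2) ` {0<..}" by (intro image_eqI[of _ _ "sqrt x"]) auto
  qed auto
  have cv: "((\<lambda>x. \<bar>2 * x\<bar> * ((x\<^sup>2) powr (s/2 - 1) / exp (x\<^sup>2))) absolutely_integrable_on {0<..} \<and>
        integral {0<..} (\<lambda>x. \<bar>2 * x\<bar> * ((x\<^sup>2) powr (s/2 - 1) / exp (x\<^sup>2))) = Gamma (s/2)) \<longleftrightarrow>
     ((\<lambda>t. t powr (s/2 - 1) / exp t) absolutely_integrable_on (\<lambda>x. x\<^sup>2) ` {0<..} \<and>
        integral ((\<lambda>x. x\<^sup>2) ` {0<..}) (\<lambda>t. t powr (s/2 - 1) / exp t) = Gamma (s/2))"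
  proof (rule has_absolute_integral_change_of_variables_1')
    show "((\<lambda>x. x\<^sup>2) has_real_derivative 2 * x) (at x within {0<..})" for x :: real
      by (auto intro!: derivative_eq_intros)
    show "inj_on (\<lambda>x::real. x\<^sup>2) {0<..}"
      by (rule inj_onI) (simp add: power2_eq_iff_nonneg)
  qed simp
  have "(\<lambda>x. \<bar>2 * x\<bar> * ((x\<^sup>2) powr (s/2 - 1) / exp (x\<^sup>2))) absolutely_integrable_on {0<..} \<and>
        integral {0<..} (\<lambda>x. \<bar>2 * x\<bar> * ((x\<^sup>2) powr (s/2 - 1) / exp (x\<^sup>2))) = Gamma (s/2)"
    unfolding cv im using ai integral_unique[OF 0] by blast
  then have "((\<lambda>x. \<bar>2 * x\<bar> * ((x\<^sup>2) powr (s/2 - 1) / exp (x\<^sup>2))) has_integral Gamma (s/2)) {0<..}"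
    using integrable_integral[OF set_lebesgue_integral_eq_integral(1)] by fastforce
  then have "((\<lambda>x. 2 * (x powr (s - 1) * exp (- x\<^sup>2))) has_integral Gamma (s/2)) {0<..}"
  proof (rule has_integral_eq[rotated])
    fix x :: real assume "x \<in> {0<..}"
    then have x: "x > 0" by simp
    have "(x\<^sup>2) powr (s/2 - 1) = x powr (s - 2)"
      using x by (simp add: powr_numeral[symmetric] powr_powr algebra_simps del: powr_numeral)
    moreover have "x * x powr (s - 2) = x powr (s - 1)"
      using x powr_add[of x 1 "s - 2"] by simp
    ultimately show "\<bar>2 * x\<bar> * ((x\<^sup>2) powr (s/2 - 1) / exp (x\<^sup>2)) = 2 * (x powr (s - 1) * exp (- x\<^sup>2))"
      using x by (simp add: exp_minus field_simps)
  qed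
  then have "((\<lambda>x. x powr (s - 1) * exp (- x\<^sup>2)) has_integral Gamma (s/2) / 2) {0<..}"
    by (auto dest: has_integral_divide[where c=2])
  from nn_integral_has_integral_lebesgue[OF _ this]
  have "(\<integral>\<^sup>+x. ennreal (indicator {0<..} x * (x powr (s - 1) * exp (- x\<^sup>2))) \<partial>lborel) = ennreal (Gamma (s / 2) / 2)"
    by simp
  also have "(\<integral>\<^sup>+x. ennreal (indicator {0<..} x * (x powr (s - 1) * exp (- x\<^sup>2))) \<partial>lborel)
     = (\<integral>\<^sup>+x. ennreal (x powr (s - 1) * exp (- x\<^sup>2)) * indicator {0<..} x \<partial>lborel)"
    by (rule nn_integral_cong) (simp add: indicator_def)
  finally show ?thesis .
qed

lemma nn_integral_exp_square_scale_Gamma: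
  fixes s v :: real assumes s: "s > 0" and v: "v > 0"
  shows "(\<integral>\<^sup>+x. ennreal (x powr (s - 1) * exp (- (v * x\<^sup>2))) * indicator {0<..} x \<partial>lborel)
     = ennreal (Gamma (s / 2) / 2 * v powr (- (s / 2)))"
proof -
  define a where "a = sqrt v"
  have a: "a > 0" and a2: "a\<^sup>2 = v" using v by (auto simp: a_def)
  let ?I = "\<integral>\<^sup>+t. ennreal (t powr (s - 1) * exp (- (v * t\<^sup>2))) * indicator {0<..} t \<partial>lborel"
  have "ennreal (Gamma (s / 2) / 2) = (\<integral>\<^sup>+x. ennreal (x powr (s - 1) * exp (- x\<^sup>2)) * indicator {0<..} x \<partial>lborel)"
    by (rule nn_integral_exp_square_Gamma[OF s, symmetric])
  also have "\<dots> = ennreal \<bar>a\<bar> * (\<integral>\<^sup>+x. ennreal ((0 + a * x) powr (s - 1) * exp (- (0 + a * x)\<^sup>2)) * indicator {0<..} (0 + a * x) \<partial>lborel)"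
    by (rule nn_integral_real_affine) (use a in auto)
  also have "\<dots> = (\<integral>\<^sup>+x. ennreal \<bar>a\<bar> * (ennreal ((0 + a * x) powr (s - 1) * exp (- (0 + a * x)\<^sup>2)) * indicator {0<..} (0 + a * x)) \<partial>lborel)"
    by (subst nn_integral_cmult) auto
  also have "\<dots> = (\<integral>\<^sup>+t. ennreal (a powr s) * (ennreal (t powr (s - 1) * exp (- (v * t\<^sup>2))) * indicator {0<..} t) \<partial>lborel)"
    by (rule nn_integral_cong)
       (use a in \<open>auto simp: indicator_def powr_mult powr_diff exp_minus field_simps zero_less_mult_iff a2[symmetric] simp flip: ennreal_mult'\<close>)
  also have "\<dots> = ennreal (a powr s) * ?I"
    by (subst nn_integral_cmult) auto
  finally have "ennreal (a powr (-s)) * ennreal (Gamma (s / 2) / 2) = ennreal (a powr (-s)) * (ennreal (a powr s) * ?I)"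
    by simp
  also have "\<dots> = ?I"
    using a by (simp add: mult.assoc[symmetric] ennreal_mult'[symmetric] powr_add[symmetric])
  also have "a powr (- s) = v powr (- (s / 2))"
    using v by (simp add: a_def powr_half_sqrt[symmetric] powr_powr)
  finally show ?thesis using s by (simp add: ennreal_mult'[symmetric] mult.commute)
qed

lemma nn_integral_one_minus_cos_exp:
  fixes y :: real assumes y: "y > 0"
  shows "(\<integral>\<^sup>+x. ennreal ((1 - cos x) * exp (- (x * y))) * indicator {0..} x \<partial>lborel)
     = ennreal (1 / (y * (1 + y\<^sup>2)))"
proof -
  define F where "F x = - (exp (- (x * y)) / y) - exp (- (x * y)) * (sin x - y * cos x) / (1 + y\<^sup>2)" for x :: real
  have y2: "1 + y\<^sup>2 > 0" by (simp add: add_pos_nonneg)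
  have "(\<integral>\<^sup>+x. ennreal ((1 - cos x) * exp (- (x * y))) * indicator {0..} x \<partial>lborel) = ennreal (0 - F 0)"
  proof (rule nn_integral_FTC_atLeast)
    fix x :: real
    have "DERIV F x :> exp (- (x * y)) - (- y * exp (- (x * y)) * (sin x - y * cos x)
             + exp (- (x * y)) * (cos x + y * sin x)) / (1 + y\<^sup>2)"
      unfolding F_def using y y2
      by (auto intro!: derivative_eq_intros simp del: power2_eq_square) (simp add: field_simps)?
    also have "exp (- (x * y)) - (- y * exp (- (x * y)) * (sin x - y * cos x)
             + exp (- (x * y)) * (cos x + y * sin x)) / (1 + y\<^sup>2) = (1 - cos x) * exp (- (x * y))"
      using y2 by (simp add: divide_simps) (simp add: algebra_simps power2_eq_square)
    finally show "DERIV F x :> (1 - cos x) * exp (- (x * y))" .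
  next
    have e: "((\<lambda>x. exp (- (x * y))) \<longlongrightarrow> 0) at_top"
      using y by real_asymp
    have "((\<lambda>x. exp (- (x * y)) * (1 / y + (1 + y) / (1 + y\<^sup>2))) \<longlongrightarrow> 0) at_top"
      using tendsto_mult_right[OF e, of "1 / y + (1 + y) / (1 + y\<^sup>2)"] by simp
    moreover have "norm (F x) \<le> exp (- (x * y)) * (1 / y + (1 + y) / (1 + y\<^sup>2))" for x
    proof -
      have "\<bar>sin x - y * cos x\<bar> \<le> \<bar>sin x\<bar> + \<bar>y * cos x\<bar>" by linarith
      also have "\<dots> \<le> 1 + y * 1" using y by (auto simp: abs_mult intro!: add_mono mult_left_mono)
      finally have 1: "\<bar>sin x - y * cos x\<bar> \<le> 1 + y" by simp
      have "norm (F x) \<le> \<bar>exp (- (x * y)) / y\<bar> + \<bar>exp (- (x * y)) * (sin x - y * cos x) / (1 + y\<^sup>2)\<bar>"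
        unfolding F_def real_norm_def using abs_triangle_ineq4[of "- (exp (- (x * y)) / y)" "exp (- (x * y)) * (sin x - y * cos x) / (1 + y\<^sup>2)"] by simp
      also have "\<dots> = exp (- (x * y)) * (1 / y) + exp (- (x * y)) * (\<bar>sin x - y * cos x\<bar> / (1 + y\<^sup>2))"
        using y y2 by (simp add: abs_mult)
      also have "\<dots> \<le> exp (- (x * y)) * (1 / y) + exp (- (x * y)) * ((1 + y) / (1 + y\<^sup>2))"
        using 1 y2 by (intro add_left_mono mult_left_mono divide_right_mono) auto
      finally show ?thesis by (simp add: algebra_simps)
    qed
    ultimately show "(F \<longlongrightarrow> 0) at_top"
      by (rule_tac Lim_null_comparison[where g="\<lambda>x. exp (- (x * y)) * (1 / y + (1 + y) / (1 + y\<^sup>2))"])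
         (simp_all only: eventually_True)
  qed (use y in auto)
  also have "0 - F 0 = 1 / (y * (1 + y\<^sup>2))"
    using y y2 by (simp add: F_def divide_simps) (simp add: algebra_simps power2_eq_square)
  finally show ?thesis .
qed

text \<open>
  The value of the integral of \<open>(1 - cos x) x\<^sup>-\<^sup>1\<^sup>-\<^sup>\<alpha>\<close> over \<open>(0, \<infinity>)\<close>, by \<open>nn_integral_one_minus_cos_powr\<close>.
\<close>

definition cosine_integral :: "real \<Rightarrow> real" where
  "cosine_integral \<alpha> = Gamma (\<alpha> / 2) * Gamma (1 - \<alpha> / 2) / (2 * Gamma (1 + \<alpha>))"

lemma cosine_integral_pos: "0 < \<alpha> \<Longrightarrow> \<alpha> < 2 \<Longrightarrow> cosine_integral \<alpha> > 0"
  by (simp add: cosine_integral_def)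

text \<open>
  Writing \<open>\<Gamma>(1 + \<alpha>) x\<^sup>-\<^sup>1\<^sup>-\<^sup>\<alpha>\<close> as \<open>\<integral> y\<^sup>\<alpha> e\<^sup>-\<^sup>x\<^sup>y dy\<close> and \<open>1/(1 + y\<^sup>2)\<close> as \<open>\<integral> e\<^sup>-\<^sup>v\<^sup>(\<^sup>1\<^sup>+\<^sup>y\<^sup>2\<^sup>) dv\<close>, two
  applications of Tonelli's theorem leave only Gamma integrals. The computation is the same for all \<open>0 < \<alpha> < 2\<close>,
  so that \<open>\<alpha> = 1\<close> is no exception.
\<close>

lemma nn_integral_one_minus_cos_powr:
  fixes \<alpha> :: real assumes a: "0 < \<alpha>" "\<alpha> < 2"
  shows "(\<integral>\<^sup>+x. ennreal ((1 - cos x) * x powr (- 1 - \<alpha>)) * indicator {0<..} x \<partial>lborel)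
     = ennreal (cosine_integral \<alpha>)"
proof -
  let ?I = "\<integral>\<^sup>+x. ennreal ((1 - cos x) * x powr (- 1 - \<alpha>)) * indicator {0<..} x \<partial>lborel"
  have "ennreal (Gamma (1 + \<alpha>)) * ?I = (\<integral>\<^sup>+x. ennreal (Gamma (1 + \<alpha>)) * (ennreal ((1 - cos x) * x powr (- 1 - \<alpha>)) * indicator {0<..} x) \<partial>lborel)"
    by (subst nn_integral_cmult) auto
  also have "\<dots> = (\<integral>\<^sup>+x. (\<integral>\<^sup>+y. ennreal ((1 - cos x) * (y powr \<alpha> * exp (- (x * y)))) * indicator {0<..} x * indicator {0<..} y \<partial>lborel) \<partial>lborel)"
  proof (rule nn_integral_cong)
    fix x :: real
    show "ennreal (Gamma (1 + \<alpha>)) * (ennreal ((1 - cos x) * x powr (- 1 - \<alpha>)) * indicator {0<..} x) =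
      (\<integral>\<^sup>+y. ennreal ((1 - cos x) * (y powr \<alpha> * exp (- (x * y)))) * indicator {0<..} x * indicator {0<..} y \<partial>lborel)"
    proof (cases "x > 0")
      case True
      have "(\<integral>\<^sup>+y. ennreal ((1 - cos x) * (y powr \<alpha> * exp (- (x * y)))) * indicator {0<..} x * indicator {0<..} y \<partial>lborel)
        = (\<integral>\<^sup>+y. ennreal (1 - cos x) * (ennreal (y powr ((1 + \<alpha>) - 1) * exp (- (x * y))) * indicator {0<..} y) \<partial>lborel)"
        using True by (intro nn_integral_cong) (simp add: ennreal_mult' mult.assoc)
      also have "\<dots> = ennreal (1 - cos x) * ennreal (Gamma (1 + \<alpha>) * x powr (- (1 + \<alpha>)))"
        using True a by (subst nn_integral_cmult, simp, subst nn_integral_exp_Gamma) auto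
      also have "\<dots> = ennreal (Gamma (1 + \<alpha>)) * (ennreal ((1 - cos x) * x powr (- 1 - \<alpha>)) * indicator {0<..} x)"
        using True a by (simp add: ennreal_mult'[symmetric] mult_ac)
      finally show ?thesis by simp
    qed simp
  qed
  also have "\<dots> = (\<integral>\<^sup>+y. (\<integral>\<^sup>+x. ennreal ((1 - cos x) * (y powr \<alpha> * exp (- (x * y)))) * indicator {0<..} x * indicator {0<..} y \<partial>lborel) \<partial>lborel)"
    by (subst lborel_pair.Fubini') (auto simp: case_prod_unfold)
  also have "\<dots> = (\<integral>\<^sup>+y. (\<integral>\<^sup>+v. ennreal (y powr (\<alpha> - 1) * (exp (- v) * exp (- (v * y\<^sup>2)))) * indicator {0<..} v * indicator {0<..} y \<partial>lborel) \<partial>lborel)"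
  proof (rule nn_integral_cong)
    fix y :: real
    show "(\<integral>\<^sup>+x. ennreal ((1 - cos x) * (y powr \<alpha> * exp (- (x * y)))) * indicator {0<..} x * indicator {0<..} y \<partial>lborel)
     = (\<integral>\<^sup>+v. ennreal (y powr (\<alpha> - 1) * (exp (- v) * exp (- (v * y\<^sup>2)))) * indicator {0<..} v * indicator {0<..} y \<partial>lborel)"
    proof (cases "y > 0")
      case True
      have y2: "1 + y\<^sup>2 > 0" by (simp add: add_pos_nonneg)
      have "(\<integral>\<^sup>+x. ennreal ((1 - cos x) * (y powr \<alpha> * exp (- (x * y)))) * indicator {0<..} x * indicator {0<..} y \<partial>lborel)
         = (\<integral>\<^sup>+x. ennreal (y powr \<alpha>) * (ennreal ((1 - cos x) * exp (- (x * y))) * indicator {0..} x) \<partial>lborel)"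
        using True by (intro nn_integral_cong) (auto simp: indicator_def ennreal_mult'[symmetric] mult_ac)
      also have "\<dots> = ennreal (y powr \<alpha>) * ennreal (1 / (y * (1 + y\<^sup>2)))"
        using True by (subst nn_integral_cmult, simp, subst nn_integral_one_minus_cos_exp) auto
      also have "\<dots> = ennreal (y powr (\<alpha> - 1)) * ennreal (Gamma 1 * (1 + y\<^sup>2) powr (- 1))"
        using True y2 by (simp add: ennreal_mult'[symmetric] powr_diff powr_minus field_simps)
      also have "\<dots> = (\<integral>\<^sup>+v. ennreal (y powr (\<alpha> - 1)) * (ennreal (v powr (1 - 1) * exp (- ((1 + y\<^sup>2) * v))) * indicator {0<..} v) \<partial>lborel)"
        by (subst nn_integral_cmult, simp, subst nn_integral_exp_Gamma[OF _ y2]) auto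
      also have "\<dots> = (\<integral>\<^sup>+v. ennreal (y powr (\<alpha> - 1) * (exp (- v) * exp (- (v * y\<^sup>2)))) * indicator {0<..} v * indicator {0<..} y \<partial>lborel)"
        using True by (intro nn_integral_cong) (auto simp: indicator_def ennreal_mult'[symmetric] exp_add[symmetric] algebra_simps)
      finally show ?thesis .
    qed simp
  qed
  also have "\<dots> = (\<integral>\<^sup>+v. (\<integral>\<^sup>+y. ennreal (y powr (\<alpha> - 1) * (exp (- v) * exp (- (v * y\<^sup>2)))) * indicator {0<..} v * indicator {0<..} y \<partial>lborel) \<partial>lborel)"
    by (subst lborel_pair.Fubini') (auto simp: case_prod_unfold)
  also have "\<dots> = (\<integral>\<^sup>+v. ennreal (Gamma (\<alpha> / 2) / 2) * (ennreal (v powr ((1 - \<alpha> / 2) - 1) * exp (- (1 * v))) * indicator {0<..} v) \<partial>lborel)"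
  proof (rule nn_integral_cong)
    fix v :: real
    show "(\<integral>\<^sup>+y. ennreal (y powr (\<alpha> - 1) * (exp (- v) * exp (- (v * y\<^sup>2)))) * indicator {0<..} v * indicator {0<..} y \<partial>lborel)
      = ennreal (Gamma (\<alpha> / 2) / 2) * (ennreal (v powr ((1 - \<alpha> / 2) - 1) * exp (- (1 * v))) * indicator {0<..} v)"
    proof (cases "v > 0")
      case True
      have "(\<integral>\<^sup>+y. ennreal (y powr (\<alpha> - 1) * (exp (- v) * exp (- (v * y\<^sup>2)))) * indicator {0<..} v * indicator {0<..} y \<partial>lborel)
        = (\<integral>\<^sup>+y. ennreal (exp (- v)) * (ennreal (y powr (\<alpha> - 1) * exp (- (v * y\<^sup>2))) * indicator {0<..} y) \<partial>lborel)"
        using True by (intro nn_integral_cong) (auto simp: indicator_def ennreal_mult'[symmetric] mult_ac)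
      also have "\<dots> = ennreal (exp (- v)) * ennreal (Gamma (\<alpha> / 2) / 2 * v powr (- (\<alpha> / 2)))"
        using True a by (subst nn_integral_cmult, simp, subst nn_integral_exp_square_scale_Gamma) auto
      also have "\<dots> = ennreal (Gamma (\<alpha> / 2) / 2) * (ennreal (v powr ((1 - \<alpha> / 2) - 1) * exp (- (1 * v))) * indicator {0<..} v)"
        using True a by (simp add: ennreal_mult'[symmetric] mult_ac)
      finally show ?thesis .
    qed simp
  qed
  also have "\<dots> = ennreal (Gamma (\<alpha> / 2) / 2) * ennreal (Gamma (1 - \<alpha> / 2) * 1 powr (- (1 - \<alpha> / 2)))"
    using a by (subst nn_integral_cmult, simp, subst nn_integral_exp_Gamma) auto
  finally have "ennreal (1 / Gamma (1 + \<alpha>)) * (ennreal (Gamma (1 + \<alpha>)) * ?I) = ennreal (1 / Gamma (1 + \<alpha>)) * (ennreal (Gamma (\<alpha> / 2) / 2) * ennreal (Gamma (1 - \<alpha> / 2)))"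
    by simp
  moreover have "ennreal (1 / Gamma (1 + \<alpha>)) * (ennreal (Gamma (1 + \<alpha>)) * ?I) = ?I"
    using a Gamma_real_pos[of "1 + \<alpha>"] by (simp add: mult.assoc[symmetric] ennreal_mult'[symmetric] less_imp_neq[symmetric])
  ultimately show ?thesis
    using a by (simp add: cosine_integral_def ennreal_mult'[symmetric] mult_ac)
qed

lemma Gamma_reflection_real:
  fixes x :: real
  shows "Gamma x * Gamma (1 - x) = pi / sin (pi * x)"
proof -
  have "complex_of_real (Gamma x * Gamma (1 - x)) = of_real (pi / sin (pi * x))"
    using Gamma_reflection_complex[of "of_real x"]
    by (simp add: Gamma_complex_of_real[symmetric] sin_of_real[symmetric])
  then show ?thesis by (simp only: of_real_eq_iff)
qed

text \<open>
  The reflection formula at \<open>\<alpha>/2\<close> and at \<open>\<alpha>\<close> shows that both branches of \<open>stable_const\<close> are values of one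
  expression.
\<close>

lemma stable_const_eq:
  fixes \<alpha> :: real assumes a: "0 < \<alpha>" "\<alpha> < 2"
  shows "stable_const \<alpha> = 1 / (\<alpha> * cosine_integral \<alpha>)"
proof -
  have G1: "Gamma (1 + \<alpha>) = \<alpha> * Gamma \<alpha>"
    using Gamma_plus1[of \<alpha>] a by (simp add: add.commute) (force dest: nonpos_Ints_nonpos)
  have Gpos: "Gamma \<alpha> > 0" using a by simp
  have sp: "sin (pi * (\<alpha> / 2)) > 0"
    using a by (intro sin_gt_zero) auto
  have ci: "cosine_integral \<alpha> = pi / (2 * \<alpha> * Gamma \<alpha> * sin (pi * (\<alpha> / 2)))"
    unfolding cosine_integral_def Gamma_reflection_real[of "\<alpha> / 2"] G1 by simp
  show ?thesis
  proof (cases "\<alpha> = 1")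
    case True
    then have "cosine_integral \<alpha> = pi / 2" using ci by simp
    then have "1 / (\<alpha> * cosine_integral \<alpha>) = 2 / pi" by (simp only: True) simp
    then show ?thesis using True by (simp only: stable_const_def simp_thms if_True)
  next
    case False
    have "1 - \<alpha> \<notin> \<int>\<^sub>\<le>\<^sub>0"
    proof
      assume "1 - \<alpha> \<in> \<int>\<^sub>\<le>\<^sub>0"
      then obtain k where k: "1 - \<alpha> = - real k" by (auto elim: nonpos_Ints_cases')
      with a False have "0 < k" "k < 1" by linarith+ 
      then show False by simp
    qed
    then have G2: "Gamma (2 - \<alpha>) = (1 - \<alpha>) * Gamma (1 - \<alpha>)"
      using Gamma_plus1[of "1 - \<alpha>"] by (simp add: algebra_simps)
    have sc: "sin (pi * \<alpha>) = 2 * sin (pi * (\<alpha> / 2)) * cos (pi * (\<alpha> / 2))"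
      using sin_double[of "pi * (\<alpha> / 2)"] by (simp add: mult_ac)
    have cz: "cos (pi * (\<alpha> / 2)) \<noteq> 0"
    proof (cases "\<alpha> < 1")
      case True
      then have "pi * (\<alpha> / 2) < pi / 2" "- (pi / 2) < pi * (\<alpha> / 2)"
        using a by (auto simp: field_simps intro: less_trans[of _ 0])
      then show ?thesis using cos_gt_zero_pi by fastforce
    next
      case 2: False
      then have "cos (pi - pi * (\<alpha> / 2)) > 0"
        using a False by (intro cos_gt_zero_pi) (auto simp: field_simps)
      then show ?thesis by simp
    qed
    have "Gamma (1 - \<alpha>) = (Gamma \<alpha> * Gamma (1 - \<alpha>)) / Gamma \<alpha>"
      using Gpos by simp
    then have "Gamma (1 - \<alpha>) = pi / (sin (pi * \<alpha>) * Gamma \<alpha>)"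
      unfolding Gamma_reflection_real by simp
    then have "stable_const \<alpha> = 1 / (pi / (sin (pi * \<alpha>) * Gamma \<alpha>) * cos (pi * \<alpha> / 2))"
      using False by (simp add: stable_const_def G2)
    also have "\<dots> = 1 / (\<alpha> * cosine_integral \<alpha>)"
      unfolding ci sc using a Gpos cz sp by (simp add: field_simps)
    finally show ?thesis .
  qed
qed

section \<open>Fourier transforms of tilted measures\<close>

lemma abs_sinc_le_1: "\<bar>sinc (x::real)\<bar> \<le> 1"
  using abs_sin_x_le_abs_x[of x] by (cases "x = 0") (simp_all add: field_simps)

lemma sinc_le_1: "sinc (x::real) \<le> 1"
  using abs_sinc_le_1[of x] by linarith

lemma sinc_le_half:
  assumes x: "2 \<le> \<bar>x\<bar>" shows "sinc (x::real) \<le> 1 / 2"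
proof -
  have "x \<noteq> 0" using x by auto
  then have "sinc x \<le> \<bar>sin x / x\<bar>" using abs_ge_self[of "sin x / x"] by (simp del: abs_divide)
  also have "\<bar>sin x / x\<bar> = \<bar>sin x\<bar> / \<bar>x\<bar>" by simp
  also have "\<dots> \<le> 1 / 2" using x by (intro frac_le) auto
  finally show ?thesis .
qed

lemma nn_integral_average_one_minus_cos:
  fixes \<theta> x :: real
  shows "(\<integral>\<^sup>+u. ennreal (1 - cos ((\<theta> + u) * x)) * indicator {-1..1} u \<partial>lborel)
     = ennreal (2 * (1 - cos (\<theta> * x)) + 2 * (cos (\<theta> * x) * (1 - sinc x)))"
proof (cases "x = 0")
  case False
  define F where "F u = u - sin ((\<theta> + u) * x) / x" for u :: real
  have "(\<integral>\<^sup>+u. ennreal (1 - cos ((\<theta> + u) * x)) * indicator {-1..1} u \<partial>lborel) = ennreal (F 1 - F (-1))"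
  proof (rule nn_integral_FTC_Icc)
    fix u :: real
    show "DERIV F u :> 1 - cos ((\<theta> + u) * x)"
      unfolding F_def
      using False by (auto intro!: derivative_eq_intros)
  qed auto
  also have "F 1 - F (-1) = 2 - (sin (\<theta> * x + x) - sin (\<theta> * x - x)) / x"
    by (simp add: F_def algebra_simps diff_divide_distrib)
  also have "\<dots> = 2 * (1 - cos (\<theta> * x)) + 2 * (cos (\<theta> * x) * (1 - sinc x))"
    using False by (simp add: sin_add sin_diff field_simps)
  finally show ?thesis .
qed simp

text \<open>
  The measure \<open>m\<close> may be infinite near \<open>0\<close>, as Levy measures are, but \<open>(1 - sinc) m\<close> is finite. Its Fourier
  transform can be read off from the exponent \<open>\<Psi>\<close> of \<open>m\<close>: the average of \<open>1 - cos ((\<theta> + u) x)\<close> over \<open>u \<in> [-1, 1]\<close> is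
  \<open>(1 - cos (\<theta> x)) + cos (\<theta> x) (1 - sinc x)\<close>, and Tonelli's theorem integrates the left-hand side.
\<close>

lemma tilt_integrals:
  fixes m :: "real measure" and \<Psi> :: "real \<Rightarrow> real"
  assumes sf: "sigma_finite_measure m" and sets[measurable_cong, simp]: "sets m = sets borel"
    and Psi: "\<And>u. (\<integral>\<^sup>+x. ennreal (1 - cos (u * x)) \<partial>m) = ennreal (\<Psi> u)" "\<And>u. 0 \<le> \<Psi> u"
    and cont: "continuous_on UNIV \<Psi>"
    and symm: "distr m borel uminus = m"
  shows "integrable m (\<lambda>x. 1 - sinc x)"
    and "(\<integral>x. cos (\<theta> * x) * (1 - sinc x) \<partial>m) = (LBINT u:{-1..1}. \<Psi> (\<theta> + u)) / 2 - \<Psi> \<theta>"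
    and "(\<integral>x. sin (\<theta> * x) * (1 - sinc x) \<partial>m) = 0"
proof -
  interpret m: sigma_finite_measure m by fact
  interpret pair_sigma_finite m lborel by unfold_locales
  have spm[simp]: "space m = UNIV" using sets_eq_imp_space_eq[OF sets] by simp
  have ig: "set_integrable lborel {-1..1} (\<lambda>u. \<Psi> (\<theta> + u))" for \<theta>
    by (rule borel_integrable_atLeastAtMost') (intro continuous_intros continuous_on_compose2[OF cont], auto)
  have main: "(\<integral>\<^sup>+x. ennreal (2 * (1 - cos (\<theta> * x)) + 2 * (cos (\<theta> * x) * (1 - sinc x))) \<partial>m)
     = ennreal (LBINT u:{-1..1}. \<Psi> (\<theta> + u))" for \<theta>
  proof -
    have "(\<integral>\<^sup>+x. ennreal (2 * (1 - cos (\<theta> * x)) + 2 * (cos (\<theta> * x) * (1 - sinc x))) \<partial>m)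
      = (\<integral>\<^sup>+x. (\<integral>\<^sup>+u. ennreal (1 - cos ((\<theta> + u) * x)) * indicator {-1..1} u \<partial>lborel) \<partial>m)"
      by (simp add: nn_integral_average_one_minus_cos)
    also have "\<dots> = (\<integral>\<^sup>+u. (\<integral>\<^sup>+x. ennreal (1 - cos ((\<theta> + u) * x)) * indicator {-1..1} u \<partial>m) \<partial>lborel)"
      by (rule Fubini'[symmetric]) (simp add: case_prod_unfold)
    also have "\<dots> = (\<integral>\<^sup>+u. ennreal (indicator {-1..1} u *\<^sub>R \<Psi> (\<theta> + u)) \<partial>lborel)"
      by (intro nn_integral_cong) (auto simp: nn_integral_multc Psi indicator_def)
    also have "\<dots> = ennreal (LBINT u:{-1..1}. \<Psi> (\<theta> + u))"
      unfolding set_lebesgue_integral_def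
      by (rule nn_integral_eq_integral) (use ig[of \<theta>] Psi(2) in \<open>auto simp: set_integrable_def\<close>)
    finally show ?thesis .
  qed
  \<comment> \<open>The integrand equals \<open>2 (1 - cos (\<theta> x) sinc x)\<close>.\<close>
  have nn: "0 \<le> 2 * (1 - cos (\<theta> * x)) + 2 * (cos (\<theta> * x) * (1 - sinc x))" for \<theta> x :: real
  proof -
    have "0 \<le> 2 * (1 - cos (\<theta> * x) * sinc x)"
    proof -
      have "\<bar>cos (\<theta> * x) * sinc x\<bar> \<le> 1 * 1"
        unfolding abs_mult by (intro mult_mono abs_sinc_le_1) auto
      then show ?thesis by auto
    qed
    then show ?thesis by (simp add: algebra_simps)
  qed
  have Pn: "0 \<le> (LBINT u:{-1..1}. \<Psi> (\<theta> + u))" for \<theta>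
    unfolding set_lebesgue_integral_def using Psi(2) by (intro integral_nonneg_AE AE_I2) auto
  have A: "integrable m (\<lambda>x. 2 * (1 - cos (\<theta> * x)) + 2 * (cos (\<theta> * x) * (1 - sinc x)))"
    "(\<integral>x. 2 * (1 - cos (\<theta> * x)) + 2 * (cos (\<theta> * x) * (1 - sinc x)) \<partial>m) = (LBINT u:{-1..1}. \<Psi> (\<theta> + u))" for \<theta>
    using has_bochner_integral_nn_integral[OF _ AE_I2[OF nn[of \<theta>]] Pn main]
    by (auto simp only: has_bochner_integral_iff) measurable
  have B: "integrable m (\<lambda>x. 1 - cos (\<theta> * x))" "(\<integral>x. 1 - cos (\<theta> * x) \<partial>m) = \<Psi> \<theta>" for \<theta>
    using has_bochner_integral_nn_integral[where f="\<lambda>x. 1 - cos (\<theta> * x)" and M=m, OF _ _ Psi(2) Psi(1)]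
    by (auto simp: has_bochner_integral_iff)
  have "integrable m (\<lambda>x. (2 * (1 - cos (0 * x)) + 2 * (cos (0 * x) * (1 - sinc x))) / 2)"
    using A(1)[of 0] by (rule integrable_divide)
  then show I: "integrable m (\<lambda>x. 1 - sinc x)" by (simp add: diff_divide_distrib)
  have "(\<integral>x. cos (\<theta> * x) * (1 - sinc x) \<partial>m)
    = (\<integral>x. (2 * (1 - cos (\<theta> * x)) + 2 * (cos (\<theta> * x) * (1 - sinc x))) / 2 - (1 - cos (\<theta> * x)) \<partial>m)"
    by (intro Bochner_Integration.integral_cong) (auto simp: field_simps)
  also have "\<dots> = (LBINT u:{-1..1}. \<Psi> (\<theta> + u)) / 2 - \<Psi> \<theta>"
    using A[of \<theta>] B[of \<theta>] by (subst Bochner_Integration.integral_diff) auto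
  finally show "(\<integral>x. cos (\<theta> * x) * (1 - sinc x) \<partial>m) = (LBINT u:{-1..1}. \<Psi> (\<theta> + u)) / 2 - \<Psi> \<theta>" .
  have "(\<integral>x. sin (\<theta> * x) * (1 - sinc x) \<partial>m) = (\<integral>x. sin (\<theta> * x) * (1 - sinc x) \<partial>(distr m borel uminus))"
    by (simp only: symm)
  also have "\<dots> = (\<integral>x. sin (\<theta> * (- x)) * (1 - sinc (- x)) \<partial>m)"
    by (rule integral_distr) auto
  also have "\<dots> = (\<integral>x. - (sin (\<theta> * x) * (1 - sinc x)) \<partial>m)"
    by (intro Bochner_Integration.integral_cong) auto
  also have "\<dots> = - (\<integral>x. sin (\<theta> * x) * (1 - sinc x) \<partial>m)" by simp
  finally show "(\<integral>x. sin (\<theta> * x) * (1 - sinc x) \<partial>m) = 0" by simp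
qed

text \<open>
  Normalised to a probability measure, so that Levy's continuity theorem applies to it.
\<close>

lemma tilt_distribution:
  fixes m :: "real measure" and \<Psi> :: "real \<Rightarrow> real"
  assumes sf: "sigma_finite_measure m" and sets[measurable_cong, simp]: "sets m = sets borel"
    and Psi: "\<And>u. (\<integral>\<^sup>+x. ennreal (1 - cos (u * x)) \<partial>m) = ennreal (\<Psi> u)" "\<And>u. 0 \<le> \<Psi> u"
    and cont: "continuous_on UNIV \<Psi>"
    and symm: "distr m borel uminus = m"
    and k: "k = (LBINT u:{-1..1}. \<Psi> u) / 2" "k > 0"
  shows "real_distribution (density m (\<lambda>x. (1 - sinc x) / k))"
    and "char (density m (\<lambda>x. (1 - sinc x) / k)) \<theta> = of_real (((LBINT u:{-1..1}. \<Psi> (\<theta> + u)) / 2 - \<Psi> \<theta>) / k)"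
    and "f \<in> borel_measurable borel \<Longrightarrow> integral\<^sup>L (density m (\<lambda>x. (1 - sinc x) / k)) (f :: real \<Rightarrow> real) = (\<integral>x. (1 - sinc x) * f x \<partial>m) / k"
proof -
  note T = tilt_integrals[OF sf sets Psi cont symm]
  have spm[simp]: "space m = UNIV" using sets_eq_imp_space_eq[OF sets] by simp
  have nn: "0 \<le> (1 - sinc x) / k" for x using sinc_le_1[of x] k(2) by simp
  have P0: "\<Psi> 0 = 0" using Psi[of 0] by simp
  have i1: "(\<integral>x. 1 - sinc x \<partial>m) = k"
    using T(2)[of 0] k(1) P0 by simp
  have "(\<integral>\<^sup>+x. ennreal ((1 - sinc x) / k) \<partial>m) = ennreal (\<integral>x. (1 - sinc x) / k \<partial>m)"
    using nn T(1) by (intro nn_integral_eq_integral) auto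
  also have "\<dots> = 1" using i1 k(2) by simp
  finally have e1: "(\<integral>\<^sup>+x. ennreal ((1 - sinc x) / k) \<partial>m) = 1" .
  interpret D: prob_space "density m (\<lambda>x. (1 - sinc x) / k)"
    by (rule prob_spaceI) (simp add: emeasure_density e1)
  show rd: "real_distribution (density m (\<lambda>x. (1 - sinc x) / k))"
    by unfold_locales auto
  show f: "integral\<^sup>L (density m (\<lambda>x. (1 - sinc x) / k)) (f :: real \<Rightarrow> real) = (\<integral>x. (1 - sinc x) * f x \<partial>m) / k"
    if [measurable]: "f \<in> borel_measurable borel" for f
    using nn by (subst integral_density) auto
  have "char (density m (\<lambda>x. (1 - sinc x) / k)) \<theta> = 
     (CLINT x|density m (\<lambda>x. (1 - sinc x) / k). complex_of_real (cos (\<theta> * x)) + \<i> * complex_of_real (sin (\<theta> * x)))"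
    unfolding char_def by (intro Bochner_Integration.integral_cong) (auto simp: complex_eq_iff Re_exp Im_exp)
  also have "\<dots> = complex_of_real (\<integral>x. cos (\<theta> * x) \<partial>density m (\<lambda>x. (1 - sinc x) / k)) + \<i> * complex_of_real (\<integral>x. sin (\<theta> * x) \<partial>density m (\<lambda>x. (1 - sinc x) / k))"
    by (subst Bochner_Integration.integral_add)
       (auto intro!: D.integrable_const_bound[where B=1] simp: norm_mult)
  also have "(\<integral>x. cos (\<theta> * x) \<partial>density m (\<lambda>x. (1 - sinc x) / k)) = ((LBINT u:{-1..1}. \<Psi> (\<theta> + u)) / 2 - \<Psi> \<theta>) / k"
    using T(2)[of \<theta>] by (subst f) (auto simp: mult.commute)
  also have "(\<integral>x. sin (\<theta> * x) \<partial>density m (\<lambda>x. (1 - sinc x) / k)) = 0"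
    using T(3)[of \<theta>] by (subst f) (auto simp: mult.commute)
  finally show "char (density m (\<lambda>x. (1 - sinc x) / k)) \<theta> = of_real (((LBINT u:{-1..1}. \<Psi> (\<theta> + u)) / 2 - \<Psi> \<theta>) / k)"
    by simp
qed

section \<open>Symmetric stable laws\<close>

lemma nn_integral_even:
  fixes g :: "real \<Rightarrow> ennreal"
  assumes [measurable]: "g \<in> borel_measurable borel" and even: "\<And>x. g (- x) = g x"
  shows "(\<integral>\<^sup>+x. g x \<partial>lborel) = 2 * (\<integral>\<^sup>+x. g x * indicator {0<..} x \<partial>lborel)"
proof -
  have "(\<integral>\<^sup>+x. g x \<partial>lborel) = (\<integral>\<^sup>+x. g x * indicator {0<..} x + g x * indicator {..<0} x \<partial>lborel)"
    by (rule nn_integral_cong_AE, rule eventually_mono[OF AE_lborel_singleton[of 0]]) (auto simp: indicator_def)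
  also have "\<dots> = (\<integral>\<^sup>+x. g x * indicator {0<..} x \<partial>lborel) + (\<integral>\<^sup>+x. g x * indicator {..<0} x \<partial>lborel)"
    by (rule nn_integral_add) auto
  also have "(\<integral>\<^sup>+x. g x * indicator {..<0} x \<partial>lborel) = ennreal \<bar>-1\<bar> * (\<integral>\<^sup>+x. g (0 + (-1) * x) * indicator {..<0} (0 + (-1) * x) \<partial>lborel)"
    by (rule nn_integral_real_affine) auto
  also have "\<dots> = (\<integral>\<^sup>+x. g x * indicator {0<..} x \<partial>lborel)"
    by (auto simp: even indicator_def intro!: nn_integral_cong)
  finally show ?thesis by (simp add: mult_2)
qed

text \<open>
  The Levy measure of the law with characteristic function \<open>exp (- |\<theta>|\<^sup>\<alpha>)\<close>; the factor makes its exponent exactly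
  \<open>|\<theta>|\<^sup>\<alpha>\<close>.
\<close>

definition stable_levy_measure :: "real \<Rightarrow> real measure" where
  "stable_levy_measure \<alpha> = density lborel (\<lambda>x. ennreal (\<bar>x\<bar> powr (- 1 - \<alpha>) / (2 * cosine_integral \<alpha>)))"

lemma sets_stable_levy_measure[measurable_cong, simp]: "sets (stable_levy_measure \<alpha>) = sets borel"
  by (simp add: stable_levy_measure_def)

lemma nn_integral_stable_levy_measure:
  assumes a: "0 < \<alpha>" "\<alpha> < 2" and [measurable]: "g \<in> borel_measurable borel" and even: "\<And>x. g (- x) = g x"
  shows "(\<integral>\<^sup>+x. g x \<partial>stable_levy_measure \<alpha>) = ennreal (1 / cosine_integral \<alpha>) * (\<integral>\<^sup>+x. ennreal (x powr (- 1 - \<alpha>)) * g x * indicator {0<..} x \<partial>lborel)"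
proof -
  have "(\<integral>\<^sup>+x. g x \<partial>stable_levy_measure \<alpha>) = (\<integral>\<^sup>+x. ennreal (\<bar>x\<bar> powr (- 1 - \<alpha>) / (2 * cosine_integral \<alpha>)) * g x \<partial>lborel)"
    unfolding stable_levy_measure_def by (subst nn_integral_density) auto
  also have "\<dots> = 2 * (\<integral>\<^sup>+x. ennreal (\<bar>x\<bar> powr (- 1 - \<alpha>) / (2 * cosine_integral \<alpha>)) * g x * indicator {0<..} x \<partial>lborel)"
    by (rule nn_integral_even) (auto simp: even)
  also have "(\<integral>\<^sup>+x. ennreal (\<bar>x\<bar> powr (- 1 - \<alpha>) / (2 * cosine_integral \<alpha>)) * g x * indicator {0<..} x \<partial>lborel)
    = (\<integral>\<^sup>+x. ennreal (1 / (2 * cosine_integral \<alpha>)) * (ennreal (x powr (- 1 - \<alpha>)) * g x * indicator {0<..} x) \<partial>lborel)"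
    using cosine_integral_pos[OF a]
    by (intro nn_integral_cong) (auto simp: indicator_def ennreal_mult'[symmetric] mult.assoc[symmetric])
  also have "\<dots> = ennreal (1 / (2 * cosine_integral \<alpha>)) * (\<integral>\<^sup>+x. ennreal (x powr (- 1 - \<alpha>)) * g x * indicator {0<..} x \<partial>lborel)"
    by (rule nn_integral_cmult) auto
  also have "2 * \<dots> = (ennreal 2 * ennreal (1 / (2 * cosine_integral \<alpha>))) * (\<integral>\<^sup>+x. ennreal (x powr (- 1 - \<alpha>)) * g x * indicator {0<..} x \<partial>lborel)"
    by (simp add: mult.assoc)
  also have "ennreal 2 * ennreal (1 / (2 * cosine_integral \<alpha>)) = ennreal (1 / cosine_integral \<alpha>)"
    by (subst ennreal_mult'[symmetric]) auto
  finally show ?thesis .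
qed

lemma stable_levy_measure_exponent:
  assumes a: "0 < \<alpha>" "\<alpha> < 2"
  shows "(\<integral>\<^sup>+x. ennreal (1 - cos (u * x)) \<partial>stable_levy_measure \<alpha>) = ennreal (\<bar>u\<bar> powr \<alpha>)"
proof (cases "u = 0")
  case False
  define v where "v = \<bar>u\<bar>"
  have v: "v > 0" using False by (simp add: v_def)
  have cu: "cos (u * x) = cos (v * x)" for x by (cases "u \<ge> 0") (auto simp: v_def)
  let ?J = "\<integral>\<^sup>+x. ennreal (x powr (- 1 - \<alpha>)) * ennreal (1 - cos (v * x)) * indicator {0<..} x \<partial>lborel"
  have "ennreal (cosine_integral \<alpha>) = ennreal \<bar>v\<bar> * (\<integral>\<^sup>+x. ennreal ((1 - cos (0 + v * x)) * (0 + v * x) powr (- 1 - \<alpha>)) * indicator {0<..} (0 + v * x) \<partial>lborel)"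
    unfolding nn_integral_one_minus_cos_powr[OF a, symmetric]
    by (rule nn_integral_real_affine) (use v in auto)
  also have "\<dots> = (\<integral>\<^sup>+x. ennreal \<bar>v\<bar> * (ennreal ((1 - cos (0 + v * x)) * (0 + v * x) powr (- 1 - \<alpha>)) * indicator {0<..} (0 + v * x)) \<partial>lborel)"
    by (subst nn_integral_cmult) auto
  also have "\<dots> = (\<integral>\<^sup>+x. ennreal (v powr (- \<alpha>)) * (ennreal (x powr (- 1 - \<alpha>)) * ennreal (1 - cos (v * x)) * indicator {0<..} x) \<partial>lborel)"
  proof (rule nn_integral_cong)
    fix x :: real
    have "v * ((1 - cos (v * x)) * (v * x) powr (- 1 - \<alpha>)) = v powr (- \<alpha>) * (x powr (- 1 - \<alpha>) * (1 - cos (v * x)))" if "x > 0"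
    proof -
      have "v * v powr (- 1 - \<alpha>) = v powr (- \<alpha>)"
        using v powr_add[of v 1 "- 1 - \<alpha>"] by simp
      then show ?thesis using that v by (simp add: powr_mult mult_ac)
    qed
    then show "ennreal \<bar>v\<bar> * (ennreal ((1 - cos (0 + v * x)) * (0 + v * x) powr (- 1 - \<alpha>)) * indicator {0<..} (0 + v * x)) 
     = ennreal (v powr (- \<alpha>)) * (ennreal (x powr (- 1 - \<alpha>)) * ennreal (1 - cos (v * x)) * indicator {0<..} x)"
      using v by (auto simp: indicator_def zero_less_mult_iff ennreal_mult'[symmetric])
  qed
  also have "\<dots> = ennreal (v powr (- \<alpha>)) * ?J"
    by (rule nn_integral_cmult) auto
  finally have "ennreal (v powr \<alpha>) * ennreal (cosine_integral \<alpha>) = ennreal (v powr \<alpha>) * (ennreal (v powr (- \<alpha>)) * ?J)"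
    by simp
  also have "\<dots> = ?J"
    using v by (simp add: mult.assoc[symmetric] ennreal_mult'[symmetric] powr_add[symmetric])
  finally have J: "?J = ennreal (v powr \<alpha>) * ennreal (cosine_integral \<alpha>)" ..
  have "(\<integral>\<^sup>+x. ennreal (1 - cos (u * x)) \<partial>stable_levy_measure \<alpha>) = ennreal (1 / cosine_integral \<alpha>) * ?J"
    unfolding cu by (rule nn_integral_stable_levy_measure[OF a]) auto
  also have "\<dots> = ennreal (v powr \<alpha>)"
    unfolding J using cosine_integral_pos[OF a] by (simp add: ennreal_mult'[symmetric])
  finally show ?thesis by (simp add: v_def)
qed (use a in simp)

lemma stable_levy_measure_tail:
  assumes a: "0 < \<alpha>" "\<alpha> < 2" and x: "x > 0"
  shows "emeasure (stable_levy_measure \<alpha>) {y. x < \<bar>y\<bar>} = ennreal (stable_const \<alpha> * x powr (- \<alpha>))"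
proof -
  have "emeasure (stable_levy_measure \<alpha>) {y. x < \<bar>y\<bar>} = (\<integral>\<^sup>+y. indicator {y. x < \<bar>y\<bar>} y \<partial>stable_levy_measure \<alpha>)"
    by simp
  also have "\<dots> = ennreal (1 / cosine_integral \<alpha>) * (\<integral>\<^sup>+y. ennreal (y powr (- 1 - \<alpha>)) * indicator {y. x < \<bar>y\<bar>} y * indicator {0<..} y \<partial>lborel)"
    by (rule nn_integral_stable_levy_measure[OF a]) (auto simp: indicator_def)
  also have "(\<integral>\<^sup>+y. ennreal (y powr (- 1 - \<alpha>)) * indicator {y. x < \<bar>y\<bar>} y * indicator {0<..} y \<partial>lborel)
     = (\<integral>\<^sup>+y. ennreal (y powr (- 1 - \<alpha>)) * indicator {x..} y \<partial>lborel)"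
    using x by (intro nn_integral_cong_AE, intro eventually_mono[OF AE_lborel_singleton[of x]]) (auto simp: indicator_def)
  also have "\<dots> = ennreal (0 - (- (x powr (- \<alpha>) / \<alpha>)))"
  proof (rule nn_integral_FTC_atLeast[where F="\<lambda>y. - (y powr (- \<alpha>) / \<alpha>)"])
    fix y assume "x \<le> y"
    then have "y > 0" using x by simp
    then show "DERIV (\<lambda>y. - (y powr (- \<alpha>) / \<alpha>)) y :> y powr (- 1 - \<alpha>)"
      using a by (auto intro!: derivative_eq_intros simp: algebra_simps minus_diff_commute)
  next
    have lim0: "((\<lambda>y. y powr (- \<alpha>)) \<longlongrightarrow> 0) at_top"
      using a by (intro tendsto_neg_powr filterlim_ident) auto
    show "((\<lambda>y. - (y powr (- \<alpha>) / \<alpha>)) \<longlongrightarrow> 0) at_top"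
      using tendsto_minus[OF tendsto_divide[OF lim0 tendsto_const[of \<alpha>]]] a by simp
  qed auto
  finally show ?thesis
    using a cosine_integral_pos[OF a] by (simp add: ennreal_mult'[symmetric] stable_const_eq mult_ac)
qed

text \<open>
  Here \<open>m\<close> is the \<open>\<alpha>\<close>-th power of the scale parameter, which makes it additive over independent summands.
\<close>

definition stable_law :: "real \<Rightarrow> real \<Rightarrow> real measure \<Rightarrow> bool" where
  "stable_law \<alpha> m D \<longleftrightarrow> real_distribution D \<and> (\<forall>\<theta>. char D \<theta> = of_real (exp (- (\<bar>\<theta>\<bar> powr \<alpha> * m))))"

lemma char_distr_scale:
  assumes "real_distribution D" 
  shows "char (distr D borel (\<lambda>x. a * x)) \<theta> = char D (a * \<theta>)"
proof -
  interpret real_distribution D by fact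
  show ?thesis unfolding char_def by (subst integral_distr) (auto simp: mult_ac)
qed

lemma stable_law_scale:
  assumes "stable_law \<alpha> m D" 
  shows "stable_law \<alpha> (\<bar>a\<bar> powr \<alpha> * m) (distr D borel (\<lambda>x. a * x))"
proof -
  interpret real_distribution D using assms by (simp add: stable_law_def)
  have "real_distribution (distr D borel (\<lambda>x. a * x))" by (rule real_distribution_distr) auto
  then show ?thesis using assms char_distr_scale[OF real_distribution_axioms, of a]
    by (simp add: stable_law_def abs_mult powr_mult mult_ac)
qed

lemma stable_law_unique: "stable_law \<alpha> m D \<Longrightarrow> stable_law \<alpha> m D' \<Longrightarrow> D = D'"
  by (rule Levy_uniqueness) (simp_all add: stable_law_def fun_eq_iff)

lemma stable_law_symmetric:
  assumes "stable_law \<alpha> m D" shows "distr D borel uminus = D"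
proof -
  have "stable_law \<alpha> (\<bar>-1\<bar> powr \<alpha> * m) (distr D borel (\<lambda>x. (-1) * x))"
    by (rule stable_law_scale[OF assms])
  then have "stable_law \<alpha> m (distr D borel uminus)" by simp
  then show ?thesis by (rule stable_law_unique[OF _ assms])
qed

lemma stable_law_one_minus_cos:
  assumes D: "stable_law \<alpha> m D" and m: "m \<ge> 0"
  shows "(\<integral>\<^sup>+x. ennreal (1 - cos (u * x)) \<partial>D) = ennreal (1 - exp (- (\<bar>u\<bar> powr \<alpha> * m)))"
proof -
  interpret real_distribution D using D by (simp add: stable_law_def)
  have "Re (char D u) = (\<integral>x. Re (iexp (u * x)) \<partial>D)"
    unfolding char_def by (rule integral_Re[symmetric]) (simp add: integrable_iexp)
  also have "\<dots> = (\<integral>x. cos (u * x) \<partial>D)"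
    by (simp only: Re_exp) simp
  finally have e: "(\<integral>x. cos (u * x) \<partial>D) = exp (- (\<bar>u\<bar> powr \<alpha> * m))"
    using D by (simp add: stable_law_def)
  have i: "integrable D (\<lambda>x. cos (u * x))"
    by (rule integrable_const_bound[where B=1]) auto
  have i2: "integrable D (\<lambda>x. 1 - cos (u * x))"
    by (rule Bochner_Integration.integrable_diff[OF _ i]) simp
  have "(\<integral>x. 1 - cos (u * x) \<partial>D) = (\<integral>x. 1 \<partial>D) - (\<integral>x. cos (u * x) \<partial>D)"
    by (rule Bochner_Integration.integral_diff[OF _ i]) simp
  also have "\<dots> = 1 - exp (- (\<bar>u\<bar> powr \<alpha> * m))"
    using prob_space unfolding e by simp
  finally have e2: "(\<integral>x. 1 - cos (u * x) \<partial>D) = 1 - exp (- (\<bar>u\<bar> powr \<alpha> * m))" .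
  show ?thesis
    unfolding e2[symmetric] by (rule nn_integral_eq_integral[OF i2]) simp
qed

section \<open>Tails of symmetric stable laws\<close>

lemma sigma_finite_stable_levy_measure: "sigma_finite_measure (stable_levy_measure \<alpha>)"
  unfolding stable_levy_measure_def
  by (subst sigma_finite_measure.sigma_finite_iff_density_finite[OF sigma_finite_lborel]) auto

lemma stable_levy_measure_symmetric: "distr (stable_levy_measure \<alpha>) borel uminus = stable_levy_measure \<alpha>"
proof -
  let ?f = "\<lambda>x. ennreal (\<bar>x\<bar> powr (- 1 - \<alpha>) / (2 * cosine_integral \<alpha>))"
  have "distr (density lborel ?f) borel uminus = distr (density lborel (?f \<circ> uminus)) borel uminus"
    by (simp add: comp_def)
  also have "\<dots> = density (distr lborel borel uminus) ?f"
    by (rule density_distr[symmetric, unfolded comp_def[symmetric]]) auto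
  also have "distr lborel borel uminus = (lborel :: real measure)"
    by (rule lborel_distr_uminus)
  finally show ?thesis unfolding stable_levy_measure_def .
qed

lemma set_integral_pos_lower_bound:
  fixes \<Psi> :: "real \<Rightarrow> real"
  assumes cont: "continuous_on UNIV \<Psi>" and nn: "\<And>u. 0 \<le> \<Psi> u" and b: "\<And>u. 1/2 \<le> u \<Longrightarrow> b \<le> \<Psi> u" "b > 0"
  shows "(LBINT u:{-1..1}. \<Psi> u) > 0"
proof -
  have ig: "set_integrable lborel {-1..1} \<Psi>"
    by (rule borel_integrable_atLeastAtMost') (rule continuous_on_subset[OF cont], auto)
  have "0 < b / 2" using b by simp
  also have "b / 2 = (\<integral>u. indicator {1/2..1::real} u *\<^sub>R b \<partial>lborel)"
    by simp
  also have "\<dots> \<le> (LBINT u:{-1..1}. \<Psi> u)"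
    unfolding set_lebesgue_integral_def
  proof (rule integral_mono)
    show "indicator {1/2..1} u *\<^sub>R b \<le> indicator {-1..1} u *\<^sub>R \<Psi> u" for u :: real
      using b nn by (auto simp: indicator_def)
    have "integrable lborel (indicat_real {1/2..1::real})"
      by (rule integrable_real_indicator) (auto simp: less_top[symmetric])
    then show "integrable lborel (\<lambda>u. indicat_real {1/2..1::real} u *\<^sub>R b)" by simp
  qed (use ig in \<open>simp add: set_integrable_def\<close>)
  finally show ?thesis .
qed

lemma scaled_exponent_tendsto:
  assumes r: "filterlim r at_top sequentially" and a: "0 < \<alpha>"
  shows "(\<lambda>n. r n powr \<alpha> * (1 - exp (- (A / r n powr \<alpha>)))) \<longlonglongrightarrow> (A :: real)"
proof -
  have D: "((\<lambda>h. (exp (0 + h) - exp 0) / h) \<longlongrightarrow> exp (0::real)) (at 0)"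
    using DERIV_exp[of "0::real"] unfolding DERIV_def .
  have "((\<lambda>y. y * (1 - exp (- (A / y)))) \<longlongrightarrow> A) at_top" 
  proof (cases "A = 0")
    case False
    have "filterlim (\<lambda>y. - (A / y)) (at 0) at_top"
      unfolding filterlim_at
    proof
      show "\<forall>\<^sub>F y in at_top. - (A / y) \<in> UNIV \<and> - (A / y) \<noteq> 0"
        using False by (auto intro!: eventually_mono[OF eventually_gt_at_top[of 0]])
      have "((\<lambda>y. A / y) \<longlongrightarrow> 0) at_top"
        by (rule real_tendsto_divide_at_top[OF tendsto_const filterlim_ident])
      from tendsto_minus[OF this] show "((\<lambda>y. - (A / y)) \<longlongrightarrow> 0) at_top" by simp
    qed
    from filterlim_compose[OF D this]
    have "((\<lambda>y. A * ((exp (0 + - (A / y)) - exp 0) / - (A / y))) \<longlongrightarrow> A * exp 0) at_top"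
      by (rule tendsto_mult_left)
    then have lim: "((\<lambda>y. A * ((exp (0 + - (A / y)) - exp 0) / - (A / y))) \<longlongrightarrow> A) at_top" by simp
    show ?thesis
      by (rule Lim_transform_eventually[OF lim])
         (use False in \<open>auto intro!: eventually_mono[OF eventually_gt_at_top[of 0]] simp: field_simps\<close>)
  qed simp
  moreover have "filterlim (\<lambda>n. r n powr \<alpha>) at_top sequentially"
    using a by (intro filterlim_compose[OF _ r]) real_asymp
  ultimately show ?thesis by (rule filterlim_compose)
qed

text \<open>
  The law of \<open>Z/r\<close> with total mass \<open>r\<^sup>\<alpha>\<close>. Away from the origin it approximates the Levy measure as \<open>r \<rightarrow> \<infinity>\<close>.
\<close>

definition rescaled_law :: "real \<Rightarrow> real measure \<Rightarrow> real \<Rightarrow> real measure" where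
  "rescaled_law \<alpha> D r = density (distr D borel (\<lambda>x. (1 / r) * x)) (\<lambda>_. ennreal (r powr \<alpha>))"

definition rescaled_exponent :: "real \<Rightarrow> real \<Rightarrow> real \<Rightarrow> real" where
  "rescaled_exponent \<alpha> r u = r powr \<alpha> * (1 - exp (- (\<bar>u\<bar> powr \<alpha> / r powr \<alpha>)))"

lemma rescaled_exponent_continuous: "0 < \<alpha> \<Longrightarrow> continuous_on UNIV (rescaled_exponent \<alpha> r)"
  unfolding rescaled_exponent_def by (cases "r = 0") (auto intro!: continuous_intros continuous_on_powr')

lemma rescaled_exponent_bounds:
  assumes "0 < r" shows "0 \<le> rescaled_exponent \<alpha> r u" "rescaled_exponent \<alpha> r u \<le> \<bar>u\<bar> powr \<alpha>"
proof -
  have "1 - exp (- (\<bar>u\<bar> powr \<alpha> / r powr \<alpha>)) \<le> \<bar>u\<bar> powr \<alpha> / r powr \<alpha>"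
    using exp_ge_add_one_self[of "- (\<bar>u\<bar> powr \<alpha> / r powr \<alpha>)"] by linarith
  then have "rescaled_exponent \<alpha> r u \<le> r powr \<alpha> * (\<bar>u\<bar> powr \<alpha> / r powr \<alpha>)"
    unfolding rescaled_exponent_def by (intro mult_left_mono) auto
  then show "rescaled_exponent \<alpha> r u \<le> \<bar>u\<bar> powr \<alpha>" using assms by simp
qed (auto simp: rescaled_exponent_def)

lemma rescaled_law_properties:
  assumes a: "0 < \<alpha>" and D: "stable_law \<alpha> 1 D" and r: "r > 0"
  shows "sigma_finite_measure (rescaled_law \<alpha> D r)" "sets (rescaled_law \<alpha> D r) = sets borel"
    "(\<integral>\<^sup>+x. ennreal (1 - cos (u * x)) \<partial>rescaled_law \<alpha> D r) = ennreal (rescaled_exponent \<alpha> r u)"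
    "distr (rescaled_law \<alpha> D r) borel uminus = rescaled_law \<alpha> D r"
    "emeasure (rescaled_law \<alpha> D r) {x. t < \<bar>x\<bar>} = ennreal (r powr \<alpha> * measure D {x. t * r < \<bar>x\<bar>})"
proof -
  interpret real_distribution D using D by (simp add: stable_law_def)
  define E where "E = distr D borel (\<lambda>x. (1 / r) * x)"
  have E: "stable_law \<alpha> (1 / r powr \<alpha>) E"
    using stable_law_scale[OF D, of "1 / r"] r by (simp add: E_def powr_divide)
  interpret E: real_distribution E using E by (simp add: stable_law_def)
  have R: "rescaled_law \<alpha> D r = density E (\<lambda>_. ennreal (r powr \<alpha>))"
    by (simp add: rescaled_law_def E_def)
  show "sigma_finite_measure (rescaled_law \<alpha> D r)"
    unfolding R by (subst E.sigma_finite_iff_density_finite) auto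
  show "sets (rescaled_law \<alpha> D r) = sets borel" unfolding R by simp
  show "(\<integral>\<^sup>+x. ennreal (1 - cos (u * x)) \<partial>rescaled_law \<alpha> D r) = ennreal (rescaled_exponent \<alpha> r u)"
    unfolding R rescaled_exponent_def
    by (subst nn_integral_density, simp, simp, subst nn_integral_cmult, simp, subst stable_law_one_minus_cos[OF E])
       (simp_all add: ennreal_mult')
  have "distr (density E (\<lambda>_. ennreal (r powr \<alpha>))) borel uminus = density (distr E borel uminus) (\<lambda>_. ennreal (r powr \<alpha>))"
    by (rule density_distr[symmetric, of _ _ uminus E, simplified]) auto
  then show "distr (rescaled_law \<alpha> D r) borel uminus = rescaled_law \<alpha> D r"
    unfolding R using stable_law_symmetric[OF E] by simp
  have "emeasure E {x. t < \<bar>x\<bar>} = emeasure D {x. t * r < \<bar>x\<bar>}"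
    unfolding E_def using r by (subst emeasure_distr) (auto simp: abs_mult field_simps)
  then show "emeasure (rescaled_law \<alpha> D r) {x. t < \<bar>x\<bar>} = ennreal (r powr \<alpha> * measure D {x. t * r < \<bar>x\<bar>})"
    unfolding R by (subst emeasure_density_const) (auto simp: emeasure_eq_measure ennreal_mult'[symmetric])
qed

text \<open>
  The exponents of the rescaled laws converge to \<open>|u|\<^sup>\<alpha>\<close>, so the tilted rescaled laws converge weakly to the tilted
  Levy measure. Integrating the function \<open>1 / (1 - sinc x)\<close> on \<open>|x| > 2\<close> undoes the tilt; the level \<open>2\<close> is chosen
  because \<open>sinc x \<le> 1/2\<close> beyond it, which keeps this function bounded.
\<close>

lemma stable_law_tail_at_2:
  assumes a: "0 < \<alpha>" "\<alpha> < 2" and D: "stable_law \<alpha> 1 D"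
  shows "((\<lambda>r. r powr \<alpha> * measure D {x. 2 * r < \<bar>x\<bar>}) \<longlongrightarrow> stable_const \<alpha> * 2 powr (- \<alpha>)) at_top"
proof (rule tendsto_at_topI_sequentially)
  fix X :: "nat \<Rightarrow> real" assume X: "filterlim X at_top sequentially"
  \<comment> \<open>Only large values of the sequence matter; the cut-off makes all rescaled laws well defined.\<close>
  define r where "r n = max 1 (X n)" for n
  have r_pos: "r n > 0" for n by (simp add: r_def)
  have r: "filterlim r at_top sequentially"
    by (rule filterlim_at_top_mono[OF X]) (auto simp: r_def)
  let ?L = "stable_levy_measure \<alpha>"
  define k where "k n = (LBINT u:{-1..1}. rescaled_exponent \<alpha> (r n) u) / 2" for n
  define k' where "k' = (LBINT u:{-1..1}. \<bar>u\<bar> powr \<alpha>) / 2"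
  note RP = rescaled_law_properties[OF a(1) D r_pos]
  have cont': "continuous_on UNIV (\<lambda>u::real. \<bar>u\<bar> powr \<alpha>)"
    using a by (auto intro!: continuous_intros continuous_on_powr')
  have k_pos: "k n > 0" for n
  proof -
    have "(LBINT u:{-1..1}. rescaled_exponent \<alpha> (r n) u) > 0"
    proof (rule set_integral_pos_lower_bound)
      show "rescaled_exponent \<alpha> (r n) (1/2) \<le> rescaled_exponent \<alpha> (r n) u" if "1/2 \<le> u" for u
        unfolding rescaled_exponent_def using that a r_pos[of n]
        by (auto intro!: mult_left_mono divide_right_mono powr_mono2)
      show "rescaled_exponent \<alpha> (r n) (1/2) > 0"
        unfolding rescaled_exponent_def using r_pos[of n] by simp
    qed (use rescaled_exponent_continuous[OF a(1)] rescaled_exponent_bounds[OF r_pos] in auto)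
    then show ?thesis by (simp add: k_def)
  qed
  have k'_pos: "k' > 0"
  proof -
    have "(LBINT u:{-1..1}. \<bar>u\<bar> powr \<alpha>) > 0"
      by (rule set_integral_pos_lower_bound[OF cont', of "(1/2) powr \<alpha>"]) (use a in \<open>auto intro!: powr_mono2\<close>)
    then show ?thesis by (simp add: k'_def)
  qed
  note T = tilt_distribution[OF RP(1-3) rescaled_exponent_bounds(1)[OF r_pos] rescaled_exponent_continuous[OF a(1)] RP(4) k_def k_pos]
  note T' = tilt_distribution[OF sigma_finite_stable_levy_measure sets_stable_levy_measure stable_levy_measure_exponent[OF a]
       powr_ge_zero cont' stable_levy_measure_symmetric k'_def k'_pos]
  have lim_exp: "(\<lambda>n. rescaled_exponent \<alpha> (r n) u) \<longlonglongrightarrow> \<bar>u\<bar> powr \<alpha>" for u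
    unfolding rescaled_exponent_def by (rule scaled_exponent_tendsto[OF r a(1)])
  have [measurable]: "rescaled_exponent \<alpha> (r n) \<in> borel_measurable borel" for n
    using rescaled_exponent_continuous[OF a(1)] by (rule borel_measurable_continuous_onI)
  have lim_int: "(\<lambda>n. LBINT u:{-1..1}. rescaled_exponent \<alpha> (r n) (\<theta> + u)) \<longlonglongrightarrow> (LBINT u:{-1..1}. \<bar>\<theta> + u\<bar> powr \<alpha>)" for \<theta>
    unfolding set_lebesgue_integral_def
  proof (rule integral_dominated_convergence[where w="\<lambda>u. indicator {-1..1} u *\<^sub>R \<bar>\<theta> + u\<bar> powr \<alpha>"])
    show "integrable lborel (\<lambda>u. indicator {-1..1} u *\<^sub>R \<bar>\<theta> + u\<bar> powr \<alpha>)"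
      unfolding set_integrable_def[symmetric] using a
      by (intro borel_integrable_atLeastAtMost' continuous_on_powr' continuous_intros) auto
    show "AE u in lborel. (\<lambda>n. indicator {-1..1} u *\<^sub>R rescaled_exponent \<alpha> (r n) (\<theta> + u)) \<longlonglongrightarrow> indicator {-1..1} u *\<^sub>R \<bar>\<theta> + u\<bar> powr \<alpha>"
      by (intro AE_I2 tendsto_intros lim_exp)
    show "AE u in lborel. norm (indicator {-1..1} u *\<^sub>R rescaled_exponent \<alpha> (r n) (\<theta> + u)) \<le> indicator {-1..1} u *\<^sub>R \<bar>\<theta> + u\<bar> powr \<alpha>" for n
      using rescaled_exponent_bounds[OF r_pos] by (intro AE_I2) (auto simp: indicator_def)
  qed auto
  have k_lim: "k \<longlonglongrightarrow> k'"
    unfolding k_def k'_def using lim_int[of 0] by (intro tendsto_divide) auto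
  let ?M = "\<lambda>n. density (rescaled_law \<alpha> D (r n)) (\<lambda>x. ennreal ((1 - sinc x) / k n))"
  let ?M' = "density ?L (\<lambda>x. ennreal ((1 - sinc x) / k'))"
  have wc: "weak_conv_m ?M ?M'"
  proof (rule levy_continuity)
    show "(\<lambda>n. char (?M n) \<theta>) \<longlonglongrightarrow> char ?M' \<theta>" for \<theta>
      unfolding T(2) T'(2) using k'_pos by (intro tendsto_intros lim_int lim_exp k_lim) auto
  qed (use T(1) T'(1) in auto)
  define f where "f x = (if 2 < \<bar>x\<bar> then 1 / (1 - sinc x) else 0)" for x :: real
  have [measurable]: "f \<in> borel_measurable borel" unfolding f_def by measurable
  have fb: "norm (f x) \<le> 2" for x
  proof (cases "2 < \<bar>x\<bar>")
    case True
    then have "1 - sinc x \<ge> 1 / 2" using sinc_le_half[of x] by simp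
    then have "1 / (1 - sinc x) \<le> 1 / (1 / 2)" by (intro divide_left_mono mult_pos_pos) auto
    moreover have "1 / (1 - sinc x) \<ge> 0" using \<open>1 - sinc x \<ge> 1 / 2\<close> by (intro divide_nonneg_nonneg) auto
    moreover have "f x = 1 / (1 - sinc x)" by (simp only: f_def True if_True)
    ultimately show ?thesis by (simp only: real_norm_def abs_of_nonneg) simp
  qed (simp add: f_def)
  have fprod: "(1 - sinc x) * f x = indicator {x. 2 < \<bar>x\<bar>} x" for x
    unfolding f_def using sinc_le_half[of x] by (auto simp: indicator_def)
  interpret RM': real_distribution ?M' by (rule T'(1))
  have fc: "isCont f x" if "x \<noteq> 2" "x \<noteq> -2" for x
  proof (cases "2 < \<bar>x\<bar>")
    case True
    have "isCont f x \<longleftrightarrow> isCont (\<lambda>x. 1 / (1 - sinc x)) x"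
    proof (rule isCont_cong)
      have "open {x::real. 2 < \<bar>x\<bar>}" by (intro open_Collect_less continuous_intros)
      then show "\<forall>\<^sub>F x in nhds x. f x = 1 / (1 - sinc x)"
        using True by (auto simp: eventually_nhds f_def intro!: exI[of _ "{x::real. 2 < \<bar>x\<bar>}"])
    qed
    also have "\<dots>" using isCont_sinc[of x] sinc_le_half[of x] True by (intro continuous_intros) auto
    finally show ?thesis .
  next
    case False
    have "isCont f x \<longleftrightarrow> isCont (\<lambda>x. 0 :: real) x"
    proof (rule isCont_cong)
      have "open {x::real. \<bar>x\<bar> < 2}" by (intro open_Collect_less continuous_intros)
      then show "\<forall>\<^sub>F x in nhds x. f x = 0"
        using False that by (auto simp: eventually_nhds f_def intro!: exI[of _ "{x::real. \<bar>x\<bar> < 2}"])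
    qed
    then show ?thesis by simp
  qed
  have "(\<lambda>n. integral\<^sup>L (?M n) f) \<longlonglongrightarrow> integral\<^sup>L ?M' f"
  proof (rule weak_conv_imp_bdd_ae_continuous_conv[OF _ _ wc])
    have "{x. \<not> isCont f x} \<subseteq> {2, -2}" using fc by auto
    moreover have "emeasure ?M' {2, -2} = 0"
    proof -
      have "AE x in lborel. x \<notin> {2, -2::real}"
        using AE_lborel_singleton[of "2::real"] AE_lborel_singleton[of "-2::real"] by eventually_elim auto
      then have "AE x in ?L. x \<notin> {2, -2::real}"
        unfolding stable_levy_measure_def by - (subst AE_density, simp, erule eventually_mono, blast)
      then have "AE x in ?M'. x \<notin> {2, -2::real}"
        by - (subst AE_density, simp, erule eventually_mono, blast)
      then show ?thesis by (subst (asm) AE_iff_measurable[where N="{2, -2}"]) (auto simp: sets_eq_imp_space_eq[OF sets_stable_levy_measure])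
    qed
    ultimately have "emeasure ?M' {x. \<not> isCont f x} \<le> 0"
      using emeasure_mono[of "{x. \<not> isCont f x}" "{2,-2}" ?M'] by simp
    then show "emeasure ?M' {x. \<not> isCont f x} = 0" by simp
  qed (use T(1) T'(1) fb in auto)
  moreover have "integral\<^sup>L (?M n) f = (r n powr \<alpha> * measure D {x. 2 * r n < \<bar>x\<bar>}) / k n" for n
    by (subst T(3)) (auto simp: fprod measure_def RP(5) RP(2) sets_eq_imp_space_eq[OF RP(2)])
  moreover have "integral\<^sup>L ?M' f = (stable_const \<alpha> * 2 powr (- \<alpha>)) / k'"
    using cosine_integral_pos[OF a] a
    by (subst T'(3)) (auto simp: fprod measure_def stable_levy_measure_tail[OF a] stable_const_eq sets_eq_imp_space_eq[OF sets_stable_levy_measure])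
  ultimately have "(\<lambda>n. (r n powr \<alpha> * measure D {x. 2 * r n < \<bar>x\<bar>}) / k n) \<longlonglongrightarrow> (stable_const \<alpha> * 2 powr (- \<alpha>)) / k'"
    by simp
  from tendsto_mult[OF this k_lim] 
  have "(\<lambda>n. r n powr \<alpha> * measure D {x. 2 * r n < \<bar>x\<bar>}) \<longlonglongrightarrow> stable_const \<alpha> * 2 powr (- \<alpha>)"
    using k_pos k'_pos by (simp add: less_imp_neq[symmetric])
  moreover have "\<forall>\<^sub>F n in sequentially. r n = X n"
    using X unfolding filterlim_at_top by (auto simp: r_def elim!: allE[of _ 1] eventually_mono)
  ultimately show "(\<lambda>n. X n powr \<alpha> * measure D {x. 2 * X n < \<bar>x\<bar>}) \<longlonglongrightarrow> stable_const \<alpha> * 2 powr (- \<alpha>)"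
    by (rule Lim_transform_eventually[OF _ eventually_mono]) simp
qed

lemma stable_law_tail:
  assumes a: "0 < \<alpha>" "\<alpha> < 2" and D: "stable_law \<alpha> 1 D"
  shows "((\<lambda>x. x powr \<alpha> * measure D {y. x < \<bar>y\<bar>}) \<longlongrightarrow> stable_const \<alpha>) at_top"
proof -
  have f: "filterlim (\<lambda>x::real. x / 2) at_top at_top" by real_asymp
  have "((\<lambda>x. 2 powr \<alpha> * ((x / 2) powr \<alpha> * measure D {y. 2 * (x / 2) < \<bar>y\<bar>})) \<longlongrightarrow> 2 powr \<alpha> * (stable_const \<alpha> * 2 powr (- \<alpha>))) at_top"
    by (intro tendsto_mult_left filterlim_compose[OF stable_law_tail_at_2[OF a D] f])
  then have "((\<lambda>x. 2 powr \<alpha> * ((x / 2) powr \<alpha> * measure D {y. 2 * (x / 2) < \<bar>y\<bar>})) \<longlongrightarrow> stable_const \<alpha>) at_top"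
    by (simp add: powr_minus field_simps)
  then show ?thesis
    by (rule Lim_transform_eventually)
       (auto intro!: eventually_mono[OF eventually_ge_at_top[of 0]] simp: powr_divide)
qed

lemma stable_law_zero:
  assumes D: "stable_law \<alpha> 0 D" shows "D = return borel 0"
proof (rule stable_law_unique[OF D])
  interpret R: prob_space "return borel (0::real)" by (rule prob_space_return) simp
  have "real_distribution (return borel (0::real))" by unfold_locales auto
  then show "stable_law \<alpha> 0 (return borel 0)"
    by (simp add: stable_law_def char_def integral_return)
qed

text \<open>
  By uniqueness and scaling all tails come from a single function \<open>H\<close>. If there is no law with \<open>m = 1\<close> there is
  none with \<open>m > 0\<close> either, and any function with the right asymptotics serves; this saves the construction of such a law.
\<close>

lemma stable_law_tail_function:
  assumes a: "0 < \<alpha>" "\<alpha> < 2"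
  obtains H where "((\<lambda>x. x powr \<alpha> * H x) \<longlongrightarrow> stable_const \<alpha>) at_top"
    and "\<And>x. H x \<le> 1"
    and "\<And>D m x. stable_law \<alpha> m D \<Longrightarrow> m > 0 \<Longrightarrow> measure D {y. x < \<bar>y\<bar>} = H (x / m powr (1 / \<alpha>))"
proof (cases "\<exists>D. stable_law \<alpha> 1 D")
  case True
  then obtain D0 where D0: "stable_law \<alpha> 1 D0" by blast
  interpret D0: real_distribution D0 using D0 by (simp add: stable_law_def)
  show ?thesis
  proof (rule that[of "\<lambda>x. measure D0 {y. x < \<bar>y\<bar>}"])
    show "((\<lambda>x. x powr \<alpha> * measure D0 {y. x < \<bar>y\<bar>}) \<longlongrightarrow> stable_const \<alpha>) at_top"
      by (rule stable_law_tail[OF a D0])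
    fix D m x assume D: "stable_law \<alpha> m D" and m: "(m::real) > 0"
    define c where "c = m powr (1 / \<alpha>)"
    have c: "c > 0" "c powr \<alpha> = m" using m a by (auto simp: c_def powr_powr)
    have "D = distr D0 borel (\<lambda>x. c * x)"
      using stable_law_scale[OF D0, of c] c by (intro stable_law_unique[OF D]) simp
    then have "measure D {y. x < \<bar>y\<bar>} = measure (distr D0 borel (\<lambda>x. c * x)) {y. x < \<bar>y\<bar>}" by simp
    also have "\<dots> = measure D0 {y. x / c < \<bar>y\<bar>}"
      using c by (subst measure_distr) (auto simp: abs_mult field_simps)
    finally show "measure D {y. x < \<bar>y\<bar>} = measure D0 {y. x / m powr (1 / \<alpha>) < \<bar>y\<bar>}" by (simp add: c_def)
  qed simp
next
  case False
  show ?thesis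
  proof (rule that[of "\<lambda>x. min 1 (stable_const \<alpha> * x powr (- \<alpha>))"])
    have "((\<lambda>x. stable_const \<alpha> * x powr (- \<alpha>)) \<longlongrightarrow> stable_const \<alpha> * 0) at_top"
      using a by (intro tendsto_mult_left tendsto_neg_powr filterlim_ident) auto
    then have "\<forall>\<^sub>F x in at_top. stable_const \<alpha> * x powr (- \<alpha>) < 1"
      by (rule order_tendstoD(2)) simp
    then have "\<forall>\<^sub>F x in at_top. stable_const \<alpha> = x powr \<alpha> * min 1 (stable_const \<alpha> * x powr (- \<alpha>))"
      using eventually_gt_at_top[of 0]
      by eventually_elim (simp add: min_def powr_minus)
    then show "((\<lambda>x. x powr \<alpha> * min 1 (stable_const \<alpha> * x powr (- \<alpha>))) \<longlongrightarrow> stable_const \<alpha>) at_top"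
      by (rule Lim_transform_eventually[OF tendsto_const])
    fix D m x assume D: "stable_law \<alpha> m D" and m: "(m::real) > 0"
    have "stable_law \<alpha> 1 (distr D borel (\<lambda>x. m powr (- (1 / \<alpha>)) * x))"
    proof -
      have "\<bar>m powr (- (1 / \<alpha>))\<bar> powr \<alpha> * m = 1"
        using m a by (simp add: powr_minus_divide powr_divide powr_powr)
      with stable_law_scale[OF D, of "m powr (- (1 / \<alpha>))"] show ?thesis by simp
    qed
    with False show "measure D {y. x < \<bar>y\<bar>} = min 1 (stable_const \<alpha> * (x / m powr (1 / \<alpha>)) powr (- \<alpha>))"
      by blast
  qed simp
qed

lemma stable_const_pos: "0 < \<alpha> \<Longrightarrow> \<alpha> < 2 \<Longrightarrow> stable_const \<alpha> > 0"
  by (simp add: stable_const_eq cosine_integral_pos)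

definition stable_tail_bound :: "real \<Rightarrow> real \<Rightarrow> bool" where
  "stable_tail_bound \<alpha> K \<longleftrightarrow> K > 0 \<and> (\<forall>D m x. stable_law \<alpha> m D \<longrightarrow> 0 \<le> m \<longrightarrow> 0 < x \<longrightarrow>
     measure D {y. x < \<bar>y\<bar>} \<le> K * m * x powr (- \<alpha>))"

lemma stable_tail_boundD:
  assumes "stable_tail_bound \<alpha> K"
  shows "K > 0"
    and "stable_law \<alpha> m D \<Longrightarrow> 0 \<le> m \<Longrightarrow> 0 < x \<Longrightarrow> measure D {y. x < \<bar>y\<bar>} \<le> K * m * x powr (- \<alpha>)"
  using assms unfolding stable_tail_bound_def by blast+

lemma stable_law_tail_bound:
  assumes a: "0 < \<alpha>" "\<alpha> < 2"
  shows "\<exists>K. stable_tail_bound \<alpha> K"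
proof -
  obtain H where H: "((\<lambda>x. x powr \<alpha> * H x) \<longlongrightarrow> stable_const \<alpha>) at_top" "\<And>x. H x \<le> 1"
    "\<And>D m x. stable_law \<alpha> m D \<Longrightarrow> m > 0 \<Longrightarrow> measure D {y. x < \<bar>y\<bar>} = H (x / m powr (1 / \<alpha>))"
    using a by (rule stable_law_tail_function) blast
  have "\<forall>\<^sub>F x in at_top. x powr \<alpha> * H x < stable_const \<alpha> + 1"
    by (rule order_tendstoD(2)[OF H(1)]) simp
  then obtain x0 where x0: "\<And>x. x \<ge> x0 \<Longrightarrow> x powr \<alpha> * H x < stable_const \<alpha> + 1"
    by (auto simp: eventually_at_top_linorder)
  define K where "K = max (stable_const \<alpha> + 1) (x0 powr \<alpha>)"
  have K: "K > 0" using stable_const_pos[OF a] by (auto simp: K_def)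
  have HK: "x powr \<alpha> * H x \<le> K" if "x > 0" for x
  proof (cases "x \<ge> x0")
    case True
    then show ?thesis using x0[of x] by (simp add: K_def)
  next
    case False
    have "x powr \<alpha> * H x \<le> x powr \<alpha> * 1" using H(2) by (intro mult_left_mono) auto
    also have "\<dots> \<le> x0 powr \<alpha>" using False that a by (simp add: powr_mono2)
    finally show ?thesis by (simp add: K_def)
  qed
  show ?thesis
    unfolding stable_tail_bound_def
  proof (intro exI[of _ K] conjI K allI impI)
    fix D m x assume D: "stable_law \<alpha> m D" and m: "0 \<le> m" and x: "(0::real) < x"
    show "measure D {y. x < \<bar>y\<bar>} \<le> K * m * x powr (- \<alpha>)"
    proof (cases "m = 0")
      case True
      then show ?thesis using D x stable_law_zero[of \<alpha> D] by (simp add: measure_return)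
    next
      case False
      then have m: "m > 0" using m by simp
      define z where "z = x / m powr (1 / \<alpha>)"
      have z: "z > 0" "z powr \<alpha> = x powr \<alpha> / m" using m x a by (auto simp: z_def powr_divide powr_powr)
      have "x powr \<alpha> / m * H z \<le> K" using HK[OF z(1)] z(2) by simp
      then have "H z \<le> K * m * x powr (- \<alpha>)"
        using m x by (simp add: powr_minus field_simps)
      then show ?thesis using H(3)[OF D m] by (simp add: z_def)
    qed
  qed
qed

text \<open>
  The tail asymptotics of a stable law, uniform in \<open>m\<close>: they hold as soon as \<open>x\<^sup>\<alpha>\<close> is large compared with \<open>m\<close>.
\<close>

definition stable_tail_asymptotics :: "real \<Rightarrow> real \<Rightarrow> real \<Rightarrow> bool" where
  "stable_tail_asymptotics \<alpha> \<epsilon> R \<longleftrightarrow> R > 0 \<and> (\<forall>D m x. stable_law \<alpha> m D \<longrightarrow> 0 \<le> m \<longrightarrow> 0 < x \<longrightarrow> R * m \<le> x powr \<alpha> \<longrightarrow>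
     \<bar>measure D {y. x < \<bar>y\<bar>} - stable_const \<alpha> * m * x powr (- \<alpha>)\<bar> \<le> \<epsilon> * m * x powr (- \<alpha>))"

lemma stable_tail_asymptoticsD:
  assumes "stable_tail_asymptotics \<alpha> \<epsilon> R"
  shows "stable_law \<alpha> m D \<Longrightarrow> 0 \<le> m \<Longrightarrow> 0 < x \<Longrightarrow> R * m \<le> x powr \<alpha> \<Longrightarrow>
     \<bar>measure D {y. x < \<bar>y\<bar>} - stable_const \<alpha> * m * x powr (- \<alpha>)\<bar> \<le> \<epsilon> * m * x powr (- \<alpha>)"
    and "R > 0"
  using assms unfolding stable_tail_asymptotics_def by blast+

lemma stable_law_tail_uniform:
  assumes a: "0 < \<alpha>" "\<alpha> < 2" and e: "\<epsilon> > 0"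
  shows "\<exists>R. stable_tail_asymptotics \<alpha> \<epsilon> R"
proof -
  obtain H where H: "((\<lambda>x. x powr \<alpha> * H x) \<longlongrightarrow> stable_const \<alpha>) at_top" "\<And>x. H x \<le> 1"
    "\<And>D m x. stable_law \<alpha> m D \<Longrightarrow> m > 0 \<Longrightarrow> measure D {y. x < \<bar>y\<bar>} = H (x / m powr (1 / \<alpha>))"
    using a by (rule stable_law_tail_function) blast
  have "\<forall>\<^sub>F x in at_top. dist (x powr \<alpha> * H x) (stable_const \<alpha>) < \<epsilon>"
    by (rule tendstoD[OF H(1) e])
  then obtain x0 where x0: "\<And>x. x \<ge> x0 \<Longrightarrow> \<bar>x powr \<alpha> * H x - stable_const \<alpha>\<bar> < \<epsilon>"
    by (auto simp: eventually_at_top_linorder dist_real_def)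
  define R where "R = (max 1 x0) powr \<alpha>"
  have R: "R > 0" by (simp add: R_def)
  show ?thesis
    unfolding stable_tail_asymptotics_def
  proof (intro exI[of _ R] conjI R allI impI)
    fix D m x assume D: "stable_law \<alpha> m D" and m: "0 \<le> m" and x: "(0::real) < x" and Rm: "R * m \<le> x powr \<alpha>"
    show "\<bar>measure D {y. x < \<bar>y\<bar>} - stable_const \<alpha> * m * x powr (- \<alpha>)\<bar> \<le> \<epsilon> * m * x powr (- \<alpha>)"
    proof (cases "m = 0")
      case True
      then show ?thesis using D x stable_law_zero[of \<alpha> D] by (simp add: measure_return)
    next
      case False
      then have m: "m > 0" using m by simp
      define z where "z = x / m powr (1 / \<alpha>)"
      have z: "z > 0" "z powr \<alpha> = x powr \<alpha> / m" using m x a by (auto simp: z_def powr_divide powr_powr)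
      have "(max 1 x0) powr \<alpha> \<le> z powr \<alpha>" using Rm m by (simp add: z R_def field_simps)
      then have "max 1 x0 \<le> z" using a z powr_less_mono2[of \<alpha> z "max 1 x0"] by linarith
      then have "\<bar>x powr \<alpha> / m * H z - stable_const \<alpha>\<bar> \<le> \<epsilon>" using x0[of z] z(2) by simp
      then have "\<bar>x powr \<alpha> / m * H z - stable_const \<alpha>\<bar> * (m * x powr (- \<alpha>)) \<le> \<epsilon> * (m * x powr (- \<alpha>))"
        using m by (intro mult_right_mono) auto
      also have "\<bar>x powr \<alpha> / m * H z - stable_const \<alpha>\<bar> * (m * x powr (- \<alpha>)) = \<bar>(x powr \<alpha> / m * H z - stable_const \<alpha>) * (m * x powr (- \<alpha>))\<bar>"
        using m by (simp add: abs_mult)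
      also have "(x powr \<alpha> / m * H z - stable_const \<alpha>) * (m * x powr (- \<alpha>)) = H z - stable_const \<alpha> * m * x powr (- \<alpha>)"
        using m x by (simp add: powr_minus field_simps)
      finally show ?thesis using H(3)[OF D m] by (simp add: z_def mult_ac)
    qed
  qed
qed

lemma one_minus_cos_ge:
  fixes u :: real assumes "\<bar>u\<bar> \<le> 1" shows "u\<^sup>2 \<le> 4 * (1 - cos u)"
proof -
  have *: "u\<^sup>2 \<le> 4 * (1 - cos u)" if u: "0 \<le> u" "u \<le> 1" for u :: real
  proof -
    have c: "1/2 \<le> cos x" if "0 \<le> x" "x \<le> 1" for x :: real
      using cos_monotone_0_pi_le[of x "pi / 3"] that pi_gt3 by (simp add: cos_60)
    have s: "x / 2 \<le> sin x" if x: "0 \<le> x" "x \<le> 1" for x :: real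
    proof -
      have "(\<lambda>x. sin x - x / 2) 0 \<le> (\<lambda>x. sin x - x / 2) x"
      proof (rule DERIV_nonneg_imp_nondecreasing[OF x(1)])
        fix y assume "0 \<le> y" "y \<le> x"
        then show "\<exists>d. DERIV (\<lambda>x. sin x - x / 2) y :> d \<and> 0 \<le> d"
          using c[of y] x by (intro exI[of _ "cos y - 1 / 2"]) (auto intro!: derivative_eq_intros)
      qed
      then show ?thesis by simp
    qed
    have "(\<lambda>x. 4 * (1 - cos x) - x\<^sup>2) 0 \<le> (\<lambda>x. 4 * (1 - cos x) - x\<^sup>2) u"
    proof (rule DERIV_nonneg_imp_nondecreasing[OF u(1)])
      fix y assume "0 \<le> y" "y \<le> u"
      then show "\<exists>d. DERIV (\<lambda>x. 4 * (1 - cos x) - x\<^sup>2) y :> d \<and> 0 \<le> d"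
        using s[of y] u by (intro exI[of _ "4 * sin y - 2 * y"]) (auto intro!: derivative_eq_intros)
    qed
    then show ?thesis by simp
  qed
  show ?thesis using *[of "\<bar>u\<bar>"] assms by simp
qed

text \<open>
  On \<open>|x| \<le> R\<close> the square \<open>x\<^sup>2\<close> is at most \<open>4 R\<^sup>2 (1 - cos (x/R))\<close>, whose mean is known from the characteristic
  function at \<open>1/R\<close>.
\<close>

lemma stable_law_truncated_second_moment:
  assumes D: "stable_law \<alpha> m D" and m: "m \<ge> 0" and R: "R > 0"
  shows "(\<integral>x. (if \<bar>x\<bar> \<le> R then x else 0)\<^sup>2 \<partial>D) \<le> 4 * m * R powr (2 - \<alpha>)"
proof -
  interpret real_distribution D using D by (simp add: stable_law_def)
  have i1: "integrable D (\<lambda>x. 1 - cos (1 / R * x))"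
  proof (rule integrable_const_bound[where B=2])
    have "norm (1 - cos (1 / R * x)) \<le> 2" for x
      using cos_ge_minus_one[of "1 / R * x"] cos_le_one[of "1 / R * x"] unfolding real_norm_def by linarith
    then show "AE x in D. norm (1 - cos (1 / R * x)) \<le> 2" by simp
  qed simp
  have "(\<integral>x. (if \<bar>x\<bar> \<le> R then x else 0)\<^sup>2 \<partial>D) \<le> (\<integral>x. (4 * R\<^sup>2) * (1 - cos (1 / R * x)) \<partial>D)"
  proof (rule integral_mono)
    show "integrable D (\<lambda>x. (if \<bar>x\<bar> \<le> R then x else 0)\<^sup>2)"
      by (rule integrable_const_bound[where B="R\<^sup>2"]) (auto intro!: AE_I2 simp: abs_le_square_iff[symmetric])
    show "(if \<bar>x\<bar> \<le> R then x else 0)\<^sup>2 \<le> (4 * R\<^sup>2) * (1 - cos (1 / R * x))" for x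
    proof (cases "\<bar>x\<bar> \<le> R")
      case True
      have "(x / R)\<^sup>2 \<le> 4 * (1 - cos (x / R))" using True R by (intro one_minus_cos_ge) auto
      then have "R\<^sup>2 * (x / R)\<^sup>2 \<le> R\<^sup>2 * (4 * (1 - cos (x / R)))" by (intro mult_left_mono) auto
      then show ?thesis using True R by (simp add: power_divide algebra_simps)
    qed simp
  qed (use i1 in simp)
  also have "\<dots> = 4 * R\<^sup>2 * (\<integral>x. 1 - cos (1 / R * x) \<partial>D)" by simp
  also have "(\<integral>x. 1 - cos (1 / R * x) \<partial>D) = 1 - exp (- (\<bar>1 / R\<bar> powr \<alpha> * m))"
    using stable_law_one_minus_cos[OF D m, of "1 / R"] m
    by (subst integral_eq_nn_integral) auto
  also have "\<dots> \<le> \<bar>1 / R\<bar> powr \<alpha> * m"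
    using exp_ge_add_one_self[of "- (\<bar>1 / R\<bar> powr \<alpha> * m)"] by linarith
  also have "4 * R\<^sup>2 * (\<bar>1 / R\<bar> powr \<alpha> * m) = 4 * m * R powr (2 - \<alpha>)"
    using R by (simp add: powr_diff powr_divide powr_numeral)
  finally show ?thesis using R by (simp add: mult_left_mono)
qed

lemma stable_law_truncated_mean:
  assumes D: "stable_law \<alpha> m D"
  shows "(\<integral>x. (if \<bar>x\<bar> \<le> R then x else 0) \<partial>D) = 0"
proof -
  interpret real_distribution D using D by (simp add: stable_law_def)
  have "(\<integral>x. (if \<bar>x\<bar> \<le> R then x else 0) \<partial>D) = (\<integral>x. (if \<bar>x\<bar> \<le> R then x else 0) \<partial>distr D borel uminus)"
    by (simp only: stable_law_symmetric[OF D])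
  also have "\<dots> = (\<integral>x. (if \<bar>- x\<bar> \<le> R then - x else 0) \<partial>D)"
    by (rule integral_distr) auto
  also have "\<dots> = (\<integral>x. - (if \<bar>x\<bar> \<le> R then x else 0) \<partial>D)"
    by (intro Bochner_Integration.integral_cong) auto
  also have "\<dots> = - (\<integral>x. (if \<bar>x\<bar> \<le> R then x else 0) \<partial>D)" by simp
  finally show ?thesis by simp
qed

section \<open>Weighted sums of independent stable variables\<close>

text \<open>
  The family \<open>S\<^sub>t = \<Sum>\<^sub>j a\<^sub>t\<^sub>j Z\<^sub>j\<close> is the discrete model of a field of stable integrals: \<open>Z\<^sub>j\<close> is the random
  measure of the \<open>j\<close>-th cell, \<open>m\<^sub>j\<close> the measure of the cell and \<open>a\<^sub>t\<^sub>j\<close> the value of the \<open>t\<close>-th kernel on it.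
\<close>

locale stable_array = prob_space Q for Q :: "'b measure" +
  fixes \<alpha> :: real and J :: "'j set" and Z :: "'j \<Rightarrow> 'b \<Rightarrow> real" and m :: "'j \<Rightarrow> real"
    and T :: "'t set" and a :: "'t \<Rightarrow> 'j \<Rightarrow> real" and s :: real
  assumes alpha: "0 < \<alpha>" "\<alpha> < 2" and finJ: "finite J"
    and indep: "indep_vars (\<lambda>_. borel) Z J"
    and law: "\<And>j. j \<in> J \<Longrightarrow> stable_law \<alpha> (m j) (distr Q borel (Z j))"
    and m_nonneg: "\<And>j. 0 \<le> m j"
    and finT: "finite T" and T_ne: "T \<noteq> {}"
    and scale: "\<And>t. t \<in> T \<Longrightarrow> (\<Sum>j\<in>J. m j * \<bar>a t j\<bar> powr \<alpha>) \<le> s"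
begin

lemma Z_measurable[measurable]: "j \<in> J \<Longrightarrow> Z j \<in> borel_measurable Q"
  using indep by (auto simp: indep_vars_def)

lemma law_scaled: "j \<in> J \<Longrightarrow> stable_law \<alpha> (\<bar>c\<bar> powr \<alpha> * m j) (distr Q borel (\<lambda>\<omega>. c * Z j \<omega>))"
  using stable_law_scale[OF law, of j c] by (simp add: distr_distr comp_def)

lemma prob_scaled: "j \<in> J \<Longrightarrow> prob {\<omega> \<in> space Q. x < \<bar>c * Z j \<omega>\<bar>} = measure (distr Q borel (\<lambda>\<omega>. c * Z j \<omega>)) {y. x < \<bar>y\<bar>}"
  by (subst measure_distr) (auto intro!: arg_cong[where f="prob"])

lemma s_nonneg: "0 \<le> s"
proof -
  obtain t where "t \<in> T" using T_ne by auto
  have "0 \<le> (\<Sum>j\<in>J. m j * \<bar>a t j\<bar> powr \<alpha>)" using m_nonneg by (intro sum_nonneg) auto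
  with scale[OF \<open>t \<in> T\<close>] show ?thesis by linarith
qed

text \<open>
  For fixed \<open>t\<close> the events that two given terms are large are independent, so the double sum of their joint
  probabilities is at most the square of a sum that \<open>s\<close> controls.
\<close>

lemma prob_two_large:
  assumes Kb: "stable_tail_bound \<alpha> K"
    and R: "R > 0"
  shows "prob {\<omega> \<in> space Q. \<exists>t\<in>T. \<exists>i\<in>J. \<exists>j\<in>J. i \<noteq> j \<and> R < \<bar>a t i * Z i \<omega>\<bar> \<and> R < \<bar>a t j * Z j \<omega>\<bar>}
     \<le> card T * (K * s * R powr (- \<alpha>))\<^sup>2"
proof -
  note K = stable_tail_boundD[OF Kb]
  define E where "E t j = {\<omega> \<in> space Q. R < \<bar>a t j * Z j \<omega>\<bar>}" for t j
  have [measurable]: "E t j \<in> sets Q" if "j \<in> J" for t j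
    using that unfolding E_def by measurable
  have pE: "prob (E t j) \<le> K * R powr (- \<alpha>) * (m j * \<bar>a t j\<bar> powr \<alpha>)" if "j \<in> J" for t j
    unfolding E_def prob_scaled[OF that]
    using K(2)[OF law_scaled[OF that, of "a t j"] _ R] m_nonneg[of j] by (simp add: mult_ac)
  have sE: "(\<Sum>j\<in>J. prob (E t j)) \<le> K * s * R powr (- \<alpha>)" if "t \<in> T" for t
  proof -
    have "(\<Sum>j\<in>J. prob (E t j)) \<le> (\<Sum>j\<in>J. K * R powr (- \<alpha>) * (m j * \<bar>a t j\<bar> powr \<alpha>))"
      by (intro sum_mono pE)
    also have "\<dots> = K * R powr (- \<alpha>) * (\<Sum>j\<in>J. m j * \<bar>a t j\<bar> powr \<alpha>)"
      by (simp add: sum_distrib_left)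
    also have "\<dots> \<le> K * R powr (- \<alpha>) * s"
      using scale[OF that] K by (intro mult_left_mono) auto
    finally show ?thesis by (simp add: mult_ac)
  qed
  have indE: "prob (E t i \<inter> E t j) = prob (E t i) * prob (E t j)" if "i \<in> J" "j \<in> J" "i \<noteq> j" for t i j
  proof -
    have "prob (\<Inter>k\<in>{i, j}. Z k -` {y. R < \<bar>a t k * y\<bar>} \<inter> space Q) = (\<Prod>k\<in>{i, j}. prob (Z k -` {y. R < \<bar>a t k * y\<bar>} \<inter> space Q))"
      by (rule indep_varsD[OF indep]) (use that in auto)
    moreover have "Z k -` {y. R < \<bar>a t k * y\<bar>} \<inter> space Q = E t k" for k
      by (auto simp: E_def)
    ultimately show ?thesis using that by simp
  qed
  define I where "I = {(i, j). i \<in> J \<and> j \<in> J \<and> i \<noteq> j}"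
  have finI: "finite I"
    by (rule finite_subset[of _ "J \<times> J"]) (auto simp: I_def finJ)
  have "{\<omega> \<in> space Q. \<exists>t\<in>T. \<exists>i\<in>J. \<exists>j\<in>J. i \<noteq> j \<and> R < \<bar>a t i * Z i \<omega>\<bar> \<and> R < \<bar>a t j * Z j \<omega>\<bar>}
     = (\<Union>p\<in>T \<times> I. E (fst p) (fst (snd p)) \<inter> E (fst p) (snd (snd p)))"
    by (auto simp: E_def I_def) blast+
  also have "prob \<dots> \<le> (\<Sum>p\<in>T \<times> I. prob (E (fst p) (fst (snd p)) \<inter> E (fst p) (snd (snd p))))"
    by (rule finite_measure_subadditive_finite[OF finite_cartesian_product[OF finT finI]]) (auto simp: I_def)
  also have "\<dots> = (\<Sum>t\<in>T. \<Sum>q\<in>I. prob (E t (fst q)) * prob (E t (snd q)))"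
    by (subst sum.cartesian_product, intro sum.cong) (auto simp: indE I_def)
  also have "\<dots> \<le> (\<Sum>t\<in>T. \<Sum>q\<in>J\<times>J. prob (E t (fst q)) * prob (E t (snd q)))"
    by (intro sum_mono sum_mono2) (auto simp: I_def finJ)
  also have "\<dots> = (\<Sum>t\<in>T. (\<Sum>j\<in>J. prob (E t j))\<^sup>2)"
    by (simp add: power2_eq_square sum_product sum.cartesian_product case_prod_unfold)
  also have "\<dots> \<le> (\<Sum>t\<in>T. (K * s * R powr (- \<alpha>))\<^sup>2)"
    by (intro sum_mono power_mono sE sum_nonneg) auto
  finally show ?thesis by simp
qed

text \<open>
  The truncated terms are centred and uncorrelated, so Chebyshev's inequality applies with the sum of the truncated
  second moments. With \<open>|T| = V\<close>, \<open>R = \<kappa>L\<close>, \<open>y = \<delta>L\<close> and \<open>L\<^sup>\<alpha> = V\<close> the bound is \<open>4 s \<kappa>\<^sup>2\<^sup>-\<^sup>\<alpha>/\<delta>\<^sup>2\<close>: it does not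
  vanish as \<open>V\<close> grows, but it does with \<open>\<kappa>\<close>.
\<close>

lemma prob_truncated_sum_large:
  assumes R: "R > 0" and y: "y > 0"
  shows "prob {\<omega> \<in> space Q. \<exists>t\<in>T. y < \<bar>\<Sum>j\<in>J. if \<bar>a t j * Z j \<omega>\<bar> \<le> R then a t j * Z j \<omega> else 0\<bar>}
     \<le> card T * (4 * s * R powr (2 - \<alpha>) / y\<^sup>2)"
proof -
  define U where "U t j \<omega> = (if \<bar>a t j * Z j \<omega>\<bar> \<le> R then a t j * Z j \<omega> else 0)" for t j \<omega>
  have Um[measurable]: "U t j \<in> borel_measurable Q" if "j \<in> J" for t j
    using that unfolding U_def by measurable
  have Ub: "\<bar>U t j \<omega>\<bar> \<le> R" for t j \<omega> using R by (simp add: U_def)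
  have Ui: "integrable Q (U t j)" if "j \<in> J" for t j
    using Ub that by (intro integrable_const_bound[where B=R]) auto
  have UUi: "integrable Q (\<lambda>\<omega>. U t i \<omega> * U t j \<omega>)" if "i \<in> J" "j \<in> J" for t i j
    using Ub that R by (intro integrable_const_bound[where B="R * R"]) (auto simp: abs_mult intro!: mult_mono)
  have law': "stable_law \<alpha> (\<bar>a t j\<bar> powr \<alpha> * m j) (distr Q borel (\<lambda>\<omega>. a t j * Z j \<omega>))" if "j \<in> J" for t j
    by (rule law_scaled[OF that])
  have U0: "expectation (U t j) = 0" if "j \<in> J" for t j
    using stable_law_truncated_mean[OF law'[OF that, of t], of R] that
    unfolding U_def by (subst (asm) integral_distr) auto
  have U2: "expectation (\<lambda>\<omega>. (U t j \<omega>)\<^sup>2) \<le> 4 * (\<bar>a t j\<bar> powr \<alpha> * m j) * R powr (2 - \<alpha>)" if "j \<in> J" for t j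
  proof -
    have "0 \<le> \<bar>a t j\<bar> powr \<alpha> * m j" using m_nonneg[of j] by simp
    from stable_law_truncated_second_moment[OF law'[OF that, of t] this R] show ?thesis
      using that unfolding U_def by (subst (asm) integral_distr) auto
  qed
  have cross: "expectation (\<lambda>\<omega>. U t i \<omega> * U t j \<omega>) = 0" if "i \<in> J" "j \<in> J" "i \<noteq> j" for t i j
  proof -
    have "indep_vars (\<lambda>_. borel) (\<lambda>k \<omega>. (\<lambda>z. if \<bar>a t k * z\<bar> \<le> R then a t k * z else 0) (Z k \<omega>)) {i, j}"
      by (rule indep_vars_compose2[OF indep_vars_subset[OF indep]]) (use that in auto)
    then have "indep_vars (\<lambda>_. borel) (U t) {i, j}"
      by (simp add: U_def[abs_def])
    from indep_vars_lebesgue_integral[OF _ this] Ui that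
    have "expectation (\<lambda>\<omega>. \<Prod>k\<in>{i, j}. U t k \<omega>) = (\<Prod>k\<in>{i, j}. expectation (U t k))" by auto
    then show ?thesis using that U0 by simp
  qed
  have one: "prob {\<omega> \<in> space Q. y < \<bar>\<Sum>j\<in>J. U t j \<omega>\<bar>} \<le> 4 * s * R powr (2 - \<alpha>) / y\<^sup>2" if t: "t \<in> T" for t
  proof -
    let ?S = "\<lambda>\<omega>. \<Sum>j\<in>J. U t j \<omega>"
    have sq: "(?S \<omega>)\<^sup>2 = (\<Sum>i\<in>J. \<Sum>j\<in>J. U t i \<omega> * U t j \<omega>)" for \<omega>
      by (simp add: power2_eq_square sum_product)
    have i2: "integrable Q (\<lambda>\<omega>. (?S \<omega>)\<^sup>2)"
      unfolding sq by (intro Bochner_Integration.integrable_sum UUi)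
    have "expectation (\<lambda>\<omega>. (?S \<omega>)\<^sup>2) = (\<Sum>i\<in>J. \<Sum>j\<in>J. expectation (\<lambda>\<omega>. U t i \<omega> * U t j \<omega>))"
      unfolding sq by (simp add: Bochner_Integration.integral_sum UUi)
    also have "\<dots> = (\<Sum>i\<in>J. \<Sum>j\<in>J. if j = i then expectation (\<lambda>\<omega>. (U t i \<omega>)\<^sup>2) else 0)"
      by (intro sum.cong) (auto simp: cross power2_eq_square)
    also have "\<dots> = (\<Sum>i\<in>J. expectation (\<lambda>\<omega>. (U t i \<omega>)\<^sup>2))"
      by (simp add: finJ)
    also have "\<dots> \<le> (\<Sum>i\<in>J. 4 * (\<bar>a t i\<bar> powr \<alpha> * m i) * R powr (2 - \<alpha>))"
      by (intro sum_mono U2)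
    also have "\<dots> = 4 * R powr (2 - \<alpha>) * (\<Sum>i\<in>J. m i * \<bar>a t i\<bar> powr \<alpha>)"
      by (simp add: sum_distrib_left mult_ac)
    also have "\<dots> \<le> 4 * R powr (2 - \<alpha>) * s"
      using scale[OF t] by (intro mult_left_mono) auto
    finally have E: "expectation (\<lambda>\<omega>. (?S \<omega>)\<^sup>2) \<le> 4 * s * R powr (2 - \<alpha>)" by (simp add: mult_ac)
    have "prob {\<omega> \<in> space Q. y < \<bar>?S \<omega>\<bar>} \<le> prob {\<omega> \<in> space Q. y\<^sup>2 \<le> (?S \<omega>)\<^sup>2}"
      using y by (intro finite_measure_mono) (auto simp: abs_le_square_iff[symmetric])
    also have "\<dots> \<le> expectation (\<lambda>\<omega>. (?S \<omega>)\<^sup>2) / y\<^sup>2"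
      using y by (intro integral_Markov_inequality_measure[OF i2, where A="space Q"]) auto
    also have "\<dots> \<le> 4 * s * R powr (2 - \<alpha>) / y\<^sup>2"
      using E by (intro divide_right_mono) auto
    finally show ?thesis .
  qed
  have "{\<omega> \<in> space Q. \<exists>t\<in>T. y < \<bar>\<Sum>j\<in>J. U t j \<omega>\<bar>} = (\<Union>t\<in>T. {\<omega> \<in> space Q. y < \<bar>\<Sum>j\<in>J. U t j \<omega>\<bar>})"
    by auto
  also have "prob \<dots> \<le> (\<Sum>t\<in>T. prob {\<omega> \<in> space Q. y < \<bar>\<Sum>j\<in>J. U t j \<omega>\<bar>})"
    by (rule finite_measure_subadditive_finite) (auto simp: finT)
  also have "\<dots> \<le> (\<Sum>t\<in>T. 4 * s * R powr (2 - \<alpha>) / y\<^sup>2)"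
    by (intro sum_mono one)
  finally show ?thesis unfolding U_def by simp
qed

text \<open>
  Outside the two exceptional events, \<open>S\<^sub>t\<close> is a remainder of size at most \<open>\<delta>\<close> plus at most one further term.
\<close>

lemma large_sum_iff_large_term:
  assumes R: "R > 0" and \<delta>: "0 < \<delta>" "\<delta> < x" "R \<le> x"
    and two: "\<not> (\<exists>t\<in>T. \<exists>i\<in>J. \<exists>j\<in>J. i \<noteq> j \<and> R < \<bar>a t i * Z i \<omega>\<bar> \<and> R < \<bar>a t j * Z j \<omega>\<bar>)"
    and trunc: "\<not> (\<exists>t\<in>T. \<delta> < \<bar>\<Sum>j\<in>J. if \<bar>a t j * Z j \<omega>\<bar> \<le> R then a t j * Z j \<omega> else 0\<bar>)"
  shows "\<exists>t\<in>T. x < \<bar>\<Sum>j\<in>J. a t j * Z j \<omega>\<bar> \<Longrightarrow> \<exists>t\<in>T. \<exists>j\<in>J. x - \<delta> < \<bar>a t j * Z j \<omega>\<bar>"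
    and "\<exists>t\<in>T. \<exists>j\<in>J. x + \<delta> < \<bar>a t j * Z j \<omega>\<bar> \<Longrightarrow> \<exists>t\<in>T. x < \<bar>\<Sum>j\<in>J. a t j * Z j \<omega>\<bar>"
proof -
  define U where "U t = (\<Sum>j\<in>J. if \<bar>a t j * Z j \<omega>\<bar> \<le> R then a t j * Z j \<omega> else 0)" for t
  have U: "\<bar>U t\<bar> \<le> \<delta>" if "t \<in> T" for t using trunc that by (force simp: U_def)
  have split: "(\<Sum>j\<in>J. a t j * Z j \<omega>) = U t + (\<Sum>j\<in>J. if \<bar>a t j * Z j \<omega>\<bar> \<le> R then 0 else a t j * Z j \<omega>)" for t
    unfolding U_def by (subst sum.distrib[symmetric], intro sum.cong) auto
  have single: "(\<Sum>j\<in>J. a t j * Z j \<omega>) = U t + a t i * Z i \<omega>" if t: "t \<in> T" and i: "i \<in> J" "R < \<bar>a t i * Z i \<omega>\<bar>" for t i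
  proof -
    have "(\<Sum>j\<in>J. if \<bar>a t j * Z j \<omega>\<bar> \<le> R then 0 else a t j * Z j \<omega>) = (\<Sum>j\<in>J. if j = i then a t i * Z i \<omega> else 0)"
    proof (intro sum.cong refl)
      fix j assume j: "j \<in> J"
      have "\<bar>a t j * Z j \<omega>\<bar> \<le> R" if "j \<noteq> i" using two t i j that by (meson not_le)
      then show "(if \<bar>a t j * Z j \<omega>\<bar> \<le> R then 0 else a t j * Z j \<omega>) = (if j = i then a t i * Z i \<omega> else 0)"
        using i by auto
    qed
    also have "\<dots> = a t i * Z i \<omega>" using i finJ by simp
    finally show ?thesis using split[of t] by simp
  qed
  show "\<exists>t\<in>T. \<exists>j\<in>J. x - \<delta> < \<bar>a t j * Z j \<omega>\<bar>" if "\<exists>t\<in>T. x < \<bar>\<Sum>j\<in>J. a t j * Z j \<omega>\<bar>"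
  proof -
    from that obtain t where t: "t \<in> T" "x < \<bar>\<Sum>j\<in>J. a t j * Z j \<omega>\<bar>" by blast
    have "\<exists>i\<in>J. R < \<bar>a t i * Z i \<omega>\<bar>"
    proof (rule ccontr)
      assume "\<not> (\<exists>i\<in>J. R < \<bar>a t i * Z i \<omega>\<bar>)"
      then have "(\<Sum>j\<in>J. if \<bar>a t j * Z j \<omega>\<bar> \<le> R then 0 else a t j * Z j \<omega>) = 0"
        by (intro sum.neutral) (auto simp: not_less)
      then show False using split[of t] U[OF t(1)] t(2) \<delta> by simp
    qed
    then obtain i where i: "i \<in> J" "R < \<bar>a t i * Z i \<omega>\<bar>" by blast
    have "x - \<delta> < \<bar>a t i * Z i \<omega>\<bar>"
      using t(2) U[OF t(1)] unfolding single[OF t(1) i] by linarith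
    then show ?thesis using t i by blast
  qed
  show "\<exists>t\<in>T. x < \<bar>\<Sum>j\<in>J. a t j * Z j \<omega>\<bar>" if "\<exists>t\<in>T. \<exists>j\<in>J. x + \<delta> < \<bar>a t j * Z j \<omega>\<bar>"
  proof -
    from that obtain t i where t: "t \<in> T" "i \<in> J" "x + \<delta> < \<bar>a t i * Z i \<omega>\<bar>" by blast
    then have "R < \<bar>a t i * Z i \<omega>\<bar>" using \<delta> by linarith
    then have "x < \<bar>\<Sum>j\<in>J. a t j * Z j \<omega>\<bar>"
      using t(3) U[OF t(1)] unfolding single[OF t(1,2) \<open>R < _\<close>] by linarith
    then show ?thesis using t by blast
  qed
qed

text \<open>
  A cell affects the maximum over \<open>T\<close> through its largest coefficient only.
\<close>

definition weight :: "'j \<Rightarrow> real" where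
  "weight j = Max ((\<lambda>t. \<bar>a t j\<bar>) ` T)"

text \<open>
  The discrete counterpart of \<open>\<integral> max |F\<^sub>t|\<^sup>\<alpha> d\<mu>\<close>.
\<close>

definition total_scale :: real where
  "total_scale = (\<Sum>j\<in>J. m j * weight j powr \<alpha>)"

lemma weight_attained: obtains t where "t \<in> T" "weight j = \<bar>a t j\<bar>"
proof -
  have "weight j \<in> (\<lambda>t. \<bar>a t j\<bar>) ` T" unfolding weight_def using finT T_ne by (intro Max_in) auto
  then show ?thesis using that by auto
qed

lemma weight_nonneg: "0 \<le> weight j"
  using weight_attained[of j] by (metis abs_ge_zero)

lemma scale_weight: assumes "j \<in> J" shows "m j * weight j powr \<alpha> \<le> s"
proof -
  obtain t where t: "t \<in> T" "weight j = \<bar>a t j\<bar>" by (rule weight_attained)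
  have "m j * \<bar>a t j\<bar> powr \<alpha> \<le> (\<Sum>j\<in>J. m j * \<bar>a t j\<bar> powr \<alpha>)"
    using assms finJ m_nonneg by (intro member_le_sum) auto
  also have "\<dots> \<le> s" by (rule scale[OF t(1)])
  finally show ?thesis using t by simp
qed

text \<open>
  By independence the probability that no term is large is the product of \<open>1 - p\<^sub>j\<close> with \<open>p\<^sub>j\<close> close to
  \<open>q\<^sub>j = C\<^sub>\<alpha> m\<^sub>j w\<^sub>j\<^sup>\<alpha> x\<^sup>-\<^sup>\<alpha>\<close>. Each \<open>q\<^sub>j\<close> is at most \<open>C\<^sub>\<alpha> s x\<^sup>-\<^sup>\<alpha>\<close>, hence small, so that the product is close to that of the
  \<open>exp (- q\<^sub>j)\<close>.
\<close>

lemma prob_large_term: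
  assumes \<epsilon>: "\<epsilon> \<ge> 0" and Ra: "stable_tail_asymptotics \<alpha> \<epsilon> R0"
    and x: "x > 0" "R0 * s \<le> x powr \<alpha>"
  shows "\<bar>prob {\<omega> \<in> space Q. \<exists>t\<in>T. \<exists>j\<in>J. x < \<bar>a t j * Z j \<omega>\<bar>} - (1 - exp (- (stable_const \<alpha> * total_scale * x powr (- \<alpha>))))\<bar>
     \<le> \<epsilon> * total_scale * x powr (- \<alpha>) + (stable_const \<alpha>)\<^sup>2 * s * total_scale * (x powr (- \<alpha>))\<^sup>2"
proof (cases "J = {}")
  case True
  have "total_scale = 0" unfolding total_scale_def using True by simp
  then show ?thesis using True by simp
next
  case False
  note R0 = stable_tail_asymptoticsD[OF Ra]
  define p where "p j = prob {\<omega> \<in> space Q. x < \<bar>weight j * Z j \<omega>\<bar>}" for j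
  define q where "q j = stable_const \<alpha> * (m j * weight j powr \<alpha>) * x powr (- \<alpha>)" for j
  have C: "stable_const \<alpha> > 0" by (rule stable_const_pos[OF alpha])
  have mw: "0 \<le> m j * weight j powr \<alpha>" for j using m_nonneg by simp
  have q0: "0 \<le> q j" for j unfolding q_def using C m_nonneg[of j] by (intro mult_nonneg_nonneg) auto
  have pq: "\<bar>p j - q j\<bar> \<le> \<epsilon> * (m j * weight j powr \<alpha>) * x powr (- \<alpha>)" if j: "j \<in> J" for j
  proof -
    have "R0 * (\<bar>weight j\<bar> powr \<alpha> * m j) \<le> R0 * s"
      using scale_weight[OF j] R0(2) weight_nonneg[of j] by (intro mult_left_mono) (auto simp: mult.commute)
    then have "R0 * (\<bar>weight j\<bar> powr \<alpha> * m j) \<le> x powr \<alpha>" using x by linarith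
    from R0(1)[OF law_scaled[OF j] _ x(1) this] show ?thesis
      unfolding p_def q_def prob_scaled[OF j]
      using m_nonneg[of j] weight_nonneg[of j] by (simp add: mult_ac)
  qed
  have ev: "Z j -` {z. \<not> x < \<bar>weight j * z\<bar>} \<inter> space Q = {\<omega>\<in>space Q. \<not> x < \<bar>weight j * Z j \<omega>\<bar>}" for j by auto
  have eq: "(\<exists>t\<in>T. x < \<bar>a t j * z\<bar>) \<longleftrightarrow> x < \<bar>weight j * z\<bar>" for j z
  proof
    assume "\<exists>t\<in>T. x < \<bar>a t j * z\<bar>"
    then obtain t where t: "t \<in> T" "x < \<bar>a t j * z\<bar>" by blast
    have "\<bar>a t j\<bar> \<le> weight j" unfolding weight_def using t finT by (intro Max_ge) auto
    then have "\<bar>a t j\<bar> * \<bar>z\<bar> \<le> weight j * \<bar>z\<bar>" by (intro mult_right_mono) auto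
    then show "x < \<bar>weight j * z\<bar>" using t weight_nonneg[of j] by (simp add: abs_mult)
  next
    assume "x < \<bar>weight j * z\<bar>"
    then show "\<exists>t\<in>T. x < \<bar>a t j * z\<bar>"
      by (metis weight_attained abs_mult abs_idempotent)
  qed
  have "{\<omega> \<in> space Q. \<exists>t\<in>T. \<exists>j\<in>J. x < \<bar>a t j * Z j \<omega>\<bar>} = space Q - (\<Inter>j\<in>J. Z j -` {z. \<not> x < \<bar>weight j * z\<bar>} \<inter> space Q)"
    using False eq by (auto simp: not_less) (meson not_le)+
  then have "prob {\<omega> \<in> space Q. \<exists>t\<in>T. \<exists>j\<in>J. x < \<bar>a t j * Z j \<omega>\<bar>} = 1 - prob (\<Inter>j\<in>J. Z j -` {z. \<not> x < \<bar>weight j * z\<bar>} \<inter> space Q)"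
    using False finJ by (simp add: prob_compl ev)
  also have "prob (\<Inter>j\<in>J. Z j -` {z. \<not> x < \<bar>weight j * z\<bar>} \<inter> space Q) = (\<Prod>j\<in>J. prob (Z j -` {z. \<not> x < \<bar>weight j * z\<bar>} \<inter> space Q))"
    by (rule indep_varsD[OF indep False finJ]) auto
  also have "\<dots> = (\<Prod>j\<in>J. 1 - p j)"
  proof (rule prod.cong[OF refl])
    fix j assume j: "j \<in> J"
    have "prob {\<omega>\<in>space Q. \<not> x < \<bar>weight j * Z j \<omega>\<bar>} = 1 - p j"
      unfolding p_def using j by (intro prob_neg) measurable
    then show "prob (Z j -` {z. \<not> x < \<bar>weight j * z\<bar>} \<inter> space Q) = 1 - p j" by (simp only: ev)
  qed
  finally have P: "prob {\<omega> \<in> space Q. \<exists>t\<in>T. \<exists>j\<in>J. x < \<bar>a t j * Z j \<omega>\<bar>} = 1 - (\<Prod>j\<in>J. 1 - p j)" .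
  have ex: "exp (- (stable_const \<alpha> * total_scale * x powr (- \<alpha>))) = (\<Prod>j\<in>J. exp (- q j))"
    by (simp add: exp_sum[OF finJ, symmetric] sum_negf total_scale_def q_def sum_distrib_left sum_distrib_right)
  have factor: "\<bar>(1 - p j) - exp (- q j)\<bar> \<le> \<epsilon> * (m j * weight j powr \<alpha>) * x powr (- \<alpha>) + (stable_const \<alpha>)\<^sup>2 * s * (m j * weight j powr \<alpha>) * (x powr (- \<alpha>))\<^sup>2"
    if j: "j \<in> J" for j
  proof -
    have "1 - q j \<le> exp (- q j)" using exp_ge_add_one_self[of "- q j"] by simp
    \<comment> \<open>Since \<open>(1 - q + q\<^sup>2) (1 + q) = 1 + q\<^sup>3 \<ge> 1\<close> for \<open>q \<ge> 0\<close>.\<close>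
    moreover have "exp (- q j) \<le> 1 - q j + (q j)\<^sup>2"
    proof (cases "q j \<le> 1")
      case True
      have "exp (- q j) = 1 / exp (q j)" by (simp add: exp_minus inverse_eq_divide)
      also have "\<dots> \<le> 1 / (1 + q j)" using exp_ge_add_one_self[of "q j"] q0[of j] by (intro divide_left_mono) auto
      also have "\<dots> \<le> 1 - q j + (q j)\<^sup>2"
      proof -
        have "1 \<le> (1 - q j + (q j)\<^sup>2) * (1 + q j)"
          using q0[of j] by (simp add: algebra_simps power2_eq_square power3_eq_cube)
        then show ?thesis using q0[of j] by (simp add: divide_le_eq)
      qed
      finally show ?thesis .
    next
      case False
      then have "1 * q j \<le> q j * q j" by (intro mult_right_mono) auto
      moreover have "exp (- q j) \<le> 1" using q0[of j] by simp
      ultimately show ?thesis unfolding power2_eq_square by linarith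
    qed
    moreover have "(q j)\<^sup>2 \<le> (stable_const \<alpha>)\<^sup>2 * s * (m j * weight j powr \<alpha>) * (x powr (- \<alpha>))\<^sup>2"
    proof -
      have "(m j * weight j powr \<alpha>) * (m j * weight j powr \<alpha>) \<le> s * (m j * weight j powr \<alpha>)"
        by (intro mult_right_mono scale_weight[OF j] mw)
      then have "((stable_const \<alpha>)\<^sup>2 * (x powr (- \<alpha>))\<^sup>2) * ((m j * weight j powr \<alpha>) * (m j * weight j powr \<alpha>)) \<le> ((stable_const \<alpha>)\<^sup>2 * (x powr (- \<alpha>))\<^sup>2) * (s * (m j * weight j powr \<alpha>))"
        by (intro mult_left_mono) auto
      then show ?thesis by (simp add: q_def power2_eq_square mult_ac)
    qed
    ultimately show ?thesis using pq[OF j] by linarith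
  qed
  have p01: "0 \<le> p j" "p j \<le> 1" for j unfolding p_def by auto
  have "\<bar>(\<Prod>j\<in>J. 1 - p j) - (\<Prod>j\<in>J. exp (- q j))\<bar> \<le> (\<Sum>j\<in>J. \<bar>(1 - p j) - exp (- q j)\<bar>)"
    using norm_prod_diff[of J "\<lambda>j. 1 - p j" "\<lambda>j. exp (- q j)"] p01 q0 by simp
  also have "\<dots> \<le> (\<Sum>j\<in>J. \<epsilon> * (m j * weight j powr \<alpha>) * x powr (- \<alpha>) + (stable_const \<alpha>)\<^sup>2 * s * (m j * weight j powr \<alpha>) * (x powr (- \<alpha>))\<^sup>2)"
    by (intro sum_mono factor)
  also have "\<dots> = \<epsilon> * total_scale * x powr (- \<alpha>) + (stable_const \<alpha>)\<^sup>2 * s * total_scale * (x powr (- \<alpha>))\<^sup>2"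
    by (simp add: sum.distrib total_scale_def sum_distrib_left sum_distrib_right)
  finally show ?thesis unfolding P ex by (simp add: abs_minus_commute)
qed

lemma prob_large_sum_bounds:
  assumes K: "stable_tail_bound \<alpha> K"
    and \<epsilon>: "\<epsilon> \<ge> 0" and R0: "stable_tail_asymptotics \<alpha> \<epsilon> R0"
    and x: "0 < R" "R \<le> x" "0 < \<delta>" "\<delta> < x" "R0 * s \<le> (x - \<delta>) powr \<alpha>"
  defines "h \<equiv> \<lambda>y. 1 - exp (- (stable_const \<alpha> * total_scale * y powr (- \<alpha>)))"
    and "err \<equiv> \<lambda>y. \<epsilon> * total_scale * y powr (- \<alpha>) + (stable_const \<alpha>)\<^sup>2 * s * total_scale * (y powr (- \<alpha>))\<^sup>2"
    and "bad \<equiv> card T * (K * s * R powr (- \<alpha>))\<^sup>2 + card T * (4 * s * R powr (2 - \<alpha>) / \<delta>\<^sup>2)"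
  shows "prob {\<omega> \<in> space Q. \<exists>t\<in>T. x < \<bar>\<Sum>j\<in>J. a t j * Z j \<omega>\<bar>} \<le> h (x - \<delta>) + err (x - \<delta>) + bad"
    and "h (x + \<delta>) - err (x + \<delta>) - bad \<le> prob {\<omega> \<in> space Q. \<exists>t\<in>T. x < \<bar>\<Sum>j\<in>J. a t j * Z j \<omega>\<bar>}"
proof -
  define E where "E y = {\<omega> \<in> space Q. \<exists>t\<in>T. \<exists>j\<in>J. y < \<bar>a t j * Z j \<omega>\<bar>}" for y
  define A where "A = {\<omega> \<in> space Q. \<exists>t\<in>T. x < \<bar>\<Sum>j\<in>J. a t j * Z j \<omega>\<bar>}"
  define B1 where "B1 = {\<omega> \<in> space Q. \<exists>t\<in>T. \<exists>i\<in>J. \<exists>j\<in>J. i \<noteq> j \<and> R < \<bar>a t i * Z i \<omega>\<bar> \<and> R < \<bar>a t j * Z j \<omega>\<bar>}"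
  define B2 where "B2 = {\<omega> \<in> space Q. \<exists>t\<in>T. \<delta> < \<bar>\<Sum>j\<in>J. if \<bar>a t j * Z j \<omega>\<bar> \<le> R then a t j * Z j \<omega> else 0\<bar>}"
  have EA: "E y = (\<Union>t\<in>T. \<Union>j\<in>J. {\<omega> \<in> space Q. y < \<bar>a t j * Z j \<omega>\<bar>})"
    "A = (\<Union>t\<in>T. {\<omega> \<in> space Q. x < \<bar>\<Sum>j\<in>J. a t j * Z j \<omega>\<bar>})"
    "B1 = (\<Union>t\<in>T. \<Union>i\<in>J. \<Union>j\<in>J - {i}. {\<omega> \<in> space Q. R < \<bar>a t i * Z i \<omega>\<bar>} \<inter> {\<omega> \<in> space Q. R < \<bar>a t j * Z j \<omega>\<bar>})"
    "B2 = (\<Union>t\<in>T. {\<omega> \<in> space Q. \<delta> < \<bar>\<Sum>j\<in>J. if \<bar>a t j * Z j \<omega>\<bar> \<le> R then a t j * Z j \<omega> else 0\<bar>})" for y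
    unfolding E_def A_def B1_def B2_def by blast+
  have [measurable]: "E y \<in> sets Q" "A \<in> sets Q" "B1 \<in> sets Q" "B2 \<in> sets Q" for y
    unfolding EA using finT finJ by (auto intro!: sets.finite_UN sets.Int)
  have bad: "prob B1 + prob B2 \<le> bad"
    unfolding B1_def B2_def bad_def
    by (intro add_mono prob_two_large[OF K x(1)] prob_truncated_sum_large x)
  have Ebound: "\<bar>prob (E y) - h y\<bar> \<le> err y" if "x - \<delta> \<le> y" for y
  proof -
    have "(x - \<delta>) powr \<alpha> \<le> y powr \<alpha>" using that x alpha by (intro powr_mono2) auto
    then show ?thesis
      unfolding E_def h_def err_def using that x by (intro prob_large_term[OF \<epsilon> R0]) auto
  qed
  have "A \<subseteq> E (x - \<delta>) \<union> (B1 \<union> B2)"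
  proof
    fix \<omega> assume \<omega>: "\<omega> \<in> A"
    show "\<omega> \<in> E (x - \<delta>) \<union> (B1 \<union> B2)"
    proof (cases "\<omega> \<in> B1 \<union> B2")
      case False
      then have "\<omega> \<in> E (x - \<delta>)"
        using \<omega> large_sum_iff_large_term(1)[OF x(1,3,4,2), of \<omega>]
        unfolding A_def E_def B1_def B2_def by blast
      then show ?thesis by simp
    qed simp
  qed
  then have "prob A \<le> prob (E (x - \<delta>) \<union> (B1 \<union> B2))" by (intro finite_measure_mono) auto
  also have "\<dots> \<le> prob (E (x - \<delta>)) + (prob B1 + prob B2)"
    by (intro order_trans[OF measure_Un_le] add_left_mono measure_Un_le) auto
  finally show "prob {\<omega> \<in> space Q. \<exists>t\<in>T. x < \<bar>\<Sum>j\<in>J. a t j * Z j \<omega>\<bar>} \<le> h (x - \<delta>) + err (x - \<delta>) + bad"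
    using Ebound[of "x - \<delta>"] bad unfolding A_def by simp
  have "E (x + \<delta>) \<subseteq> A \<union> (B1 \<union> B2)"
  proof
    fix \<omega> assume \<omega>: "\<omega> \<in> E (x + \<delta>)"
    show "\<omega> \<in> A \<union> (B1 \<union> B2)"
    proof (cases "\<omega> \<in> B1 \<union> B2")
      case False
      then have "\<omega> \<in> A"
        using \<omega> large_sum_iff_large_term(2)[OF x(1,3,4,2), of \<omega>]
        unfolding A_def E_def B1_def B2_def by blast
      then show ?thesis by simp
    qed simp
  qed
  then have "prob (E (x + \<delta>)) \<le> prob (A \<union> (B1 \<union> B2))" by (intro finite_measure_mono) auto
  also have "\<dots> \<le> prob A + (prob B1 + prob B2)"
    by (intro order_trans[OF measure_Un_le] add_left_mono measure_Un_le) auto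
  finally show "h (x + \<delta>) - err (x + \<delta>) - bad \<le> prob {\<omega> \<in> space Q. \<exists>t\<in>T. x < \<bar>\<Sum>j\<in>J. a t j * Z j \<omega>\<bar>}"
    using Ebound[of "x + \<delta>"] bad x unfolding A_def by simp
qed

end

section \<open>Stable integrals of simple functions\<close>

text \<open>
  A substitute for Minkowski's inequality that covers \<open>\<alpha> < 1\<close> and \<open>\<alpha> \<ge> 1\<close> alike: either \<open>x\<close> and \<open>y\<close> are relatively
  close, and continuity of the power at \<open>1\<close> applies, or both are dominated by \<open>|x - y|\<close>.
\<close>

lemma powr_perturbation:
  assumes a: "0 < \<alpha>" and e: "0 < \<epsilon>"
  obtains C where "C > 0" "\<And>x y :: real. x \<ge> 0 \<Longrightarrow> y \<ge> 0 \<Longrightarrow> \<bar>x powr \<alpha> - y powr \<alpha>\<bar> \<le> \<epsilon> * y powr \<alpha> + C * \<bar>x - y\<bar> powr \<alpha>"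
proof -
  have "isCont (\<lambda>x::real. x powr \<alpha>) 1" by (intro continuous_intros) auto
  then obtain d where d: "d > 0" "\<And>x. dist x 1 < d \<Longrightarrow> dist (x powr \<alpha>) (1 powr \<alpha>) < \<epsilon>"
    using e unfolding continuous_at_eps_delta by metis
  define C where "C = (1 + 1 / d) powr \<alpha>"
  have "1 + 1 / d > 0" using d by (simp add: add_pos_pos)
  then have C: "C > 0" by (simp add: C_def)
  show ?thesis
  proof (rule that[OF C])
    fix x y :: real assume xy: "x \<ge> 0" "y \<ge> 0"
    show "\<bar>x powr \<alpha> - y powr \<alpha>\<bar> \<le> \<epsilon> * y powr \<alpha> + C * \<bar>x - y\<bar> powr \<alpha>"
    proof (cases "\<bar>x - y\<bar> < d * y")
      case True
      then have y: "y > 0" using d(1) xy by (cases "y = 0") auto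
      have "dist (x / y) 1 < d" using True y by (simp add: dist_real_def field_simps abs_less_iff)
      from d(2)[OF this] have "\<bar>(x / y) powr \<alpha> - 1\<bar> \<le> \<epsilon>" by (simp add: dist_real_def)
      then have "\<bar>(x / y) powr \<alpha> - 1\<bar> * y powr \<alpha> \<le> \<epsilon> * y powr \<alpha>" by (intro mult_right_mono) auto
      also have "\<bar>(x / y) powr \<alpha> - 1\<bar> * y powr \<alpha> = \<bar>((x / y) powr \<alpha> - 1) * y powr \<alpha>\<bar>" by (simp add: abs_mult)
      also have "((x / y) powr \<alpha> - 1) * y powr \<alpha> = x powr \<alpha> - y powr \<alpha>"
        using y xy by (simp add: powr_divide field_simps)
      finally show ?thesis using C by (simp add: add_increasing2)
    next
      case False
      then have y: "y \<le> \<bar>x - y\<bar> / d" using d by (simp add: field_simps)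
      moreover have "x \<le> y + \<bar>x - y\<bar>" by simp
      ultimately have "x \<le> (1 + 1 / d) * \<bar>x - y\<bar>" by (simp add: algebra_simps)
      moreover have "y \<le> (1 + 1 / d) * \<bar>x - y\<bar>" using y by (simp add: algebra_simps add_increasing)
      ultimately have "x powr \<alpha> \<le> ((1 + 1 / d) * \<bar>x - y\<bar>) powr \<alpha>" "y powr \<alpha> \<le> ((1 + 1 / d) * \<bar>x - y\<bar>) powr \<alpha>"
        using xy a by (auto intro!: powr_mono2)
      moreover have "((1 + 1 / d) * \<bar>x - y\<bar>) powr \<alpha> = C * \<bar>x - y\<bar> powr \<alpha>"
        using d by (simp add: C_def powr_mult)
      moreover have "0 \<le> x powr \<alpha>" "0 \<le> y powr \<alpha>" "0 \<le> \<epsilon> * y powr \<alpha>" using e by auto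
      ultimately show ?thesis by linarith
    qed
  qed
qed

lemma Max_abs_diff_le_sum:
  fixes f g :: "'t \<Rightarrow> real"
  assumes T: "finite T" "T \<noteq> {}"
  shows "\<bar>Max (f ` T) - Max (g ` T)\<bar> \<le> (\<Sum>t\<in>T. \<bar>f t - g t\<bar>)"
proof -
  have *: "Max (f ` T) \<le> Max (g ` T) + (\<Sum>t\<in>T. \<bar>f t - g t\<bar>)" for f g :: "'t \<Rightarrow> real"
  proof -
    have "f t \<le> Max (g ` T) + (\<Sum>t\<in>T. \<bar>f t - g t\<bar>)" if t: "t \<in> T" for t
    proof -
      have "\<bar>f t - g t\<bar> \<le> (\<Sum>t\<in>T. \<bar>f t - g t\<bar>)" using T t by (intro member_le_sum) auto
      moreover have "g t \<le> Max (g ` T)" using T t by (intro Max_ge) auto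
      ultimately show ?thesis by linarith
    qed
    then show ?thesis using T by (subst Max_le_iff) auto
  qed
  have "(\<Sum>t\<in>T. \<bar>g t - f t\<bar>) = (\<Sum>t\<in>T. \<bar>f t - g t\<bar>)" by (simp add: abs_minus_commute)
  then show ?thesis using *[of f g] *[of g f] by linarith
qed

text \<open>
  Additivity along the constant sequence of empty sets gives a convergent series with constant terms.
\<close>

lemma SaS_random_measure_empty:
  fixes N :: "'s set \<Rightarrow> 'b \<Rightarrow> real"
  assumes N: "SaS_random_measure \<alpha> Q \<mu> N"
  shows "AE \<omega> in Q. N {} \<omega> = 0"
proof -
  have "AE \<omega> in Q. (\<lambda>i::nat. N ((\<lambda>_. {}) i) \<omega>) sums N (\<Union>i::nat. (\<lambda>_. {}) i) \<omega>"
  proof -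
    from N have "\<forall>A :: nat \<Rightarrow> 's set. disjoint_family A \<and> (\<forall>i. A i \<in> sets \<mu> \<and> emeasure \<mu> (A i) < \<infinity>) \<longrightarrow>
        (emeasure \<mu> (\<Union>i. A i) < \<infinity> \<longrightarrow> (AE \<omega> in Q. (\<lambda>i. N (A i) \<omega>) sums N (\<Union>i. A i) \<omega>))"
      unfolding SaS_random_measure_def by blast
    from this[rule_format, of "\<lambda>_. {}"] show ?thesis by (simp add: disjoint_family_on_def)
  qed
  then show ?thesis
  proof (rule eventually_mono)
    fix \<omega> assume "(\<lambda>i::nat. N ((\<lambda>_. {}) i) \<omega>) sums N (\<Union>i::nat. (\<lambda>_. {}) i) \<omega>"
    then have "summable (\<lambda>i::nat. N {} \<omega>)" by (auto simp: sums_iff)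
    then have "(\<lambda>i::nat. N {} \<omega>) \<longlonglongrightarrow> 0" by (rule summable_LIMSEQ_zero)
    then show "N {} \<omega> = 0" by (simp add: LIMSEQ_const_iff)
  qed
qed

lemma SaS_random_measure_additive:
  assumes N: "SaS_random_measure \<alpha> Q \<mu> N"
    and I: "finite I" and A: "\<And>i. i \<in> I \<Longrightarrow> A i \<in> sets \<mu> \<and> emeasure \<mu> (A i) < \<infinity>"
    and disj: "disjoint_family_on A I"
  shows "AE \<omega> in Q. N (\<Union>i\<in>I. A i) \<omega> = (\<Sum>i\<in>I. N (A i) \<omega>)"
proof -
  obtain e where e: "bij_betw e {0..<card I} I" using ex_bij_betw_nat_finite[OF I] by blast
  define B where "B k = (if k < card I then A (e k) else {})" for k
  have eI: "e k \<in> I" if "k < card I" for k using e that by (auto simp: bij_betw_def)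
  have BU: "(\<Union>k. B k) = (\<Union>i\<in>I. A i)"
  proof -
    have "(\<Union>k. B k) = (\<Union>k\<in>{0..<card I}. A (e k))" by (auto simp: B_def split: if_splits)
    also have "\<dots> = (\<Union>i\<in>e ` {0..<card I}. A i)" by auto
    also have "e ` {0..<card I} = I" using e by (simp add: bij_betw_def)
    finally show ?thesis .
  qed
  have "disjoint_family B"
    unfolding disjoint_family_on_def
  proof (intro ballI impI)
    fix k l :: nat assume kl: "k \<noteq> l"
    show "B k \<inter> B l = {}"
    proof (cases "k < card I \<and> l < card I")
      case True
      then have "e k \<noteq> e l" using e kl by (auto simp: bij_betw_def inj_on_def)
      then show ?thesis using disj True eI by (auto simp: B_def disjoint_family_on_def)
    qed (auto simp: B_def)
  qed
  moreover have "B i \<in> sets \<mu> \<and> emeasure \<mu> (B i) < \<infinity>" for i using A eI by (auto simp: B_def)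
  moreover have "emeasure \<mu> (\<Union>i. B i) < \<infinity>"
  proof -
    have "emeasure \<mu> (\<Union>i\<in>I. A i) \<le> (\<Sum>i\<in>I. emeasure \<mu> (A i))"
      by (rule emeasure_subadditive_finite[OF I]) (use A in auto)
    also have "\<dots> < \<infinity>" using A I by (simp add: sum_Pinfty less_top)
    finally show ?thesis by (simp add: BU)
  qed
  ultimately have "AE \<omega> in Q. (\<lambda>i. N (B i) \<omega>) sums N (\<Union>i. B i) \<omega>"
    using N unfolding SaS_random_measure_def by blast
  with SaS_random_measure_empty[OF N] show ?thesis
  proof eventually_elim
    fix \<omega> assume *: "N {} \<omega> = 0" "(\<lambda>i. N (B i) \<omega>) sums N (\<Union>i. B i) \<omega>"
    have "(\<lambda>i. N (B i) \<omega>) sums (\<Sum>i\<in>{0..<card I}. N (B i) \<omega>)"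
      by (rule sums_finite) (auto simp: B_def *(1))
    with *(2) have "N (\<Union>i. B i) \<omega> = (\<Sum>i\<in>{0..<card I}. N (B i) \<omega>)" by (rule sums_unique2)
    also have "\<dots> = (\<Sum>k\<in>{0..<card I}. N (A (e k)) \<omega>)" by (intro sum.cong) (auto simp: B_def)
    also have "\<dots> = (\<Sum>i\<in>I. N (A i) \<omega>)" by (rule sum.reindex_bij_betw[OF e])
    finally show "N (\<Union>i\<in>I. A i) \<omega> = (\<Sum>i\<in>I. N (A i) \<omega>)" by (simp add: BU)
  qed
qed

definition joint_values :: "'t set \<Rightarrow> ('t \<Rightarrow> 's \<Rightarrow> real) \<Rightarrow> 's \<Rightarrow> 't \<Rightarrow> real" where
  "joint_values T G x = (\<lambda>t\<in>T. G t x)"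

definition joint_level :: "'s measure \<Rightarrow> 't set \<Rightarrow> ('t \<Rightarrow> 's \<Rightarrow> real) \<Rightarrow> ('t \<Rightarrow> real) \<Rightarrow> 's set" where
  "joint_level \<mu> T G v = {x \<in> space \<mu>. joint_values T G x = v}"

text \<open>
  The joint level sets of finitely many simple functions are disjoint, so their random measures are independent, and
  every one of the functions is constant on each of them.
  The cell on which all functions vanish is left out, as it may have infinite measure.
\<close>

lemma simple_integrals_as_array:
  fixes N :: "'s set \<Rightarrow> 'b \<Rightarrow> real" and T :: "'t set"
  assumes alpha: "0 < \<alpha>" "\<alpha> < 2" and N: "SaS_random_measure \<alpha> Q \<mu> N"
    and T: "finite T" "T \<noteq> {}"
    and G: "\<And>t. t \<in> T \<Longrightarrow> simple_function \<mu> (G t)" "\<And>t. t \<in> T \<Longrightarrow> emeasure \<mu> {x \<in> space \<mu>. G t x \<noteq> 0} < \<infinity>"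
    and s: "\<And>t. t \<in> T \<Longrightarrow> (\<integral>x. \<bar>G t x\<bar> powr \<alpha> \<partial>\<mu>) \<le> s"
  obtains J :: "nat set" and Z m a where
    "stable_array Q \<alpha> J Z m T a s"
    "stable_array.total_scale \<alpha> J m T a = (\<integral>x. Max ((\<lambda>t. \<bar>G t x\<bar> powr \<alpha>) ` T) \<partial>\<mu>)"
    "\<And>t. t \<in> T \<Longrightarrow> AE \<omega> in Q. simple_stable_integral \<mu> N (G t) \<omega> = (\<Sum>j\<in>J. a t j * Z j \<omega>)"
proof -
  interpret Q: prob_space Q using N by (simp add: SaS_random_measure_def)
  define zero where "zero = (\<lambda>t\<in>T. 0 :: real)"
  define V where "V = joint_values T G ` space \<mu> - {zero}"
  define A where "A = joint_level \<mu> T G"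
  have "joint_values T G ` space \<mu> \<subseteq> PiE T (\<lambda>t. G t ` space \<mu>)"
    by (auto simp: joint_values_def)
  moreover have "finite (PiE T (\<lambda>t. G t ` space \<mu>))"
    using T G by (intro finite_PiE) (auto simp: simple_function_def)
  ultimately have finV: "finite V" unfolding V_def by (meson finite_Diff finite_subset)
  have vext: "v \<in> extensional T" if "v \<in> V" for v using that by (auto simp: V_def joint_values_def)
  have Aeq: "A v = {x \<in> space \<mu>. \<forall>t\<in>T. G t x = v t}" if "v \<in> V" for v
    unfolding A_def joint_level_def joint_values_def using vext[OF that] by (auto simp: fun_eq_iff extensional_def)
  have Gm: "G t \<in> borel_measurable \<mu>" if "t \<in> T" for t using G(1)[OF that] by (rule borel_measurable_simple_function)
  have Asets: "A v \<in> sets \<mu>" if "v \<in> V" for v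
  proof -
    have "{x \<in> space \<mu>. G t x = v t} \<in> sets \<mu>" if "t \<in> T" for t using Gm[OF that] by measurable
    then show ?thesis unfolding Aeq[OF that] using T(1) by (intro sets.sets_Collect_finite_All) auto
  qed
  have Afin: "emeasure \<mu> (A v) < \<infinity>" if v: "v \<in> V" for v
  proof -
    have "v \<noteq> zero" using v by (simp add: V_def)
    then obtain t where t: "t \<in> T" "v t \<noteq> 0"
      using vext[OF v] unfolding zero_def by (metis (no_types, lifting) extensionalityI restrict_apply' restrict_extensional)
    then have "A v \<subseteq> {x \<in> space \<mu>. G t x \<noteq> 0}" unfolding Aeq[OF v] by auto
    then have "emeasure \<mu> (A v) \<le> emeasure \<mu> {x \<in> space \<mu>. G t x \<noteq> 0}"
      using Gm[OF t(1)] by (intro emeasure_mono) auto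
    then show ?thesis using G(2)[OF t(1)] by simp
  qed
  have Adisj: "disjoint_family_on A U" for U
    by (auto simp: disjoint_family_on_def A_def joint_level_def)
  obtain e where e: "bij_betw e {0..<card V} V" using ex_bij_betw_nat_finite[OF finV] by blast
  have eV: "e k \<in> V" if "k < card V" for k using e that by (auto simp: bij_betw_def)
  define J where "J = {0..<card V}"
  define B where "B k = (if k < card V then A (e k) else {})" for k
  define Z where "Z k = N (B k)" for k
  define m where "m k = measure \<mu> (B k)" for k
  define a where "a t k = e k t" for t k
  have Bdisj: "disjoint_family B"
    unfolding disjoint_family_on_def
  proof (intro ballI impI)
    fix k l :: nat assume kl: "k \<noteq> l"
    show "B k \<inter> B l = {}"
    proof (cases "k < card V \<and> l < card V")
      case True
      then have "e k \<noteq> e l" using e kl by (auto simp: bij_betw_def inj_on_def)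
      then show ?thesis using Adisj[of UNIV] True by (auto simp: B_def disjoint_family_on_def)
    qed (auto simp: B_def)
  qed
  have Bsets: "B k \<in> sets \<mu> \<and> emeasure \<mu> (B k) < \<infinity>" for k using Asets Afin eV by (auto simp: B_def)
  have sumV: "(\<Sum>k\<in>J. g (m k) (e k)) = (\<Sum>v\<in>V. g (measure \<mu> (A v)) v)" for g :: "real \<Rightarrow> ('t \<Rightarrow> real) \<Rightarrow> real"
  proof -
    have "(\<Sum>k\<in>J. g (m k) (e k)) = (\<Sum>k\<in>{0..<card V}. g (measure \<mu> (A (e k))) (e k))"
      by (intro sum.cong) (auto simp: J_def m_def B_def)
    also have "\<dots> = (\<Sum>v\<in>V. g (measure \<mu> (A v)) v)"
      by (rule sum.reindex_bij_betw[OF e, of "\<lambda>v. g (measure \<mu> (A v)) v"])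
    finally show ?thesis .
  qed
  have int: "(\<Sum>k\<in>J. m k * g (e k)) = (\<integral>x. g (joint_values T G x) \<partial>\<mu>)" if g0: "g zero = 0" for g :: "('t \<Rightarrow> real) \<Rightarrow> real"
  proof -
    have "g (joint_values T G x) = (\<Sum>v\<in>V. indicator (A v) x *\<^sub>R g v)" if x: "x \<in> space \<mu>" for x
    proof -
      have "(\<Sum>v\<in>V. indicator (A v) x *\<^sub>R g v) = (\<Sum>v\<in>V. if v = joint_values T G x then g v else 0)"
        using x by (intro sum.cong) (auto simp: A_def joint_level_def indicator_def)
      also have "\<dots> = g (joint_values T G x)"
        using finV x g0 by (auto simp: V_def)
      finally show ?thesis by simp
    qed
    then have "(\<integral>x. g (joint_values T G x) \<partial>\<mu>) = (\<integral>x. (\<Sum>v\<in>V. indicator (A v) x *\<^sub>R g v) \<partial>\<mu>)"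
      by (intro Bochner_Integration.integral_cong) auto
    also have "\<dots> = (\<Sum>v\<in>V. \<integral>x. indicator (A v) x *\<^sub>R g v \<partial>\<mu>)"
      using Asets Afin by (intro Bochner_Integration.integral_sum integrable_scaleR_left integrable_real_indicator) auto
    also have "\<dots> = (\<Sum>v\<in>V. measure \<mu> (A v) * g v)"
    proof (intro sum.cong refl)
      fix v assume v: "v \<in> V"
      have "A v \<inter> space \<mu> = A v" using sets.sets_into_space[OF Asets[OF v]] by auto
      then show "(\<integral>x. indicator (A v) x *\<^sub>R g v \<partial>\<mu>) = measure \<mu> (A v) * g v"
        using Asets[OF v] Afin[OF v] by simp
    qed
    also have "\<dots> = (\<Sum>k\<in>J. m k * g (e k))" by (rule sumV[symmetric])
    finally show ?thesis by simp
  qed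
  have arr: "stable_array Q \<alpha> J Z m T a s"
  proof (unfold_locales)
    have "Q.indep_vars (\<lambda>_. borel) (\<lambda>i. N (B i)) UNIV"
      using N Bdisj Bsets unfolding SaS_random_measure_def by blast
    then show "Q.indep_vars (\<lambda>_. borel) Z J"
      unfolding Z_def by (rule Q.indep_vars_subset) simp
    fix j
    have "N (B j) \<in> borel_measurable Q" and char: "\<And>\<theta>. char (distr Q borel (N (B j))) \<theta> = of_real (exp (- (\<bar>\<theta>\<bar> powr \<alpha> * measure \<mu> (B j))))"
      using N Bsets[of j] unfolding SaS_random_measure_def by blast+
    then show "stable_law \<alpha> (m j) (distr Q borel (Z j))"
      unfolding stable_law_def Z_def m_def by (auto intro!: Q.real_distribution_distr)
  next
    fix t assume t: "t \<in> T"
    have "(\<Sum>k\<in>J. m k * \<bar>e k t\<bar> powr \<alpha>) = (\<integral>x. \<bar>joint_values T G x t\<bar> powr \<alpha> \<partial>\<mu>)"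
      by (rule int) (use t in \<open>simp add: zero_def\<close>)
    then show "(\<Sum>j\<in>J. m j * \<bar>a t j\<bar> powr \<alpha>) \<le> s"
      using s[OF t] t by (simp add: a_def joint_values_def)
  qed (use alpha T in \<open>auto simp: J_def m_def\<close>)
  interpret stable_array Q \<alpha> J Z m T a s by (rule arr)
  have powr_Max: "(Max (f ` T)) powr \<alpha> = Max ((\<lambda>t. f t powr \<alpha>) ` T)" if "\<And>t. f t \<ge> 0" for f :: "'t \<Rightarrow> real"
  proof -
    have "Max (f ` T) \<in> f ` T" using T by (intro Max_in) auto
    then obtain t where t: "t \<in> T" "Max (f ` T) = f t" by auto
    show ?thesis unfolding t(2)
    proof (rule Max_eqI[symmetric])
      fix y assume "y \<in> (\<lambda>t. f t powr \<alpha>) ` T"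
      then obtain u where u: "u \<in> T" "y = f u powr \<alpha>" by auto
      have "f u \<le> f t" unfolding t(2)[symmetric] using T u by (intro Max_ge) auto
      then show "y \<le> f t powr \<alpha>" using u that alpha by (auto intro!: powr_mono2)
    qed (use T t in auto)
  qed
  have tot: "total_scale = (\<integral>x. Max ((\<lambda>t. \<bar>G t x\<bar> powr \<alpha>) ` T) \<partial>\<mu>)"
  proof -
    have "total_scale = (\<Sum>k\<in>J. m k * (Max ((\<lambda>t. \<bar>e k t\<bar>) ` T)) powr \<alpha>)"
      by (simp add: total_scale_def weight_def a_def)
    also have "\<dots> = (\<integral>x. (Max ((\<lambda>t. \<bar>joint_values T G x t\<bar>) ` T)) powr \<alpha> \<partial>\<mu>)"
    proof (rule int)
      have "(\<lambda>t. \<bar>zero t\<bar>) ` T = {0}" using T by (auto simp: zero_def)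
      then show "(Max ((\<lambda>t. \<bar>zero t\<bar>) ` T)) powr \<alpha> = 0" by simp
    qed
    also have "\<dots> = (\<integral>x. Max ((\<lambda>t. \<bar>G t x\<bar> powr \<alpha>) ` T) \<partial>\<mu>)"
    proof (intro Bochner_Integration.integral_cong refl)
      fix x
      have "(\<lambda>t. \<bar>joint_values T G x t\<bar>) ` T = (\<lambda>t. \<bar>G t x\<bar>) ` T" by (auto simp: joint_values_def)
      then show "(Max ((\<lambda>t. \<bar>joint_values T G x t\<bar>) ` T)) powr \<alpha> = Max ((\<lambda>t. \<bar>G t x\<bar> powr \<alpha>) ` T)"
        by (simp add: powr_Max)
    qed
    finally show ?thesis .
  qed
  have ss: "AE \<omega> in Q. simple_stable_integral \<mu> N (G t) \<omega> = (\<Sum>j\<in>J. a t j * Z j \<omega>)" if t: "t \<in> T" for t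
  proof -
    let ?S = "G t ` space \<mu>"
    have finS: "finite ?S" using G(1)[OF t] by (simp add: simple_function_def)
    have "AE \<omega> in Q. \<forall>y\<in>?S - {0}. N (\<Union>v\<in>{v\<in>V. v t = y}. A v) \<omega> = (\<Sum>v\<in>{v\<in>V. v t = y}. N (A v) \<omega>)"
    proof (rule AE_finite_allI)
      show "finite (?S - {0})" using finS by simp
      show "AE \<omega> in Q. N (\<Union>v\<in>{v\<in>V. v t = y}. A v) \<omega> = (\<Sum>v\<in>{v\<in>V. v t = y}. N (A v) \<omega>)" for y
        by (rule SaS_random_measure_additive[OF N]) (use finV Asets Afin Adisj in auto)
    qed
    then show ?thesis
    proof (rule eventually_mono)
      fix \<omega> assume H: "\<forall>y\<in>?S - {0}. N (\<Union>v\<in>{v\<in>V. v t = y}. A v) \<omega> = (\<Sum>v\<in>{v\<in>V. v t = y}. N (A v) \<omega>)"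
      have lev: "{x \<in> space \<mu>. G t x = y} = (\<Union>v\<in>{v\<in>V. v t = y}. A v)" if "y \<noteq> 0" for y
      proof -
        have jt: "joint_values T G x t = G t x" for x using t by (simp add: joint_values_def)
        show ?thesis
        proof (intro set_eqI iffI)
          fix x assume x: "x \<in> {x \<in> space \<mu>. G t x = y}"
          have "joint_values T G x \<noteq> zero"
          proof
            assume "joint_values T G x = zero"
            then have "G t x = zero t" using jt[of x] by simp
            then show False using t x that by (simp add: zero_def)
          qed
          then have "joint_values T G x \<in> V" using x by (simp add: V_def)
          then show "x \<in> (\<Union>v\<in>{v\<in>V. v t = y}. A v)"
            using x jt[of x] by (auto simp: A_def joint_level_def)
        next
          fix x assume "x \<in> (\<Union>v\<in>{v\<in>V. v t = y}. A v)"
          then obtain v where "v t = y" "x \<in> space \<mu>" "joint_values T G x = v"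
            by (auto simp: A_def joint_level_def)
          then show "x \<in> {x \<in> space \<mu>. G t x = y}" using jt[of x] by simp
        qed
      qed
      have "simple_stable_integral \<mu> N (G t) \<omega> = (\<Sum>y\<in>?S. y * N {x \<in> space \<mu>. G t x = y} \<omega>)"
        by (simp add: simple_stable_integral_def)
      also have "\<dots> = (\<Sum>y\<in>?S. \<Sum>v\<in>{v\<in>V. v t = y}. v t * N (A v) \<omega>)"
      proof (intro sum.cong refl)
        fix y assume y: "y \<in> ?S"
        show "y * N {x \<in> space \<mu>. G t x = y} \<omega> = (\<Sum>v\<in>{v\<in>V. v t = y}. v t * N (A v) \<omega>)"
        proof (cases "y = 0")
          case False
          then have "y * N {x \<in> space \<mu>. G t x = y} \<omega> = y * (\<Sum>v\<in>{v\<in>V. v t = y}. N (A v) \<omega>)"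
            using H y lev[OF False] by simp
          also have "\<dots> = (\<Sum>v\<in>{v\<in>V. v t = y}. v t * N (A v) \<omega>)"
            by (simp add: sum_distrib_left)
          finally show ?thesis .
        qed simp
      qed
      also have "\<dots> = (\<Sum>v\<in>V. v t * N (A v) \<omega>)"
        by (rule sum.group[OF finV finS]) (use t in \<open>auto simp: V_def joint_values_def\<close>)
      also have "\<dots> = (\<Sum>k\<in>{0..<card V}. e k t * N (A (e k)) \<omega>)"
        by (rule sum.reindex_bij_betw[OF e, symmetric])
      also have "\<dots> = (\<Sum>j\<in>J. a t j * Z j \<omega>)"
        by (intro sum.cong) (auto simp: J_def a_def Z_def B_def)
      finally show "simple_stable_integral \<mu> N (G t) \<omega> = (\<Sum>j\<in>J. a t j * Z j \<omega>)" .
    qed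
  qed
  show ?thesis by (rule that[OF arr tot ss])
qed

section \<open>Approximation of stable integrals\<close>

lemma integrable_Max:
  fixes f :: "'t \<Rightarrow> 's \<Rightarrow> real"
  assumes "finite T" "T \<noteq> {}" "\<And>t. t \<in> T \<Longrightarrow> integrable M (f t)"
  shows "integrable M (\<lambda>x. Max ((\<lambda>t. f t x) ` T))"
  using assms
proof (induction T rule: finite_ne_induct)
  case (insert t T)
  then have "integrable M (\<lambda>x. max (f t x) (Max ((\<lambda>t. f t x) ` T)))"
    by (intro integrable_max) auto
  also have "(\<lambda>x. max (f t x) (Max ((\<lambda>t. f t x) ` T))) = (\<lambda>x. Max ((\<lambda>t. f t x) ` insert t T))"
    using insert by (auto simp: fun_eq_iff)
  finally show ?case .
qed simp

text \<open>
  The level set of the value \<open>0\<close> may have infinite measure, but its term is \<open>0\<close>.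
\<close>

lemma simple_stable_integral_measurable:
  assumes N: "SaS_random_measure \<alpha> Q \<mu> N" and G: "simple_function \<mu> G" "emeasure \<mu> {x \<in> space \<mu>. G x \<noteq> 0} < \<infinity>"
  shows "simple_stable_integral \<mu> N G \<in> borel_measurable Q"
proof -
  have [measurable]: "G \<in> borel_measurable \<mu>" by (rule borel_measurable_simple_function[OF G(1)])
  have "(\<lambda>\<omega>. y * N {x \<in> space \<mu>. G x = y} \<omega>) \<in> borel_measurable Q" for y
  proof (cases "y = 0")
    case False
    have "emeasure \<mu> {x \<in> space \<mu>. G x = y} \<le> emeasure \<mu> {x \<in> space \<mu>. G x \<noteq> 0}"
      using False by (intro emeasure_mono) auto
    then have "emeasure \<mu> {x \<in> space \<mu>. G x = y} < \<infinity>" using G(2) by (rule le_less_trans)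
    moreover have "{x \<in> space \<mu>. G x = y} \<in> sets \<mu>" by measurable
    ultimately have "N {x \<in> space \<mu>. G x = y} \<in> borel_measurable Q"
      using N unfolding SaS_random_measure_def by blast
    then show ?thesis by measurable
  qed simp
  then show ?thesis unfolding simple_stable_integral_def[abs_def] by (intro borel_measurable_sum)
qed

text \<open>
  The maximum of finitely many functions \<open>|G\<^sub>t|\<^sup>\<alpha>\<close> differs from that of the \<open>|F\<^sub>t|\<^sup>\<alpha>\<close> by at most the sum of the
  differences, so it suffices to approximate each kernel separately.
\<close>

lemma stable_integrals_approx:
  fixes N :: "'s set \<Rightarrow> 'b \<Rightarrow> real" and T :: "'t set"
  assumes alpha: "0 < \<alpha>" "\<alpha> < 2" and N: "SaS_random_measure \<alpha> Q \<mu> N"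
    and T: "finite T" "T \<noteq> {}"
    and X: "\<And>t. t \<in> T \<Longrightarrow> is_stable_integral \<alpha> Q \<mu> N (F t) (X t)"
    and s: "\<And>t. t \<in> T \<Longrightarrow> (\<integral>x. \<bar>F t x\<bar> powr \<alpha> \<partial>\<mu>) \<le> s"
    and \<eta>: "\<eta> > 0"
  obtains J :: "nat set" and Z m a where
    "stable_array Q \<alpha> J Z m T a (s + \<eta>)"
    "\<bar>stable_array.total_scale \<alpha> J m T a - (\<integral>x. Max ((\<lambda>t. \<bar>F t x\<bar> powr \<alpha>) ` T) \<partial>\<mu>)\<bar> \<le> \<eta>"
    "\<And>t. t \<in> T \<Longrightarrow> measure Q {\<omega> \<in> space Q. \<bar>(\<Sum>j\<in>J. a t j * Z j \<omega>) - X t \<omega>\<bar> > \<eta>} \<le> \<eta>"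
proof -
  interpret Q: prob_space Q using N by (simp add: SaS_random_measure_def)
  have "\<forall>t\<in>T. \<exists>G :: nat \<Rightarrow> 's \<Rightarrow> real.
        (\<forall>k. simple_function \<mu> (G k) \<and> emeasure \<mu> {x \<in> space \<mu>. G k x \<noteq> 0} < \<infinity>) \<and>
        (\<lambda>k. \<integral>\<^sup>+ x. ennreal (\<bar>G k x - F t x\<bar> powr \<alpha>) \<partial>\<mu>) \<longlonglongrightarrow> 0 \<and>
        (\<forall>\<epsilon>>0. (\<lambda>k. measure Q {\<omega> \<in> space Q. \<bar>simple_stable_integral \<mu> N (G k) \<omega> - X t \<omega>\<bar> > \<epsilon>}) \<longlonglongrightarrow> 0)"
    using X unfolding is_stable_integral_def by blast
  then obtain G where G: "\<And>t k. t \<in> T \<Longrightarrow> simple_function \<mu> (G t k)"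
     "\<And>t k. t \<in> T \<Longrightarrow> emeasure \<mu> {x \<in> space \<mu>. G t k x \<noteq> 0} < \<infinity>"
     "\<And>t. t \<in> T \<Longrightarrow> (\<lambda>k. \<integral>\<^sup>+ x. ennreal (\<bar>G t k x - F t x\<bar> powr \<alpha>) \<partial>\<mu>) \<longlonglongrightarrow> 0"
     "\<And>t \<epsilon>. t \<in> T \<Longrightarrow> \<epsilon> > 0 \<Longrightarrow> (\<lambda>k. measure Q {\<omega> \<in> space Q. \<bar>simple_stable_integral \<mu> N (G t k) \<omega> - X t \<omega>\<bar> > \<epsilon>}) \<longlonglongrightarrow> 0"
    unfolding bchoice_iff by blast
  have Fm[measurable]: "F t \<in> borel_measurable \<mu>" and Fi: "integrable \<mu> (\<lambda>x. \<bar>F t x\<bar> powr \<alpha>)"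
    and Xm[measurable]: "X t \<in> borel_measurable Q" if "t \<in> T" for t
    using X[OF that] by (auto simp: is_stable_integral_def in_Lp_def)
  define M where "M = real (card T)"
  have M: "M \<ge> 1" using T by (simp add: M_def Suc_leI card_gt_0_iff)
  have s0: "s \<ge> 0"
  proof -
    obtain t where "t \<in> T" using T by auto
    have "0 \<le> (\<integral>x. \<bar>F t x\<bar> powr \<alpha> \<partial>\<mu>)" by simp
    with s[OF \<open>t \<in> T\<close>] show ?thesis by linarith
  qed
  \<comment> \<open>The relative error \<open>e\<close> and the \<open>L\<^sup>\<alpha>\<close>-distance \<open>\<delta>\<close> below each account for half of the allowed error \<open>\<eta>/M\<close> per kernel.\<close>
  define e where "e = \<eta> / (2 * M * (s + 1))"
  have e: "e > 0" using \<eta> M s0 by (simp add: e_def)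
  obtain C where C: "C > 0" "\<And>x y :: real. x \<ge> 0 \<Longrightarrow> y \<ge> 0 \<Longrightarrow> \<bar>x powr \<alpha> - y powr \<alpha>\<bar> \<le> e * y powr \<alpha> + C * \<bar>x - y\<bar> powr \<alpha>"
    using powr_perturbation[OF alpha(1) e] by blast
  define \<delta> where "\<delta> = \<eta> / (2 * M * C)"
  have \<delta>: "\<delta> > 0" using \<eta> M C by (simp add: \<delta>_def)
  have "\<forall>\<^sub>F k in sequentially. \<forall>t\<in>T. (\<integral>\<^sup>+ x. ennreal (\<bar>G t k x - F t x\<bar> powr \<alpha>) \<partial>\<mu>) < ennreal \<delta> \<and>
      measure Q {\<omega> \<in> space Q. \<bar>simple_stable_integral \<mu> N (G t k) \<omega> - X t \<omega>\<bar> > \<eta>} < \<eta>"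
    using T(1) \<delta> \<eta> by (intro eventually_ball_finite ballI eventually_conj order_tendstoD(2)[OF G(3)] order_tendstoD(2)[OF G(4)]) auto
  from eventually_happens'[OF sequentially_bot this]
  obtain k where k: "\<And>t. t \<in> T \<Longrightarrow> (\<integral>\<^sup>+ x. ennreal (\<bar>G t k x - F t x\<bar> powr \<alpha>) \<partial>\<mu>) < ennreal \<delta>"
      "\<And>t. t \<in> T \<Longrightarrow> measure Q {\<omega> \<in> space Q. \<bar>simple_stable_integral \<mu> N (G t k) \<omega> - X t \<omega>\<bar> > \<eta>} < \<eta>"
    by blast
  define H where "H t = G t k" for t
  have Hm[measurable]: "H t \<in> borel_measurable \<mu>" if "t \<in> T" for t
    unfolding H_def by (rule borel_measurable_simple_function[OF G(1)[OF that]])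
  have Di: "integrable \<mu> (\<lambda>x. \<bar>H t x - F t x\<bar> powr \<alpha>)" and Dd: "(\<integral>x. \<bar>H t x - F t x\<bar> powr \<alpha> \<partial>\<mu>) \<le> \<delta>" if t: "t \<in> T" for t
  proof -
    have lt: "(\<integral>\<^sup>+ x. ennreal (\<bar>H t x - F t x\<bar> powr \<alpha>) \<partial>\<mu>) < ennreal \<delta>" using k(1)[OF t] by (simp add: H_def)
    show i: "integrable \<mu> (\<lambda>x. \<bar>H t x - F t x\<bar> powr \<alpha>)"
      using t lt by (intro integrableI_nonneg) (auto intro: less_trans)
    show "(\<integral>x. \<bar>H t x - F t x\<bar> powr \<alpha> \<partial>\<mu>) \<le> \<delta>"
      using lt \<delta> nn_integral_eq_integral[OF i] by (simp add: ennreal_less_iff)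
  qed
  have pw: "\<bar>\<bar>H t x\<bar> powr \<alpha> - \<bar>F t x\<bar> powr \<alpha>\<bar> \<le> e * \<bar>F t x\<bar> powr \<alpha> + C * \<bar>H t x - F t x\<bar> powr \<alpha>" for t x
  proof -
    have "\<bar>\<bar>H t x\<bar> - \<bar>F t x\<bar>\<bar> powr \<alpha> \<le> \<bar>H t x - F t x\<bar> powr \<alpha>"
      using alpha by (intro powr_mono2) auto
    then have "C * \<bar>\<bar>H t x\<bar> - \<bar>F t x\<bar>\<bar> powr \<alpha> \<le> C * \<bar>H t x - F t x\<bar> powr \<alpha>"
      using C by (intro mult_left_mono) auto
    then show ?thesis using C(2)[of "\<bar>H t x\<bar>" "\<bar>F t x\<bar>"] by simp
  qed
  have DDi: "integrable \<mu> (\<lambda>x. \<bar>\<bar>H t x\<bar> powr \<alpha> - \<bar>F t x\<bar> powr \<alpha>\<bar>)"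
    and DDd: "(\<integral>x. \<bar>\<bar>H t x\<bar> powr \<alpha> - \<bar>F t x\<bar> powr \<alpha>\<bar> \<partial>\<mu>) \<le> \<eta> / M" if t: "t \<in> T" for t
  proof -
    have r: "integrable \<mu> (\<lambda>x. e * \<bar>F t x\<bar> powr \<alpha> + C * \<bar>H t x - F t x\<bar> powr \<alpha>)"
      using Fi[OF t] Di[OF t] by auto
    show i: "integrable \<mu> (\<lambda>x. \<bar>\<bar>H t x\<bar> powr \<alpha> - \<bar>F t x\<bar> powr \<alpha>\<bar>)"
      by (rule Bochner_Integration.integrable_bound[OF r]) (use pw t C e in \<open>auto intro!: AE_I2 order_trans[OF pw]\<close>)
    have "(\<integral>x. \<bar>\<bar>H t x\<bar> powr \<alpha> - \<bar>F t x\<bar> powr \<alpha>\<bar> \<partial>\<mu>) \<le> (\<integral>x. e * \<bar>F t x\<bar> powr \<alpha> + C * \<bar>H t x - F t x\<bar> powr \<alpha> \<partial>\<mu>)"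
      by (rule integral_mono[OF i r pw])
    also have "\<dots> = e * (\<integral>x. \<bar>F t x\<bar> powr \<alpha> \<partial>\<mu>) + C * (\<integral>x. \<bar>H t x - F t x\<bar> powr \<alpha> \<partial>\<mu>)"
      using Fi[OF t] Di[OF t] by simp
    also have "\<dots> \<le> e * (s + 1) + C * \<delta>"
      using s[OF t] Dd[OF t] e C by (intro add_mono mult_left_mono) auto
    also have "e * (s + 1) = \<eta> / (2 * M)" using s0 by (simp add: e_def)
    also have "C * \<delta> = \<eta> / (2 * M)" using C by (simp add: \<delta>_def)
    also have "\<eta> / (2 * M) + \<eta> / (2 * M) = \<eta> / M" by simp
    finally show "(\<integral>x. \<bar>\<bar>H t x\<bar> powr \<alpha> - \<bar>F t x\<bar> powr \<alpha>\<bar> \<partial>\<mu>) \<le> \<eta> / M" .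
  qed
  have Hi: "integrable \<mu> (\<lambda>x. \<bar>H t x\<bar> powr \<alpha>)" if t: "t \<in> T" for t
  proof (rule Bochner_Integration.integrable_bound[OF Bochner_Integration.integrable_add[OF Fi[OF t] DDi[OF t]]])
    show "AE x in \<mu>. norm (\<bar>H t x\<bar> powr \<alpha>) \<le> norm (\<bar>F t x\<bar> powr \<alpha> + \<bar>\<bar>H t x\<bar> powr \<alpha> - \<bar>F t x\<bar> powr \<alpha>\<bar>)"
    proof (intro AE_I2)
      fix x
      have "\<bar>H t x\<bar> powr \<alpha> \<le> \<bar>F t x\<bar> powr \<alpha> + \<bar>\<bar>H t x\<bar> powr \<alpha> - \<bar>F t x\<bar> powr \<alpha>\<bar>" by linarith
      also have "\<dots> \<le> norm (\<bar>F t x\<bar> powr \<alpha> + \<bar>\<bar>H t x\<bar> powr \<alpha> - \<bar>F t x\<bar> powr \<alpha>\<bar>)" by simp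
      finally show "norm (\<bar>H t x\<bar> powr \<alpha>) \<le> norm (\<bar>F t x\<bar> powr \<alpha> + \<bar>\<bar>H t x\<bar> powr \<alpha> - \<bar>F t x\<bar> powr \<alpha>\<bar>)"
        by simp
    qed
  qed (use t in measurable)
  have Hs: "(\<integral>x. \<bar>H t x\<bar> powr \<alpha> \<partial>\<mu>) \<le> s + \<eta>" if t: "t \<in> T" for t
  proof -
    have "(\<integral>x. \<bar>H t x\<bar> powr \<alpha> \<partial>\<mu>) \<le> (\<integral>x. \<bar>F t x\<bar> powr \<alpha> + \<bar>\<bar>H t x\<bar> powr \<alpha> - \<bar>F t x\<bar> powr \<alpha>\<bar> \<partial>\<mu>)"
      by (rule integral_mono[OF Hi[OF t] Bochner_Integration.integrable_add[OF Fi[OF t] DDi[OF t]]]) linarith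
    also have "\<dots> \<le> s + \<eta> / M" using s[OF t] DDd[OF t] Fi[OF t] DDi[OF t] by simp
    also have "\<eta> / M \<le> \<eta>" using M \<eta> by (simp add: divide_le_eq mult_le_cancel_left1)
    finally show ?thesis by simp
  qed
  have Bd: "\<bar>(\<integral>x. Max ((\<lambda>t. \<bar>H t x\<bar> powr \<alpha>) ` T) \<partial>\<mu>) - (\<integral>x. Max ((\<lambda>t. \<bar>F t x\<bar> powr \<alpha>) ` T) \<partial>\<mu>)\<bar> \<le> \<eta>"
  proof -
    note iH = integrable_Max[OF T Hi] and iF = integrable_Max[OF T Fi]
    have "\<bar>(\<integral>x. Max ((\<lambda>t. \<bar>H t x\<bar> powr \<alpha>) ` T) \<partial>\<mu>) - (\<integral>x. Max ((\<lambda>t. \<bar>F t x\<bar> powr \<alpha>) ` T) \<partial>\<mu>)\<bar>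
      = \<bar>\<integral>x. Max ((\<lambda>t. \<bar>H t x\<bar> powr \<alpha>) ` T) - Max ((\<lambda>t. \<bar>F t x\<bar> powr \<alpha>) ` T) \<partial>\<mu>\<bar>"
      using iH iF by simp
    also have "\<dots> \<le> (\<integral>x. \<bar>Max ((\<lambda>t. \<bar>H t x\<bar> powr \<alpha>) ` T) - Max ((\<lambda>t. \<bar>F t x\<bar> powr \<alpha>) ` T)\<bar> \<partial>\<mu>)"
      by (rule integral_abs_bound)
    also have "\<dots> \<le> (\<integral>x. (\<Sum>t\<in>T. \<bar>\<bar>H t x\<bar> powr \<alpha> - \<bar>F t x\<bar> powr \<alpha>\<bar>) \<partial>\<mu>)"
      using iH iF DDi by (intro integral_mono Max_abs_diff_le_sum[OF T]) auto
    also have "\<dots> = (\<Sum>t\<in>T. \<integral>x. \<bar>\<bar>H t x\<bar> powr \<alpha> - \<bar>F t x\<bar> powr \<alpha>\<bar> \<partial>\<mu>)"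
      using DDi by (intro Bochner_Integration.integral_sum)
    also have "\<dots> \<le> (\<Sum>t\<in>T. \<eta> / M)" by (intro sum_mono DDd)
    also have "\<dots> = \<eta>" using M by (simp add: M_def)
    finally show ?thesis .
  qed
  have H: "\<And>t. t \<in> T \<Longrightarrow> simple_function \<mu> (H t)" "\<And>t. t \<in> T \<Longrightarrow> emeasure \<mu> {x \<in> space \<mu>. H t x \<noteq> 0} < \<infinity>"
    using G(1,2) by (auto simp: H_def)
  obtain J :: "nat set" and Z m a where arr: "stable_array Q \<alpha> J Z m T a (s + \<eta>)"
    "stable_array.total_scale \<alpha> J m T a = (\<integral>x. Max ((\<lambda>t. \<bar>H t x\<bar> powr \<alpha>) ` T) \<partial>\<mu>)"
    "\<And>t. t \<in> T \<Longrightarrow> AE \<omega> in Q. simple_stable_integral \<mu> N (H t) \<omega> = (\<Sum>j\<in>J. a t j * Z j \<omega>)"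
    by (rule simple_integrals_as_array[OF alpha N T, where G=H and s="s + \<eta>"]) (blast intro: H Hs)+
  have "measure Q {\<omega> \<in> space Q. \<bar>(\<Sum>j\<in>J. a t j * Z j \<omega>) - X t \<omega>\<bar> > \<eta>} \<le> \<eta>" if t: "t \<in> T" for t
  proof -
    have [measurable]: "simple_stable_integral \<mu> N (H t) \<in> borel_measurable Q"
      by (rule simple_stable_integral_measurable[OF N H[OF t]])
    have "measure Q {\<omega> \<in> space Q. \<bar>(\<Sum>j\<in>J. a t j * Z j \<omega>) - X t \<omega>\<bar> > \<eta>}
      \<le> measure Q {\<omega> \<in> space Q. \<bar>simple_stable_integral \<mu> N (H t) \<omega> - X t \<omega>\<bar> > \<eta>}"
    proof (rule Q.finite_measure_mono_AE)
      show "AE \<omega> in Q. \<omega> \<in> {\<omega> \<in> space Q. \<bar>(\<Sum>j\<in>J. a t j * Z j \<omega>) - X t \<omega>\<bar> > \<eta>}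
         \<longrightarrow> \<omega> \<in> {\<omega> \<in> space Q. \<bar>simple_stable_integral \<mu> N (H t) \<omega> - X t \<omega>\<bar> > \<eta>}"
        using arr(3)[OF t] by eventually_elim simp
    qed (use t in measurable)
    also have "\<dots> \<le> \<eta>" using k(2)[OF t] by (simp add: H_def)
    finally show ?thesis .
  qed
  then show ?thesis using that[OF arr(1)] arr(2) Bd by simp
qed

section \<open>Limit law of the maximum\<close>

text \<open>
  Half of the margin \<open>2\<delta>L\<close> is spent on
  passing from sums to single terms and half on the approximation error. That error is taken to be
  \<open>\<eta> = V\<^sup>-\<^sup>2\<close>, so that its contribution \<open>V\<eta>\<close> after summation over \<open>T\<close> still vanishes.
\<close>

lemma prob_large_stable_integral_bounds:
  fixes N :: "'s set \<Rightarrow> 'b \<Rightarrow> real" and T :: "'t set"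
  assumes alpha: "0 < \<alpha>" "\<alpha> < 2" and N: "SaS_random_measure \<alpha> Q \<mu> N"
    and T: "finite T" "T \<noteq> {}"
    and X: "\<And>t. t \<in> T \<Longrightarrow> is_stable_integral \<alpha> Q \<mu> N (F t) (X t)"
    and s: "\<And>t. t \<in> T \<Longrightarrow> (\<integral>x. \<bar>F t x\<bar> powr \<alpha> \<partial>\<mu>) \<le> s"
    and K: "stable_tail_bound \<alpha> K"
    and \<epsilon>: "\<epsilon> \<ge> 0" and R0: "stable_tail_asymptotics \<alpha> \<epsilon> R0"
    and V: "V = real (card T)" and L: "L = V powr (1 / \<alpha>)" and \<eta>: "\<eta> = 1 / V\<^sup>2"
    and x: "0 < \<kappa>" "\<kappa> \<le> x - \<delta>" "0 < \<delta>" "2 * \<delta> < x" "\<eta> \<le> \<delta> * L" "R0 * (s + \<eta>) \<le> (x - 2 * \<delta>) powr \<alpha> * V"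
    and B: "B = (\<integral>x. Max ((\<lambda>t. \<bar>F t x\<bar> powr \<alpha>) ` T) \<partial>\<mu>)"
  defines "err \<equiv> \<lambda>c. \<epsilon> * ((B + \<eta>) / V) * c powr (- \<alpha>) + (stable_const \<alpha>)\<^sup>2 * (s + \<eta>) * ((B + \<eta>) / V) * (c powr (- \<alpha>))\<^sup>2 * (1 / V)
       + (K * (s + \<eta>) * \<kappa> powr (- \<alpha>))\<^sup>2 * (1 / V) + 4 * (s + \<eta>) * \<kappa> powr (2 - \<alpha>) / \<delta>\<^sup>2 + 1 / V"
  shows "measure Q {\<omega> \<in> space Q. \<exists>t\<in>T. x * L < \<bar>X t \<omega>\<bar>}
      \<le> 1 - exp (- (stable_const \<alpha> * ((B + \<eta>) / V) * (x - 2 * \<delta>) powr (- \<alpha>))) + err (x - 2 * \<delta>)" (is ?upper)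
    and "1 - exp (- (stable_const \<alpha> * ((B - \<eta>) / V) * (x + 2 * \<delta>) powr (- \<alpha>))) - err (x + 2 * \<delta>)
      \<le> measure Q {\<omega> \<in> space Q. \<exists>t\<in>T. x * L < \<bar>X t \<omega>\<bar>}" (is ?lower)
proof -
  have V1: "V \<ge> 1" using T by (simp add: V Suc_leI card_gt_0_iff)
  have Vp: "V > 0" using V1 by simp
  have Lp: "L > 0" using Vp by (simp add: L)
  have La: "L powr \<alpha> = V" using Vp alpha by (simp add: L powr_powr)
  have \<eta>p: "\<eta> > 0" using Vp by (simp add: \<eta>)
  have C: "stable_const \<alpha> > 0" by (rule stable_const_pos[OF alpha])
  have Xm[measurable]: "X t \<in> borel_measurable Q" if "t \<in> T" for t
    using X[OF that] by (auto simp: is_stable_integral_def)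
  obtain J :: "nat set" and Z m a where arr: "stable_array Q \<alpha> J Z m T a (s + \<eta>)"
    and tot: "\<bar>stable_array.total_scale \<alpha> J m T a - B\<bar> \<le> \<eta>"
    and near: "\<And>t. t \<in> T \<Longrightarrow> measure Q {\<omega> \<in> space Q. \<bar>(\<Sum>j\<in>J. a t j * Z j \<omega>) - X t \<omega>\<bar> > \<eta>} \<le> \<eta>"
    unfolding B by (rule stable_integrals_approx[OF alpha N T, where F=F and X=X and s=s and \<eta>=\<eta>]) (blast intro: X s \<eta>p)+
  interpret stable_array Q \<alpha> J Z m T a "s + \<eta>" by (rule arr)
  define S where "S t \<omega> = (\<Sum>j\<in>J. a t j * Z j \<omega>)" for t \<omega>
  have Sm[measurable]: "S t \<in> borel_measurable Q" for t
    unfolding S_def[abs_def] by (intro borel_measurable_sum) measurable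
  define far where "far = {\<omega> \<in> space Q. \<exists>t\<in>T. \<eta> < \<bar>S t \<omega> - X t \<omega>\<bar>}"
  have far_UN: "far = (\<Union>t\<in>T. {\<omega> \<in> space Q. \<eta> < \<bar>S t \<omega> - X t \<omega>\<bar>})"
    unfolding far_def by blast
  have far[measurable]: "far \<in> sets Q"
    unfolding far_UN using T by (intro sets.finite_UN) auto
  have "prob far \<le> (\<Sum>t\<in>T. prob {\<omega> \<in> space Q. \<eta> < \<bar>S t \<omega> - X t \<omega>\<bar>})"
    unfolding far_UN using T by (intro finite_measure_subadditive_finite) auto
  also have "\<dots> \<le> (\<Sum>t\<in>T. \<eta>)" by (intro sum_mono) (simp add: S_def near)
  also have "\<dots> = 1 / V" using Vp by (simp add: V[symmetric] \<eta> power2_eq_square)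
  finally have pfar: "prob far \<le> 1 / V" .
  have EX_sets: "{\<omega> \<in> space Q. \<exists>t\<in>T. y < \<bar>W t \<omega>\<bar>} \<in> sets Q" if "\<And>t. t \<in> T \<Longrightarrow> W t \<in> borel_measurable Q" for W :: "'t \<Rightarrow> 'b \<Rightarrow> real" and y
  proof -
    have "{\<omega> \<in> space Q. y < \<bar>W t \<omega>\<bar>} \<in> sets Q" if "t \<in> T" for t
      using \<open>\<And>t. t \<in> T \<Longrightarrow> W t \<in> borel_measurable Q\<close>[OF that] by measurable
    then show ?thesis using T by (intro sets.sets_Collect_finite_Ex) auto
  qed
  have pw: "(c * L) powr (- \<alpha>) = c powr (- \<alpha>) / V" if "c > 0" for c
    using that Lp La by (simp add: powr_mult powr_minus field_simps)
  \<comment> \<open>Here \<open>L\<^sup>\<alpha> = V\<close> cancels the number of points.\<close>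
  have bad_eq: "real (card T) * (K * (s + \<eta>) * (\<kappa> * L) powr (- \<alpha>))\<^sup>2 + real (card T) * (4 * (s + \<eta>) * (\<kappa> * L) powr (2 - \<alpha>) / (\<delta> * L)\<^sup>2)
     = (K * (s + \<eta>) * \<kappa> powr (- \<alpha>))\<^sup>2 * (1 / V) + 4 * (s + \<eta>) * \<kappa> powr (2 - \<alpha>) / \<delta>\<^sup>2"
  proof -
    have "real (card T) * (K * (s + \<eta>) * (\<kappa> * L) powr (- \<alpha>))\<^sup>2 = (K * (s + \<eta>) * \<kappa> powr (- \<alpha>))\<^sup>2 * (1 / V)"
      unfolding V[symmetric] pw[OF x(1)] using Vp by (simp add: power2_eq_square)
    moreover have "(\<kappa> * L) powr (2 - \<alpha>) = \<kappa> powr (2 - \<alpha>) * (L\<^sup>2 / V)"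
      using x Lp La by (simp add: powr_mult powr_diff)
    then have "real (card T) * (4 * (s + \<eta>) * (\<kappa> * L) powr (2 - \<alpha>) / (\<delta> * L)\<^sup>2) = 4 * (s + \<eta>) * \<kappa> powr (2 - \<alpha>) / \<delta>\<^sup>2"
      unfolding V[symmetric] using Vp Lp by (simp add: power_mult_distrib)
    ultimately show ?thesis by simp
  qed
  have thr: "R0 * (s + \<eta>) \<le> (c * L) powr \<alpha>" if "x - 2 * \<delta> \<le> c" for c
  proof -
    have "(x - 2 * \<delta>) powr \<alpha> * V \<le> c powr \<alpha> * V" using that x Vp alpha by (intro mult_right_mono powr_mono2) auto
    then show ?thesis using x(6) that x(3,4) Lp La by (simp add: powr_mult)
  qed
  have err_mono: "\<epsilon> * total_scale * (c powr (- \<alpha>) / V) + (stable_const \<alpha>)\<^sup>2 * (s + \<eta>) * total_scale * (c powr (- \<alpha>) / V)\<^sup>2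
      \<le> \<epsilon> * ((B + \<eta>) / V) * c powr (- \<alpha>) + (stable_const \<alpha>)\<^sup>2 * (s + \<eta>) * ((B + \<eta>) / V) * (c powr (- \<alpha>))\<^sup>2 * (1 / V)" for c
  proof -
    have t: "total_scale \<le> B + \<eta>" using tot by linarith
    have "\<epsilon> * total_scale * (c powr (- \<alpha>) / V) \<le> \<epsilon> * (B + \<eta>) * (c powr (- \<alpha>) / V)"
      using t \<epsilon> Vp by (intro mult_right_mono mult_left_mono) auto
    moreover have "(stable_const \<alpha>)\<^sup>2 * (s + \<eta>) * total_scale * (c powr (- \<alpha>) / V)\<^sup>2 \<le> (stable_const \<alpha>)\<^sup>2 * (s + \<eta>) * (B + \<eta>) * (c powr (- \<alpha>) / V)\<^sup>2"
      using t s_nonneg by (intro mult_right_mono mult_left_mono) auto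
    ultimately show ?thesis by (simp add: power2_eq_square)
  qed
  have x2: "0 < (x - \<delta>) * L" "0 < (x + \<delta>) * L" using x Lp by auto
  show ?upper
  proof -
    have "{\<omega> \<in> space Q. \<exists>t\<in>T. x * L < \<bar>X t \<omega>\<bar>} \<subseteq> {\<omega> \<in> space Q. \<exists>t\<in>T. (x - \<delta>) * L < \<bar>S t \<omega>\<bar>} \<union> far"
    proof
      fix \<omega> assume "\<omega> \<in> {\<omega> \<in> space Q. \<exists>t\<in>T. x * L < \<bar>X t \<omega>\<bar>}"
      then obtain t where t: "\<omega> \<in> space Q" "t \<in> T" "x * L < \<bar>X t \<omega>\<bar>" by blast
      show "\<omega> \<in> {\<omega> \<in> space Q. \<exists>t\<in>T. (x - \<delta>) * L < \<bar>S t \<omega>\<bar>} \<union> far"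
      proof (cases "\<omega> \<in> far")
        case False
        then have "\<bar>S t \<omega> - X t \<omega>\<bar> \<le> \<delta> * L" using t x(5) by (force simp: far_def)
        then have "(x - \<delta>) * L < \<bar>S t \<omega>\<bar>" using t(3) unfolding left_diff_distrib by linarith
        then show ?thesis using t by blast
      qed simp
    qed
    then have "prob {\<omega> \<in> space Q. \<exists>t\<in>T. x * L < \<bar>X t \<omega>\<bar>} \<le> prob {\<omega> \<in> space Q. \<exists>t\<in>T. (x - \<delta>) * L < \<bar>S t \<omega>\<bar>} + prob far"
      by (intro order_trans[OF finite_measure_mono measure_Un_le] sets.Un EX_sets Sm far) auto
    also have "prob {\<omega> \<in> space Q. \<exists>t\<in>T. (x - \<delta>) * L < \<bar>S t \<omega>\<bar>} \<le>
       (1 - exp (- (stable_const \<alpha> * total_scale * ((x - 2 * \<delta>) powr (- \<alpha>) / V))))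
       + (\<epsilon> * total_scale * ((x - 2 * \<delta>) powr (- \<alpha>) / V) + (stable_const \<alpha>)\<^sup>2 * (s + \<eta>) * total_scale * ((x - 2 * \<delta>) powr (- \<alpha>) / V)\<^sup>2)
       + ((K * (s + \<eta>) * \<kappa> powr (- \<alpha>))\<^sup>2 * (1 / V) + 4 * (s + \<eta>) * \<kappa> powr (2 - \<alpha>) / \<delta>\<^sup>2)"
    proof -
      have d: "(x - \<delta>) * L - \<delta> * L = (x - 2 * \<delta>) * L" by (simp add: algebra_simps)
      have "0 < x - 2 * \<delta>" using x by simp
      note pw' = pw[OF this]
      show ?thesis
        using prob_large_sum_bounds(1)[OF K \<epsilon> R0, of "\<kappa> * L" "(x - \<delta>) * L" "\<delta> * L"]
        unfolding d pw' bad_eq S_def using x Lp thr[of "x - 2 * \<delta>"] by simp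
    qed
    also have "stable_const \<alpha> * total_scale * ((x - 2 * \<delta>) powr (- \<alpha>) / V) \<le> stable_const \<alpha> * (B + \<eta>) * ((x - 2 * \<delta>) powr (- \<alpha>) / V)"
      using C tot Vp by (intro mult_right_mono mult_left_mono) auto
    finally show ?upper
      using err_mono[of "x - 2 * \<delta>"] pfar unfolding err_def by simp
  qed
  show ?lower
  proof -
    have "{\<omega> \<in> space Q. \<exists>t\<in>T. (x + \<delta>) * L < \<bar>S t \<omega>\<bar>} \<subseteq> {\<omega> \<in> space Q. \<exists>t\<in>T. x * L < \<bar>X t \<omega>\<bar>} \<union> far"
    proof
      fix \<omega> assume "\<omega> \<in> {\<omega> \<in> space Q. \<exists>t\<in>T. (x + \<delta>) * L < \<bar>S t \<omega>\<bar>}"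
      then obtain t where t: "\<omega> \<in> space Q" "t \<in> T" "(x + \<delta>) * L < \<bar>S t \<omega>\<bar>" by blast
      show "\<omega> \<in> {\<omega> \<in> space Q. \<exists>t\<in>T. x * L < \<bar>X t \<omega>\<bar>} \<union> far"
      proof (cases "\<omega> \<in> far")
        case False
        then have "\<bar>S t \<omega> - X t \<omega>\<bar> \<le> \<delta> * L" using t x(5) by (force simp: far_def)
        then have "x * L < \<bar>X t \<omega>\<bar>" using t(3) unfolding distrib_right by linarith
        then show ?thesis using t by blast
      qed simp
    qed
    then have P: "prob {\<omega> \<in> space Q. \<exists>t\<in>T. (x + \<delta>) * L < \<bar>S t \<omega>\<bar>} \<le> prob {\<omega> \<in> space Q. \<exists>t\<in>T. x * L < \<bar>X t \<omega>\<bar>} + prob far"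
      by (intro order_trans[OF finite_measure_mono measure_Un_le] sets.Un EX_sets Xm far) auto
    have "(1 - exp (- (stable_const \<alpha> * total_scale * ((x + 2 * \<delta>) powr (- \<alpha>) / V))))
       - (\<epsilon> * total_scale * ((x + 2 * \<delta>) powr (- \<alpha>) / V) + (stable_const \<alpha>)\<^sup>2 * (s + \<eta>) * total_scale * ((x + 2 * \<delta>) powr (- \<alpha>) / V)\<^sup>2)
       - ((K * (s + \<eta>) * \<kappa> powr (- \<alpha>))\<^sup>2 * (1 / V) + 4 * (s + \<eta>) * \<kappa> powr (2 - \<alpha>) / \<delta>\<^sup>2)
       \<le> prob {\<omega> \<in> space Q. \<exists>t\<in>T. (x + \<delta>) * L < \<bar>S t \<omega>\<bar>}"
    proof -
      have d: "(x + \<delta>) * L + \<delta> * L = (x + 2 * \<delta>) * L" "(x + \<delta>) * L - \<delta> * L = x * L" by (simp_all add: algebra_simps)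
      have "0 < x + 2 * \<delta>" using x by simp
      note pw' = pw[OF this]
      have "\<kappa> * L \<le> (x + \<delta>) * L" "\<delta> * L < (x + \<delta>) * L" using x Lp by (auto intro!: mult_right_mono)
      then show ?thesis
        using prob_large_sum_bounds(2)[OF K \<epsilon> R0, of "\<kappa> * L" "(x + \<delta>) * L" "\<delta> * L"]
        unfolding d pw' bad_eq S_def using x Lp thr[of x] by simp
    qed
    moreover have "stable_const \<alpha> * (B - \<eta>) * ((x + 2 * \<delta>) powr (- \<alpha>) / V) \<le> stable_const \<alpha> * total_scale * ((x + 2 * \<delta>) powr (- \<alpha>) / V)"
      using C tot Vp by (intro mult_right_mono mult_left_mono) auto
    then have "exp (- (stable_const \<alpha> * total_scale * ((x + 2 * \<delta>) powr (- \<alpha>) / V))) \<le> exp (- (stable_const \<alpha> * ((B - \<eta>) / V) * (x + 2 * \<delta>) powr (- \<alpha>)))"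
      by simp
    ultimately show ?lower
      using err_mono[of "x + 2 * \<delta>"] pfar P unfolding err_def by linarith
  qed
qed

text \<open>
  The parameters are eliminated in the order \<open>n \<rightarrow> \<infinity>\<close>, then \<open>\<kappa>\<close> and \<open>\<epsilon>\<close> to \<open>0\<close>, then \<open>\<delta> \<rightarrow> 0\<close>. In the proof
  \<open>\<kappa> = \<epsilon> = r\<close>.
\<close>

lemma max_stable_tail_limit:
  fixes N :: "'s set \<Rightarrow> 'b \<Rightarrow> real" and T :: "nat \<Rightarrow> 't set"
  assumes alpha: "0 < \<alpha>" "\<alpha> < 2" and N: "SaS_random_measure \<alpha> Q \<mu> N"
    and T: "\<And>n. finite (T n)"
    and X: "\<And>t. is_stable_integral \<alpha> Q \<mu> N (F t) (X t)"
    and s: "\<And>t. (\<integral>x. \<bar>F t x\<bar> powr \<alpha> \<partial>\<mu>) \<le> s"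
    and V: "filterlim (\<lambda>n. real (card (T n))) at_top sequentially"
    and B: "(\<lambda>n. (\<integral>x. Max ((\<lambda>t. \<bar>F t x\<bar> powr \<alpha>) ` T n) \<partial>\<mu>) / real (card (T n))) \<longlonglongrightarrow> b"
    and x: "x > 0"
  shows "(\<lambda>n. measure Q {\<omega> \<in> space Q. \<exists>t\<in>T n. x * real (card (T n)) powr (1 / \<alpha>) < \<bar>X t \<omega>\<bar>})
     \<longlonglongrightarrow> 1 - exp (- (stable_const \<alpha> * b * x powr (- \<alpha>)))"
proof (rule tendstoI)
  fix e :: real assume e: "e > 0"
  let ?C = "stable_const \<alpha>"
  define g where "g c = 1 - exp (- (?C * b * c powr (- \<alpha>)))" for c :: real
  define p where "p n = measure Q {\<omega> \<in> space Q. \<exists>t\<in>T n. x * real (card (T n)) powr (1 / \<alpha>) < \<bar>X t \<omega>\<bar>}" for n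
  obtain K where K: "stable_tail_bound \<alpha> K"
    using stable_law_tail_bound[OF alpha] by blast
  have gc: "isCont g x" unfolding g_def using x by (intro continuous_intros) auto
  have "\<forall>\<^sub>F d in at_right 0. \<bar>g (x - 2 * d) - g x\<bar> < e / 4 \<and> \<bar>g (x + 2 * d) - g x\<bar> < e / 4 \<and> 2 * d < x \<and> 0 < d"
  proof (intro eventually_conj)
    have *: "((\<lambda>d. g (x + r * d)) \<longlongrightarrow> g x) (at_right 0)" for r :: real
      by (rule isCont_tendsto_compose[OF gc]) (auto intro!: tendsto_eq_intros)
    show "\<forall>\<^sub>F d in at_right 0. \<bar>g (x - 2 * d) - g x\<bar> < e / 4"
      using tendstoD[OF *[of "-2"], of "e / 4"] e by (simp add: dist_real_def)
    show "\<forall>\<^sub>F d in at_right 0. \<bar>g (x + 2 * d) - g x\<bar> < e / 4"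
      using tendstoD[OF *[of 2], of "e / 4"] e by (simp add: dist_real_def)
    have "((\<lambda>d::real. 2 * d) \<longlongrightarrow> 0) (at_right 0)" by (auto intro!: tendsto_eq_intros)
    then show "\<forall>\<^sub>F d in at_right 0. 2 * d < x" using x by (rule order_tendstoD)
    show "\<forall>\<^sub>F d in at_right 0. (0::real) < d" by (rule eventually_at_right_less)
  qed
  from eventually_happens'[OF _ this] obtain \<delta> where \<delta>:
    "\<bar>g (x - 2 * \<delta>) - g x\<bar> < e / 4" "\<bar>g (x + 2 * \<delta>) - g x\<bar> < e / 4" "2 * \<delta> < x" "0 < \<delta>" by auto
  have "\<forall>\<^sub>F r in at_right 0. r * b * (x - 2 * \<delta>) powr (- \<alpha>) + 4 * s * r powr (2 - \<alpha>) / \<delta>\<^sup>2 < e / 4 \<and>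
      r * b * (x + 2 * \<delta>) powr (- \<alpha>) + 4 * s * r powr (2 - \<alpha>) / \<delta>\<^sup>2 < e / 4 \<and> r < x - \<delta> \<and> 0 < r"
  proof (intro eventually_conj)
    have pr: "((\<lambda>r::real. r powr (2 - \<alpha>)) \<longlongrightarrow> 0) (at_right 0)"
      using alpha by (intro tendsto_eq_intros tendsto_zero_powrI[where b="2 - \<alpha>"]) (auto simp: eventually_at_right_less intro: eventually_mono[OF eventually_at_right_less])
    have *: "((\<lambda>r. r * b * c + 4 * s * r powr (2 - \<alpha>) / \<delta>\<^sup>2) \<longlongrightarrow> 0 * b * c + 4 * s * 0 / \<delta>\<^sup>2) (at_right 0)" for c
      using \<delta>(4) by (intro tendsto_intros pr) auto
    show "\<forall>\<^sub>F r in at_right 0. r * b * (x - 2 * \<delta>) powr (- \<alpha>) + 4 * s * r powr (2 - \<alpha>) / \<delta>\<^sup>2 < e / 4"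
      by (rule order_tendstoD(2)[OF *]) (use e in simp)
    show "\<forall>\<^sub>F r in at_right 0. r * b * (x + 2 * \<delta>) powr (- \<alpha>) + 4 * s * r powr (2 - \<alpha>) / \<delta>\<^sup>2 < e / 4"
      by (rule order_tendstoD(2)[OF *]) (use e in simp)
    show "\<forall>\<^sub>F r in at_right 0. r < x - \<delta>"
      by (rule order_tendstoD(2)[OF tendsto_ident_at]) (use \<delta> in simp)
    show "\<forall>\<^sub>F r in at_right 0. (0::real) < r" by (rule eventually_at_right_less)
  qed
  from eventually_happens'[OF _ this] obtain r where r:
     "r * b * (x - 2 * \<delta>) powr (- \<alpha>) + 4 * s * r powr (2 - \<alpha>) / \<delta>\<^sup>2 < e / 4"
     "r * b * (x + 2 * \<delta>) powr (- \<alpha>) + 4 * s * r powr (2 - \<alpha>) / \<delta>\<^sup>2 < e / 4" "r < x - \<delta>" "0 < r" by auto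
  obtain R0 where R0: "stable_tail_asymptotics \<alpha> r R0"
    using stable_law_tail_uniform[OF alpha r(4)] by blast
  note R0_pos = stable_tail_asymptoticsD(2)[OF R0]
  define v where "v n = real (card (T n))" for n
  define L where "L n = v n powr (1 / \<alpha>)" for n
  define \<eta> where "\<eta> n = 1 / (v n)\<^sup>2" for n
  define Bn where "Bn n = (\<integral>x. Max ((\<lambda>t. \<bar>F t x\<bar> powr \<alpha>) ` T n) \<partial>\<mu>)" for n
  define err where "err c n = r * ((Bn n + \<eta> n) / v n) * c powr (- \<alpha>) + ?C\<^sup>2 * (s + \<eta> n) * ((Bn n + \<eta> n) / v n) * (c powr (- \<alpha>))\<^sup>2 * (1 / v n)
       + (K * (s + \<eta> n) * r powr (- \<alpha>))\<^sup>2 * (1 / v n) + 4 * (s + \<eta> n) * r powr (2 - \<alpha>) / \<delta>\<^sup>2 + 1 / v n" for c n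
  have v: "filterlim v at_top sequentially" using V by (simp add: v_def[abs_def])
  have v1: "(\<lambda>n. 1 / v n) \<longlonglongrightarrow> 0" by (rule real_tendsto_divide_at_top[OF tendsto_const v])
  have \<eta>0: "\<eta> \<longlonglongrightarrow> 0" using tendsto_mult[OF v1 v1] by (simp add: \<eta>_def[abs_def] power2_eq_square)
  have B1: "(\<lambda>n. (Bn n + \<eta> n) / v n) \<longlonglongrightarrow> b"
    using tendsto_add[OF B tendsto_mult[OF \<eta>0 v1]] by (simp add: Bn_def v_def add_divide_distrib)
  have B2: "(\<lambda>n. (Bn n - \<eta> n) / v n) \<longlonglongrightarrow> b"
    using tendsto_diff[OF B tendsto_mult[OF \<eta>0 v1]] by (simp add: Bn_def v_def diff_divide_distrib)
  have err: "err c \<longlonglongrightarrow> r * b * c powr (- \<alpha>) + 4 * s * r powr (2 - \<alpha>) / \<delta>\<^sup>2" for c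
  proof -
    have "err c \<longlonglongrightarrow> r * b * c powr (- \<alpha>) + ?C\<^sup>2 * (s + 0) * b * (c powr (- \<alpha>))\<^sup>2 * 0
       + (K * (s + 0) * r powr (- \<alpha>))\<^sup>2 * 0 + 4 * (s + 0) * r powr (2 - \<alpha>) / \<delta>\<^sup>2 + 0"
      unfolding err_def[abs_def] using \<delta>(4) by (intro tendsto_intros B1 v1 \<eta>0) auto
    then show ?thesis by simp
  qed
  have up: "(\<lambda>n. 1 - exp (- (?C * ((Bn n + \<eta> n) / v n) * (x - 2 * \<delta>) powr (- \<alpha>))) + err (x - 2 * \<delta>) n)
      \<longlonglongrightarrow> g (x - 2 * \<delta>) + (r * b * (x - 2 * \<delta>) powr (- \<alpha>) + 4 * s * r powr (2 - \<alpha>) / \<delta>\<^sup>2)"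
    unfolding g_def by (intro tendsto_intros B1 err)
  have lo: "(\<lambda>n. 1 - exp (- (?C * ((Bn n - \<eta> n) / v n) * (x + 2 * \<delta>) powr (- \<alpha>))) - err (x + 2 * \<delta>) n)
      \<longlonglongrightarrow> g (x + 2 * \<delta>) - (r * b * (x + 2 * \<delta>) powr (- \<alpha>) + 4 * s * r powr (2 - \<alpha>) / \<delta>\<^sup>2)"
    unfolding g_def by (intro tendsto_intros B2 err)
  have L: "filterlim L at_top sequentially"
  proof -
    have "filterlim (\<lambda>x::real. x powr (1 / \<alpha>)) at_top at_top" using alpha by real_asymp
    then show ?thesis unfolding L_def[abs_def] by (rule filterlim_compose[OF _ v])
  qed
  have ev1: "\<forall>\<^sub>F n in sequentially. 0 < v n"
    using v unfolding filterlim_at_top_dense by blast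
  have ev2: "\<forall>\<^sub>F n in sequentially. \<eta> n < 1" by (rule order_tendstoD(2)[OF \<eta>0]) simp
  have ev3: "\<forall>\<^sub>F n in sequentially. 1 / \<delta> < L n" using L unfolding filterlim_at_top_dense by blast
  have ev4: "\<forall>\<^sub>F n in sequentially. R0 * (s + 1) / (x - 2 * \<delta>) powr \<alpha> < v n" using v unfolding filterlim_at_top_dense by blast
  have ev5: "\<forall>\<^sub>F n in sequentially. 1 - exp (- (?C * ((Bn n + \<eta> n) / v n) * (x - 2 * \<delta>) powr (- \<alpha>))) + err (x - 2 * \<delta>) n < g x + e"
    by (rule order_tendstoD(2)[OF up]) (use \<delta>(1) r(1) e in linarith)
  have ev6: "\<forall>\<^sub>F n in sequentially. g x - e < 1 - exp (- (?C * ((Bn n - \<eta> n) / v n) * (x + 2 * \<delta>) powr (- \<alpha>))) - err (x + 2 * \<delta>) n"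
    by (rule order_tendstoD(1)[OF lo]) (use \<delta>(2) r(2) e in linarith)
  show "\<forall>\<^sub>F n in sequentially. dist (measure Q {\<omega> \<in> space Q. \<exists>t\<in>T n. x * real (card (T n)) powr (1 / \<alpha>) < \<bar>X t \<omega>\<bar>}) (1 - exp (- (stable_const \<alpha> * b * x powr (- \<alpha>)))) < e"
    using ev1 ev2 ev3 ev4 ev5 ev6
  proof eventually_elim
    fix n assume n: "0 < v n" "\<eta> n < 1" "1 / \<delta> < L n" "R0 * (s + 1) / (x - 2 * \<delta>) powr \<alpha> < v n"
      and U: "1 - exp (- (?C * ((Bn n + \<eta> n) / v n) * (x - 2 * \<delta>) powr (- \<alpha>))) + err (x - 2 * \<delta>) n < g x + e"
      and W: "g x - e < 1 - exp (- (?C * ((Bn n - \<eta> n) / v n) * (x + 2 * \<delta>) powr (- \<alpha>))) - err (x + 2 * \<delta>) n"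
    have Tn: "T n \<noteq> {}" using n(1) by (auto simp: v_def)
    have c1: "\<eta> n \<le> \<delta> * L n" using n(2,3) \<delta>(4) by (simp add: field_simps)
    have "R0 * (s + \<eta> n) \<le> R0 * (s + 1)" using n(2) R0_pos by (intro mult_left_mono) auto
    also have "\<dots> \<le> (x - 2 * \<delta>) powr \<alpha> * v n"
      using n(4) \<delta>(3) by (simp add: field_simps)
    finally have c2: "R0 * (s + \<eta> n) \<le> (x - 2 * \<delta>) powr \<alpha> * v n" .
    note bounds = prob_large_stable_integral_bounds[OF alpha N T Tn X s K _ R0 v_def L_def \<eta>_def r(4) less_imp_le[OF r(3)] \<delta>(4) \<delta>(3) c1 c2 Bn_def]
    have "p n < g x + e"
      using bounds(1) U r(4) unfolding p_def err_def L_def v_def by simp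
    moreover have "g x - e < p n"
      using bounds(2) W r(4) unfolding p_def err_def L_def v_def by simp
    ultimately show "dist (measure Q {\<omega> \<in> space Q. \<exists>t\<in>T n. x * real (card (T n)) powr (1 / \<alpha>) < \<bar>X t \<omega>\<bar>}) (1 - exp (- (stable_const \<alpha> * b * x powr (- \<alpha>)))) < e"
      unfolding dist_real_def p_def[symmetric] g_def[symmetric] by linarith
  qed
qed

lemma (in stable_array) sum_stable_law:
  "stable_law \<alpha> (\<Sum>j\<in>J. m j * \<bar>a t j\<bar> powr \<alpha>) (distr Q borel (\<lambda>\<omega>. \<Sum>j\<in>J. a t j * Z j \<omega>))"
  unfolding stable_law_def
proof
  have [measurable]: "(\<lambda>\<omega>. \<Sum>j\<in>J. a t j * Z j \<omega>) \<in> borel_measurable Q"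
    by (intro borel_measurable_sum) measurable
  show "real_distribution (distr Q borel (\<lambda>\<omega>. \<Sum>j\<in>J. a t j * Z j \<omega>))"
    by (rule real_distribution_distr) measurable
  have ind: "indep_vars (\<lambda>_. borel) (\<lambda>j \<omega>. a t j * Z j \<omega>) J"
    by (rule indep_vars_compose2[OF indep]) auto
  show "\<forall>\<theta>. char (distr Q borel (\<lambda>\<omega>. \<Sum>j\<in>J. a t j * Z j \<omega>)) \<theta> = of_real (exp (- (\<bar>\<theta>\<bar> powr \<alpha> * (\<Sum>j\<in>J. m j * \<bar>a t j\<bar> powr \<alpha>))))"
  proof
    fix \<theta>
    have "char (distr Q borel (\<lambda>\<omega>. \<Sum>j\<in>J. a t j * Z j \<omega>)) \<theta> = (\<Prod>j\<in>J. char (distr Q borel (\<lambda>\<omega>. a t j * Z j \<omega>)) \<theta>)"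
      by (rule char_distr_sum[OF ind])
    also have "\<dots> = (\<Prod>j\<in>J. of_real (exp (- (\<bar>\<theta>\<bar> powr \<alpha> * (\<bar>a t j\<bar> powr \<alpha> * m j)))))"
      using law_scaled by (intro prod.cong) (auto simp: stable_law_def)
    also have "\<dots> = of_real (\<Prod>j\<in>J. exp (- (\<bar>\<theta>\<bar> powr \<alpha> * (\<bar>a t j\<bar> powr \<alpha> * m j))))" by simp
    also have "(\<Prod>j\<in>J. exp (- (\<bar>\<theta>\<bar> powr \<alpha> * (\<bar>a t j\<bar> powr \<alpha> * m j)))) = exp (- (\<bar>\<theta>\<bar> powr \<alpha> * (\<Sum>j\<in>J. m j * \<bar>a t j\<bar> powr \<alpha>)))"
      by (simp add: exp_sum[OF finJ, symmetric] sum_negf sum_distrib_left mult.commute)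
    finally show "char (distr Q borel (\<lambda>\<omega>. \<Sum>j\<in>J. a t j * Z j \<omega>)) \<theta> = of_real (exp (- (\<bar>\<theta>\<bar> powr \<alpha> * (\<Sum>j\<in>J. m j * \<bar>a t j\<bar> powr \<alpha>))))" .
  qed
qed

text \<open>
  A single stable integral is a limit of stable sums, whose tails obey the bound for stable laws; the
  approximation error tends to \<open>0\<close> at the end.
\<close>

lemma stable_integral_tail_bound:
  fixes N :: "'s set \<Rightarrow> 'b \<Rightarrow> real"
  assumes alpha: "0 < \<alpha>" "\<alpha> < 2" and N: "SaS_random_measure \<alpha> Q \<mu> N" and X: "is_stable_integral \<alpha> Q \<mu> N F X" 
    and Kb: "stable_tail_bound \<alpha> K"
    and x: "x > 0"
  shows "measure Q {\<omega> \<in> space Q. x < \<bar>X \<omega>\<bar>} \<le> K * (\<integral>y. \<bar>F y\<bar> powr \<alpha> \<partial>\<mu>) * x powr (- \<alpha>)"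
proof -
  note K = stable_tail_boundD[OF Kb]
  let ?s = "\<integral>y. \<bar>F y\<bar> powr \<alpha> \<partial>\<mu>"
  have [measurable]: "X \<in> borel_measurable Q" using X by (simp add: is_stable_integral_def)
  have bound: "measure Q {\<omega> \<in> space Q. x < \<bar>X \<omega>\<bar>} \<le> \<eta> + K * (?s + \<eta>) * (x - \<eta>) powr (- \<alpha>)" if \<eta>: "0 < \<eta>" "\<eta> < x" for \<eta>
  proof -
    obtain J :: "nat set" and Z m a where arr: "stable_array Q \<alpha> J Z m {()} a (?s + \<eta>)"
      and near: "measure Q {\<omega> \<in> space Q. \<bar>(\<Sum>j\<in>J. a () j * Z j \<omega>) - X \<omega>\<bar> > \<eta>} \<le> \<eta>"
      by (rule stable_integrals_approx[OF alpha N, where F="\<lambda>_. F" and X="\<lambda>_. X" and s="?s" and \<eta>=\<eta> and T="{()}"]) (use X \<eta> in auto)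
    interpret stable_array Q \<alpha> J Z m "{()}" a "?s + \<eta>" by (rule arr)
    define S where "S \<omega> = (\<Sum>j\<in>J. a () j * Z j \<omega>)" for \<omega>
    have [measurable]: "S \<in> borel_measurable Q"
      unfolding S_def[abs_def] by (intro borel_measurable_sum) measurable
    have "prob {\<omega> \<in> space Q. x < \<bar>X \<omega>\<bar>} \<le> prob ({\<omega> \<in> space Q. \<bar>S \<omega> - X \<omega>\<bar> > \<eta>} \<union> {\<omega> \<in> space Q. x - \<eta> < \<bar>S \<omega>\<bar>})"
      by (intro finite_measure_mono) auto
    also have "\<dots> \<le> prob {\<omega> \<in> space Q. \<bar>S \<omega> - X \<omega>\<bar> > \<eta>} + prob {\<omega> \<in> space Q. x - \<eta> < \<bar>S \<omega>\<bar>}"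
      by (intro measure_Un_le) auto
    also have "prob {\<omega> \<in> space Q. \<bar>S \<omega> - X \<omega>\<bar> > \<eta>} \<le> \<eta>" using near by (simp add: S_def)
    also have "prob {\<omega> \<in> space Q. x - \<eta> < \<bar>S \<omega>\<bar>} = measure (distr Q borel S) {y. x - \<eta> < \<bar>y\<bar>}"
      by (subst measure_distr) (auto intro!: arg_cong[where f=prob])
    also have "\<dots> \<le> K * (\<Sum>j\<in>J. m j * \<bar>a () j\<bar> powr \<alpha>) * (x - \<eta>) powr (- \<alpha>)"
      using sum_stable_law[of "()"] \<eta> m_nonneg unfolding S_def[abs_def] by (intro K(2) sum_nonneg) auto
    also have "\<dots> \<le> K * (?s + \<eta>) * (x - \<eta>) powr (- \<alpha>)"
      using scale[of "()"] K(1) by (intro mult_right_mono mult_left_mono) auto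
    finally show ?thesis by simp
  qed
  have "((\<lambda>\<eta>. \<eta> + K * (?s + \<eta>) * (x - \<eta>) powr (- \<alpha>)) \<longlongrightarrow> 0 + K * (?s + 0) * (x - 0) powr (- \<alpha>)) (at_right 0)"
    using x by (intro tendsto_intros) auto
  then have "measure Q {\<omega> \<in> space Q. x < \<bar>X \<omega>\<bar>} \<le> 0 + K * (?s + 0) * (x - 0) powr (- \<alpha>)"
  proof (rule tendsto_lowerbound)
    have "\<forall>\<^sub>F \<eta> in at_right 0. \<eta> < x" by (rule order_tendstoD(2)[OF tendsto_ident_at x])
    then show "\<forall>\<^sub>F \<eta> in at_right 0. measure Q {\<omega> \<in> space Q. x < \<bar>X \<omega>\<bar>} \<le> \<eta> + K * (?s + \<eta>) * (x - \<eta>) powr (- \<alpha>)"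
      using eventually_at_right_less[of 0] by eventually_elim (rule bound)
  qed simp
  then show ?thesis by simp
qed

section \<open>Moments and the Frechet mean\<close>

lemma (in prob_space) nn_integral_layer_cake:
  fixes u :: "'a \<Rightarrow> real"
  assumes [measurable]: "u \<in> borel_measurable M" and u: "AE x in M. 0 \<le> u x"
  shows "(\<integral>\<^sup>+x. ennreal (u x) \<partial>M) = (\<integral>\<^sup>+y. ennreal (prob {x \<in> space M. y < u x}) * indicator {0<..} y \<partial>lborel)"
proof -
  interpret pair_sigma_finite M lborel by unfold_locales
  have "(\<integral>\<^sup>+x. ennreal (u x) \<partial>M) = (\<integral>\<^sup>+x. (\<integral>\<^sup>+y. indicator {z. 0 < z \<and> z < u x} y \<partial>lborel) \<partial>M)"
  proof (rule nn_integral_cong_AE, use u in eventually_elim)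
    fix x assume x: "0 \<le> u x"
    have "{z. 0 < z \<and> z < u x} = {0<..<u x}" by auto
    then show "ennreal (u x) = (\<integral>\<^sup>+y. indicator {z. 0 < z \<and> z < u x} y \<partial>lborel)"
      using x by simp
  qed
  also have "\<dots> = (\<integral>\<^sup>+y. (\<integral>\<^sup>+x. indicator {z. 0 < z \<and> z < u x} y \<partial>M) \<partial>lborel)"
    by (rule Fubini'[symmetric]) (simp add: case_prod_unfold indicator_def)
  also have "\<dots> = (\<integral>\<^sup>+y. ennreal (prob {x \<in> space M. y < u x}) * indicator {0<..} y \<partial>lborel)"
  proof (rule nn_integral_cong)
    fix y :: real
    have "(\<integral>\<^sup>+x. indicator {z. 0 < z \<and> z < u x} y \<partial>M) = (\<integral>\<^sup>+x. indicator {0<..} y * indicator {x \<in> space M. y < u x} x \<partial>M)"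
      by (intro nn_integral_cong) (auto simp: indicator_def)
    also have "\<dots> = indicator {0<..} y * emeasure M {x \<in> space M. y < u x}"
      by (subst nn_integral_cmult) auto
    finally show "(\<integral>\<^sup>+x. indicator {z. 0 < z \<and> z < u x} y \<partial>M) = ennreal (prob {x \<in> space M. y < u x}) * indicator {0<..} y"
      by (simp add: emeasure_eq_measure mult.commute)
  qed
  finally show ?thesis .
qed

lemma frechet_cdf_properties:
  fixes \<gamma> :: real assumes g: "\<gamma> > 0"
  defines "F \<equiv> \<lambda>x::real. if x > 0 then exp (- (x powr (- \<gamma>))) else 0"
  shows "x \<le> y \<Longrightarrow> F x \<le> F y" "continuous (at_right a) F" "(F \<longlongrightarrow> 0) at_bot" "(F \<longlongrightarrow> 1) at_top"
proof -
  show "x \<le> y \<Longrightarrow> F x \<le> F y"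
  proof -
    assume xy: "x \<le> y"
    show "F x \<le> F y"
    proof (cases "x > 0")
      case True
      then have "y powr (- \<gamma>) \<le> x powr (- \<gamma>)" using xy g by (intro powr_mono2') auto
      then show ?thesis using True xy by (simp add: F_def)
    qed (simp add: F_def)
  qed
  have lim0: "((\<lambda>x::real. exp (- (x powr (- \<gamma>)))) \<longlongrightarrow> 0) (at_right 0)" using g by real_asymp
  show "continuous (at_right a) F"
    unfolding continuous_within
  proof -
    consider "a > 0" | "a = 0" | "a < 0" by linarith
    then show "(F \<longlongrightarrow> F a) (at_right a)"
    proof cases
      case 1
      have "((\<lambda>x. exp (- (x powr (- \<gamma>)))) \<longlongrightarrow> exp (- (a powr (- \<gamma>)))) (at_right a)"
        using 1 by (intro tendsto_intros) auto
      then have "(F \<longlongrightarrow> exp (- (a powr (- \<gamma>)))) (at_right a)"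
        by (rule Lim_transform_eventually)
           (use 1 in \<open>auto simp: F_def intro!: eventually_mono[OF eventually_at_right_less[of a]]\<close>)
      then show ?thesis using 1 by (simp add: F_def)
    next
      case 2
      have "(F \<longlongrightarrow> 0) (at_right 0)"
        by (rule Lim_transform_eventually[OF lim0])
           (auto simp: F_def intro!: eventually_mono[OF eventually_at_right_less[of 0]])
      then show ?thesis using 2 by (simp add: F_def)
    next
      case 3
      have "\<forall>\<^sub>F x in at_right a. x < 0" by (rule order_tendstoD(2)[OF tendsto_ident_at 3])
      then have "(F \<longlongrightarrow> 0) (at_right a)"
        by (intro Lim_transform_eventually[OF tendsto_const] eventually_mono[OF \<open>\<forall>\<^sub>F x in at_right a. x < 0\<close>]) (simp add: F_def)
      then show ?thesis using 3 by (simp add: F_def)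
    qed
  qed
  show "(F \<longlongrightarrow> 0) at_bot"
    by (intro Lim_transform_eventually[OF tendsto_const] eventually_mono[OF eventually_le_at_bot[of 0]]) (simp add: F_def)
  have lim1: "((\<lambda>x::real. exp (- (x powr (- \<gamma>)))) \<longlongrightarrow> 1) at_top" using g by real_asymp
  show "(F \<longlongrightarrow> 1) at_top"
    by (rule Lim_transform_eventually[OF lim1])
       (auto simp: F_def intro!: eventually_mono[OF eventually_gt_at_top[of 0]])
qed

text \<open>
  For \<open>A > 0\<close> the mean of a positive variable with distribution function \<open>exp (- A x\<^sup>-\<^sup>\<gamma>)\<close>, as the integral of its
  tail.
\<close>

definition tail_integral :: "real \<Rightarrow> real \<Rightarrow> real" where
  "tail_integral \<gamma> A = enn2real (\<integral>\<^sup>+y. ennreal (1 - exp (- (A * y powr (- \<gamma>)))) * indicator {0<..} y \<partial>lborel)"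

lemma nn_integral_powr_tail:
  fixes \<gamma> :: real assumes "\<gamma> > 1"
  shows "(\<integral>\<^sup>+y. ennreal (y powr (- \<gamma>)) * indicator {1..} y \<partial>lborel) = ennreal (1 / (\<gamma> - 1))"
proof -
  have "(\<integral>\<^sup>+y. ennreal (y powr (- \<gamma>)) * indicator {1..} y \<partial>lborel) = ennreal (0 - (- (1 powr (1 - \<gamma>) / (\<gamma> - 1))))"
  proof (rule nn_integral_FTC_atLeast[where F="\<lambda>y. - (y powr (1 - \<gamma>) / (\<gamma> - 1))"])
    fix y :: real assume "1 \<le> y"
    then have "y > 0" by simp
    have "DERIV (\<lambda>y. - (y powr (1 - \<gamma>) / (\<gamma> - 1))) y :> - ((1 - \<gamma>) * y powr (1 - \<gamma> - 1) / (\<gamma> - 1))"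
      using \<open>y > 0\<close> assms by (auto intro!: derivative_eq_intros)
    also have "- ((1 - \<gamma>) * y powr (1 - \<gamma> - 1) / (\<gamma> - 1)) = y powr (- \<gamma>)"
      using assms by (simp add: field_simps)
    finally show "DERIV (\<lambda>y. - (y powr (1 - \<gamma>) / (\<gamma> - 1))) y :> y powr (- \<gamma>)" .
  next
    have "((\<lambda>y::real. y powr (1 - \<gamma>)) \<longlongrightarrow> 0) at_top"
      using assms by (intro tendsto_neg_powr filterlim_ident) auto
    from tendsto_minus[OF tendsto_divide[OF this tendsto_const[of "\<gamma> - 1"]]]
    show "((\<lambda>y. - (y powr (1 - \<gamma>) / (\<gamma> - 1))) \<longlongrightarrow> 0) at_top" using assms by simp
  qed auto
  then show ?thesis by simp
qed

lemma tail_integral_finite: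
  assumes g: "\<gamma> > 1" and A: "A \<ge> 0"
  shows "(\<integral>\<^sup>+y. ennreal (1 - exp (- (A * y powr (- \<gamma>)))) * indicator {0<..} y \<partial>lborel) = ennreal (tail_integral \<gamma> A)"
proof -
  have le: "ennreal (1 - exp (- (A * y powr (- \<gamma>)))) * indicator {0<..} y \<le> indicator {0..1} y + ennreal A * (ennreal (y powr (- \<gamma>)) * indicator {1..} y)" for y :: real
  proof (cases "1 \<le> y")
    case True
    have "1 - exp (- (A * y powr (- \<gamma>))) \<le> A * y powr (- \<gamma>)"
      using exp_ge_add_one_self[of "- (A * y powr (- \<gamma>))"] by linarith
    then have "ennreal (1 - exp (- (A * y powr (- \<gamma>)))) \<le> ennreal (A * y powr (- \<gamma>))" by (rule ennreal_leI)
    also have "\<dots> = ennreal A * ennreal (y powr (- \<gamma>))" using A by (simp add: ennreal_mult')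
    finally show ?thesis using True by (simp add: add_increasing)
  next
    case False
    have "ennreal (1 - exp (- (A * y powr (- \<gamma>)))) \<le> ennreal 1" by (rule ennreal_leI) simp
    then show ?thesis using False by (auto simp: indicator_def)
  qed
  have "(\<integral>\<^sup>+y. ennreal (1 - exp (- (A * y powr (- \<gamma>)))) * indicator {0<..} y \<partial>lborel)
     \<le> (\<integral>\<^sup>+y. indicator {0..1} y + ennreal A * (ennreal (y powr (- \<gamma>)) * indicator {1..} y) \<partial>lborel)"
    by (intro nn_integral_mono le)
  also have "\<dots> = 1 + ennreal A * ennreal (1 / (\<gamma> - 1))"
    by (subst nn_integral_add, simp, simp, subst nn_integral_cmult, simp, subst nn_integral_powr_tail[OF g]) simp
  also have "\<dots> < top" by (simp add: ennreal_mult_less_top)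
  finally show ?thesis unfolding tail_integral_def by (simp add: less_top)
qed

lemma tail_integral_nonneg: "0 \<le> tail_integral \<gamma> A" by (simp add: tail_integral_def)

lemma tail_integral_scale:
  assumes g: "\<gamma> > 1" and A: "A \<ge> 0"
  shows "tail_integral \<gamma> A = A powr (1 / \<gamma>) * tail_integral \<gamma> 1"
proof (cases "A = 0")
  case True
  then show ?thesis by (simp add: tail_integral_def)
next
  case False
  define c where "c = A powr (1 / \<gamma>)"
  have Ap: "A > 0" using A False by simp
  have c: "c > 0" "c powr \<gamma> = A" using Ap g by (auto simp: c_def powr_powr)
  have "ennreal (tail_integral \<gamma> A) = (\<integral>\<^sup>+y. ennreal (1 - exp (- (A * y powr (- \<gamma>)))) * indicator {0<..} y \<partial>lborel)"
    by (rule tail_integral_finite[OF g A, symmetric])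
  also have "\<dots> = ennreal \<bar>c\<bar> * (\<integral>\<^sup>+y. ennreal (1 - exp (- (A * (0 + c * y) powr (- \<gamma>)))) * indicator {0<..} (0 + c * y) \<partial>lborel)"
    by (rule nn_integral_real_affine) (use c in auto)
  also have "(\<integral>\<^sup>+y. ennreal (1 - exp (- (A * (0 + c * y) powr (- \<gamma>)))) * indicator {0<..} (0 + c * y) \<partial>lborel)
     = (\<integral>\<^sup>+y. ennreal (1 - exp (- (1 * y powr (- \<gamma>)))) * indicator {0<..} y \<partial>lborel)"
  proof (rule nn_integral_cong)
    fix y :: real
    have "A * (c * y) powr (- \<gamma>) = y powr (- \<gamma>)" if "y > 0"
      using that c by (simp add: powr_mult powr_minus c(2)[symmetric])
    then show "ennreal (1 - exp (- (A * (0 + c * y) powr (- \<gamma>)))) * indicator {0<..} (0 + c * y) = ennreal (1 - exp (- (1 * y powr (- \<gamma>)))) * indicator {0<..} y"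
      using c by (auto simp: indicator_def zero_less_mult_iff)
  qed
  also have "\<dots> = ennreal (tail_integral \<gamma> 1)" by (rule tail_integral_finite[OF g]) simp
  finally have "ennreal (tail_integral \<gamma> A) = ennreal (c * tail_integral \<gamma> 1)"
    using c by (simp add: ennreal_mult')
  then show ?thesis using tail_integral_nonneg c by (subst (asm) ennreal_inj) (auto simp: c_def)
qed

lemma frechet_mean:
  assumes g: "\<gamma> > 1"
  shows "(\<integral>z. z \<partial>frechet \<gamma>) = tail_integral \<gamma> 1"
proof -
  have g0: "\<gamma> > 0" using g by simp
  note F = frechet_cdf_properties[OF g0]
  interpret real_distribution "frechet \<gamma>"
    unfolding frechet_def by (rule real_distribution_interval_measure) (use F in auto)
  have Iic: "measure (frechet \<gamma>) {..x} = (if x > 0 then exp (- (x powr (- \<gamma>))) else 0)" for x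
    unfolding frechet_def by (rule measure_interval_measure_Iic) (use F in auto)
  have pos: "AE z in frechet \<gamma>. 0 \<le> z"
  proof -
    have "AE z in frechet \<gamma>. z \<notin> {..0}"
      using Iic[of 0] by (intro AE_not_in) (simp add: null_sets_def emeasure_eq_measure)
    then show ?thesis by eventually_elim auto
  qed
  have "(\<integral>\<^sup>+z. ennreal z \<partial>frechet \<gamma>) = (\<integral>\<^sup>+y. ennreal (prob {z \<in> space (frechet \<gamma>). y < z}) * indicator {0<..} y \<partial>lborel)"
    by (rule nn_integral_layer_cake) (use pos in auto)
  also have "\<dots> = (\<integral>\<^sup>+y. ennreal (1 - exp (- (1 * y powr (- \<gamma>)))) * indicator {0<..} y \<partial>lborel)"
  proof (rule nn_integral_cong)
    fix y :: real
    have "{z \<in> space (frechet \<gamma>). y < z} = space (frechet \<gamma>) - {..y}" by auto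
    then have "prob {z \<in> space (frechet \<gamma>). y < z} = 1 - measure (frechet \<gamma>) {..y}"
      by (simp add: prob_compl[symmetric])
    then show "ennreal (prob {z \<in> space (frechet \<gamma>). y < z}) * indicator {0<..} y = ennreal (1 - exp (- (1 * y powr (- \<gamma>)))) * indicator {0<..} y"
      by (auto simp: Iic indicator_def)
  qed
  also have "\<dots> = ennreal (tail_integral \<gamma> 1)" by (rule tail_integral_finite[OF g]) simp
  finally have "(\<integral>\<^sup>+z. ennreal z \<partial>frechet \<gamma>) = ennreal (tail_integral \<gamma> 1)" .
  then show ?thesis using pos tail_integral_nonneg by (subst integral_eq_nn_integral) auto
qed

text \<open>
  By the layer cake formula the normalised moment is the integral of \<open>P(M\<^sub>n > y\<^sup>1\<^sup>/\<^sup>\<beta> L\<^sub>n)\<close> over \<open>y > 0\<close>, which is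
  dominated by \<open>1\<close> on \<open>[0, 1]\<close> and by \<open>K y\<^sup>-\<^sup>\<alpha>\<^sup>/\<^sup>\<beta>\<close> on \<open>[1, \<infinity>)\<close>. The exponent exceeds \<open>1\<close> because \<open>\<beta> < \<alpha>\<close>.
\<close>

lemma moment_limit:
  fixes M :: "nat \<Rightarrow> 'a \<Rightarrow> real"
  assumes P: "prob_space P" and M[measurable]: "\<And>n. M n \<in> borel_measurable P" and M0: "\<And>n \<omega>. n \<ge> 1 \<Longrightarrow> 0 \<le> M n \<omega>"
    and L: "\<And>n. n \<ge> 1 \<Longrightarrow> L n > (0::real)" and \<beta>: "0 < \<beta>" "\<beta> < \<alpha>" and K: "K \<ge> 0"
    and bound: "\<And>n x. n \<ge> 1 \<Longrightarrow> x > 0 \<Longrightarrow> measure P {\<omega> \<in> space P. x * L n < M n \<omega>} \<le> K * x powr (- \<alpha>)"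
    and lim: "\<And>x. x > 0 \<Longrightarrow> (\<lambda>n. measure P {\<omega> \<in> space P. x * L n < M n \<omega>}) \<longlonglongrightarrow> 1 - exp (- (A * x powr (- \<alpha>)))"
    and A: "A \<ge> 0"
  shows "\<forall>n\<ge>1. integrable P (\<lambda>\<omega>. M n \<omega> powr \<beta>)"
    and "(\<lambda>n. L n powr (- \<beta>) * prob_space.expectation P (\<lambda>\<omega>. M n \<omega> powr \<beta>)) \<longlonglongrightarrow> A powr (\<beta> / \<alpha>) * (\<integral>z. z \<partial>frechet (\<alpha> / \<beta>))"
proof -
  interpret prob_space P by (rule P)
  define \<gamma> where "\<gamma> = \<alpha> / \<beta>"
  have g: "\<gamma> > 1" using \<beta> by (simp add: \<gamma>_def)
  have a: "\<alpha> > 0" using \<beta> by simp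
  define p where "p n y = prob {\<omega> \<in> space P. y powr (1 / \<beta>) * L n < M n \<omega>}" for n y
  define w where "w y = indicator {0..1} y + ennreal K * (ennreal (y powr (- \<gamma>)) * indicator {1..} y)" for y :: real
  have lc: "(\<integral>\<^sup>+\<omega>. ennreal (L n powr (- \<beta>) * M n \<omega> powr \<beta>) \<partial>P) = (\<integral>\<^sup>+y. ennreal (p n y) * indicator {0<..} y \<partial>lborel)" if n: "n \<ge> 1" for n
  proof -
    have "(\<integral>\<^sup>+\<omega>. ennreal (L n powr (- \<beta>) * M n \<omega> powr \<beta>) \<partial>P) = (\<integral>\<^sup>+y. ennreal (prob {\<omega> \<in> space P. y < L n powr (- \<beta>) * M n \<omega> powr \<beta>}) * indicator {0<..} y \<partial>lborel)"
      by (rule nn_integral_layer_cake) auto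
    also have "\<dots> = (\<integral>\<^sup>+y. ennreal (p n y) * indicator {0<..} y \<partial>lborel)"
    proof (rule nn_integral_cong)
      fix y :: real
      have "y < L n powr (- \<beta>) * M n \<omega> powr \<beta> \<longleftrightarrow> y powr (1 / \<beta>) * L n < M n \<omega>" if y: "y > 0" for \<omega>
      proof -
        have "L n powr (- \<beta>) * M n \<omega> powr \<beta> = (M n \<omega> / L n) powr \<beta>"
          using L[OF n] M0[OF n] by (simp add: powr_divide powr_minus field_simps)
        moreover have "y = (y powr (1 / \<beta>)) powr \<beta>" using y \<beta> by (simp add: powr_powr)
        ultimately have "y < L n powr (- \<beta>) * M n \<omega> powr \<beta> \<longleftrightarrow> (y powr (1 / \<beta>)) powr \<beta> < (M n \<omega> / L n) powr \<beta>" by simp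
        also have "\<dots> \<longleftrightarrow> y powr (1 / \<beta>) < M n \<omega> / L n"
        proof -
          have "0 \<le> M n \<omega> / L n" using L[OF n] M0[OF n, of \<omega>] by simp
          then show ?thesis
            using \<beta> powr_less_mono2[of \<beta> "y powr (1 / \<beta>)" "M n \<omega> / L n"] powr_mono2[of \<beta> "M n \<omega> / L n" "y powr (1 / \<beta>)"]
            by (smt (verit) powr_ge_zero)
        qed
        also have "\<dots> \<longleftrightarrow> y powr (1 / \<beta>) * L n < M n \<omega>" using L[OF n] by (simp add: field_simps)
        finally show ?thesis .
      qed
      then show "ennreal (prob {\<omega> \<in> space P. y < L n powr (- \<beta>) * M n \<omega> powr \<beta>}) * indicator {0<..} y = ennreal (p n y) * indicator {0<..} y"
        by (auto simp: p_def indicator_def)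
    qed
    finally show ?thesis .
  qed
  have pw: "ennreal (p n y) * indicator {0<..} y \<le> w y" if n: "n \<ge> 1" for n and y :: real
  proof (cases "1 \<le> y")
    case True
    then have "p n y \<le> K * (y powr (1 / \<beta>)) powr (- \<alpha>)" unfolding p_def by (intro bound[OF n]) auto
    also have "(y powr (1 / \<beta>)) powr (- \<alpha>) = y powr (- \<gamma>)" by (simp add: powr_powr \<gamma>_def)
    finally have "ennreal (p n y) \<le> ennreal K * ennreal (y powr (- \<gamma>))"
      using K by (simp add: ennreal_mult'[symmetric] ennreal_leI)
    then show ?thesis using True by (simp add: w_def add_increasing)
  next
    case False
    have "ennreal (p n y) \<le> ennreal 1" by (rule ennreal_leI) (simp add: p_def)
    then show ?thesis using False by (auto simp: indicator_def w_def)
  qed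
  have w: "(\<integral>\<^sup>+y. w y \<partial>lborel) < \<infinity>"
  proof -
    have "(\<integral>\<^sup>+y. w y \<partial>lborel) = 1 + ennreal K * ennreal (1 / (\<gamma> - 1))"
      unfolding w_def
      by (subst nn_integral_add, simp, simp, subst nn_integral_cmult, simp, subst nn_integral_powr_tail[OF g]) simp
    also have "\<dots> < \<infinity>" by (simp add: ennreal_mult_less_top)
    finally show ?thesis .
  qed
  have fin: "(\<integral>\<^sup>+\<omega>. ennreal (L n powr (- \<beta>) * M n \<omega> powr \<beta>) \<partial>P) < \<infinity>" if n: "n \<ge> 1" for n
  proof -
    have "(\<integral>\<^sup>+\<omega>. ennreal (L n powr (- \<beta>) * M n \<omega> powr \<beta>) \<partial>P) \<le> (\<integral>\<^sup>+y. w y \<partial>lborel)"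
      unfolding lc[OF n] by (intro nn_integral_mono pw n)
    then show ?thesis using w by simp
  qed
  have int: "integrable P (\<lambda>\<omega>. L n powr (- \<beta>) * M n \<omega> powr \<beta>)" if n: "n \<ge> 1" for n
    by (rule integrableI_nonneg) (use fin[OF n] in auto)
  show I: "\<forall>n\<ge>1. integrable P (\<lambda>\<omega>. M n \<omega> powr \<beta>)"
  proof (intro allI impI)
    fix n :: nat assume n: "1 \<le> n"
    have "integrable P (\<lambda>\<omega>. L n powr \<beta> * (L n powr (- \<beta>) * M n \<omega> powr \<beta>))"
      by (rule integrable_mult_right[OF int[OF n]])
    moreover have "L n powr \<beta> * (L n powr (- \<beta>) * M n \<omega> powr \<beta>) = M n \<omega> powr \<beta>" for \<omega>
      using L[OF n] by (simp add: powr_minus)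
    ultimately show "integrable P (\<lambda>\<omega>. M n \<omega> powr \<beta>)" by simp
  qed
  have pm[measurable]: "p n \<in> borel_measurable borel" for n
  proof -
    have "(\<lambda>y. measure P {\<omega> \<in> space P. y powr (1 / \<beta>) * L n < M n \<omega>}) \<in> borel_measurable borel"
      by measurable
    then show ?thesis by (simp add: p_def[abs_def])
  qed
  have "(\<lambda>n. \<integral>\<^sup>+y. ennreal (p (Suc n) y) * indicator {0<..} y \<partial>lborel) \<longlonglongrightarrow> (\<integral>\<^sup>+y. ennreal (1 - exp (- (A * y powr (- \<gamma>)))) * indicator {0<..} y \<partial>lborel)"
  proof (rule nn_integral_dominated_convergence[where w=w])
    show "AE y in lborel. ennreal (p (Suc n) y) * indicator {0<..} y \<le> w y" for n
      by (intro AE_I2 pw) simp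
    show "AE y in lborel. (\<lambda>n. ennreal (p (Suc n) y) * indicator {0<..} y) \<longlonglongrightarrow> ennreal (1 - exp (- (A * y powr (- \<gamma>)))) * indicator {0<..} y"
    proof (intro AE_I2)
      fix y :: real
      show "(\<lambda>n. ennreal (p (Suc n) y) * indicator {0<..} y) \<longlonglongrightarrow> ennreal (1 - exp (- (A * y powr (- \<gamma>)))) * indicator {0<..} y"
      proof (cases "y > 0")
        case True
        have "(\<lambda>n. p n y) \<longlonglongrightarrow> 1 - exp (- (A * (y powr (1 / \<beta>)) powr (- \<alpha>)))"
          unfolding p_def by (rule lim) (use True in simp)
        also have "(y powr (1 / \<beta>)) powr (- \<alpha>) = y powr (- \<gamma>)" by (simp add: powr_powr \<gamma>_def)
        finally have "(\<lambda>n. p (Suc n) y) \<longlonglongrightarrow> 1 - exp (- (A * y powr (- \<gamma>)))" by (rule LIMSEQ_Suc)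
        then show ?thesis using True by (simp add: tendsto_ennrealI)
      qed simp
    qed
  qed (use w in \<open>auto simp: w_def[abs_def]\<close>)
  then have "(\<lambda>n. \<integral>\<^sup>+\<omega>. ennreal (L (Suc n) powr (- \<beta>) * M (Suc n) \<omega> powr \<beta>) \<partial>P) \<longlonglongrightarrow> ennreal (tail_integral \<gamma> A)"
    using tail_integral_finite[OF g A] lc by simp
  moreover have "(\<integral>\<^sup>+\<omega>. ennreal (L (Suc n) powr (- \<beta>) * M (Suc n) \<omega> powr \<beta>) \<partial>P) = ennreal (L (Suc n) powr (- \<beta>) * expectation (\<lambda>\<omega>. M (Suc n) \<omega> powr \<beta>))" for n
    using nn_integral_eq_integral[OF int[of "Suc n"]] by simp
  ultimately have "(\<lambda>n. ennreal (L (Suc n) powr (- \<beta>) * expectation (\<lambda>\<omega>. M (Suc n) \<omega> powr \<beta>))) \<longlonglongrightarrow> ennreal (tail_integral \<gamma> A)"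
    by simp
  then have "(\<lambda>n. L (Suc n) powr (- \<beta>) * expectation (\<lambda>\<omega>. M (Suc n) \<omega> powr \<beta>)) \<longlonglongrightarrow> tail_integral \<gamma> A"
    by (subst (asm) tendsto_ennreal_iff) (auto simp: tail_integral_nonneg)
  then have "(\<lambda>n. L n powr (- \<beta>) * expectation (\<lambda>\<omega>. M n \<omega> powr \<beta>)) \<longlonglongrightarrow> tail_integral \<gamma> A"
    by (rule LIMSEQ_imp_Suc)
  also have "tail_integral \<gamma> A = A powr (\<beta> / \<alpha>) * (\<integral>z. z \<partial>frechet (\<alpha> / \<beta>))"
    using frechet_mean[OF g] tail_integral_scale[OF g A] by (simp add: \<gamma>_def)
  finally show "(\<lambda>n. L n powr (- \<beta>) * expectation (\<lambda>\<omega>. M n \<omega> powr \<beta>)) \<longlonglongrightarrow> A powr (\<beta> / \<alpha>) * (\<integral>z. z \<partial>frechet (\<alpha> / \<beta>))" .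
qed

section \<open>The kernel of a nonsingular flow\<close>

locale nonsingular_flow = sigma_finite_measure \<mu> for \<mu> :: "'s measure" +
  fixes \<phi> :: "'t::{ab_group_add, countable} \<Rightarrow> 's \<Rightarrow> 's"
  assumes action: "nonsingular_action \<mu> \<phi>"
begin

lemma phi_measurable[measurable]: "\<phi> t \<in> measurable \<mu> \<mu>"
  using action by (simp add: nonsingular_action_def)

lemma phi_space: "x \<in> space \<mu> \<Longrightarrow> \<phi> t x \<in> space \<mu>"
  by (rule measurable_space[OF phi_measurable])

lemma phi_zero: "x \<in> space \<mu> \<Longrightarrow> \<phi> 0 x = x"
  and phi_add: "x \<in> space \<mu> \<Longrightarrow> \<phi> (u + v) x = \<phi> u (\<phi> v x)"
  using action by (auto simp: nonsingular_action_def)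

lemma phi_inverse: "x \<in> space \<mu> \<Longrightarrow> \<phi> t (\<phi> (- t) x) = x" "x \<in> space \<mu> \<Longrightarrow> \<phi> (- t) (\<phi> t x) = x"
  using phi_add[of x t "- t"] phi_add[of x "- t" t] phi_zero by auto

lemma phi_image: assumes "A \<in> sets \<mu>" shows "\<phi> t ` A = \<phi> (- t) -` A \<inter> space \<mu>"
proof -
  have A: "A \<subseteq> space \<mu>" by (rule sets.sets_into_space[OF assms])
  show ?thesis
  proof (intro set_eqI iffI)
    fix y assume "y \<in> \<phi> t ` A"
    then show "y \<in> \<phi> (- t) -` A \<inter> space \<mu>" using A phi_space phi_inverse(2) by auto
  next
    fix y assume "y \<in> \<phi> (- t) -` A \<inter> space \<mu>"
    then show "y \<in> \<phi> t ` A" using phi_inverse(1)[of y t] by (intro image_eqI[of _ _ "\<phi> (- t) y"]) auto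
  qed
qed

lemma shifted_measure_eq_distr: "shifted_measure \<mu> \<phi> t = distr \<mu> \<mu> (\<phi> (- t))"
proof -
  have "shifted_measure \<mu> \<phi> t = measure_of (space \<mu>) (sets \<mu>) (emeasure (distr \<mu> \<mu> (\<phi> (- t))))"
    unfolding shifted_measure_def
  proof (rule measure_of_eq)
    show "sets \<mu> \<subseteq> Pow (space \<mu>)" by (rule sets.space_closed)
    fix A assume "A \<in> sigma_sets (space \<mu>) (sets \<mu>)"
    then have "A \<in> sets \<mu>" by (simp add: sets.sigma_sets_eq)
    then show "emeasure \<mu> (\<phi> t ` A) = emeasure (distr \<mu> \<mu> (\<phi> (- t))) A"
      by (simp add: phi_image emeasure_distr)
  qed
  also have "\<dots> = distr \<mu> \<mu> (\<phi> (- t))"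
    using measure_of_of_measure[of "distr \<mu> \<mu> (\<phi> (- t))"] by simp
  finally show ?thesis .
qed

definition rn :: "'t \<Rightarrow> 's \<Rightarrow> ennreal" where
  "rn t = RN_deriv \<mu> (shifted_measure \<mu> \<phi> t)"

lemma rn_measurable[measurable]: "rn t \<in> borel_measurable \<mu>"
  by (simp add: rn_def)

lemma density_rn: "density \<mu> (rn t) = distr \<mu> \<mu> (\<phi> (- t))"
proof -
  have "absolutely_continuous \<mu> (shifted_measure \<mu> \<phi> t)"
    using action by (simp add: nonsingular_action_def)
  then show ?thesis
    unfolding rn_def shifted_measure_eq_distr by (intro density_RN_deriv) auto
qed

lemma nn_integral_shift:
  assumes [measurable]: "h \<in> borel_measurable \<mu>"
  shows "(\<integral>\<^sup>+x. rn t x * h (\<phi> t x) \<partial>\<mu>) = (\<integral>\<^sup>+x. h x \<partial>\<mu>)"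
proof -
  have "(\<integral>\<^sup>+x. rn t x * h (\<phi> t x) \<partial>\<mu>) = (\<integral>\<^sup>+x. h (\<phi> t x) \<partial>density \<mu> (rn t))"
    by (subst nn_integral_density) auto
  also have "\<dots> = (\<integral>\<^sup>+x. h (\<phi> t (\<phi> (- t) x)) \<partial>\<mu>)"
    unfolding density_rn by (subst nn_integral_distr) auto
  also have "\<dots> = (\<integral>\<^sup>+x. h x \<partial>\<mu>)"
    by (intro nn_integral_cong) (simp add: phi_inverse)
  finally show ?thesis .
qed

text \<open>
  The chain rule for Radon-Nikodym derivatives: both sides are densities of the same shifted measure.
\<close>

lemma rn_cocycle: "AE x in \<mu>. rn (t + u) x = rn t (\<phi> u x) * rn u x"
proof -
  have "density \<mu> (\<lambda>x. rn t (\<phi> u x) * rn u x) = shifted_measure \<mu> \<phi> (t + u)"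
  proof (rule measure_eqI)
    show "sets (density \<mu> (\<lambda>x. rn t (\<phi> u x) * rn u x)) = sets (shifted_measure \<mu> \<phi> (t + u))"
      by (simp add: shifted_measure_eq_distr)
    fix A assume "A \<in> sets (density \<mu> (\<lambda>x. rn t (\<phi> u x) * rn u x))"
    then have [measurable]: "A \<in> sets \<mu>" by simp
    define h where "h y = rn t y * indicator A (\<phi> (- u) y)" for y
    have [measurable]: "h \<in> borel_measurable \<mu>" unfolding h_def[abs_def] by measurable
    have "emeasure (density \<mu> (\<lambda>x. rn t (\<phi> u x) * rn u x)) A = (\<integral>\<^sup>+x. rn t (\<phi> u x) * rn u x * indicator A x \<partial>\<mu>)"
      by (rule emeasure_density) measurable
    also have "\<dots> = (\<integral>\<^sup>+x. rn u x * h (\<phi> u x) \<partial>\<mu>)"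
      by (intro nn_integral_cong) (simp add: h_def phi_inverse mult_ac)
    also have "\<dots> = (\<integral>\<^sup>+x. h x \<partial>\<mu>)" by (rule nn_integral_shift) measurable
    also have "\<dots> = (\<integral>\<^sup>+x. rn t x * indicator (\<phi> (- u) -` A \<inter> space \<mu>) x \<partial>\<mu>)"
      by (intro nn_integral_cong) (auto simp: h_def indicator_def)
    also have "\<dots> = emeasure (density \<mu> (rn t)) (\<phi> (- u) -` A \<inter> space \<mu>)"
      by (rule emeasure_density[symmetric]) auto
    also have "\<dots> = emeasure \<mu> (\<phi> (- t) -` (\<phi> (- u) -` A \<inter> space \<mu>) \<inter> space \<mu>)"
      unfolding density_rn by (rule emeasure_distr) auto
    also have "\<phi> (- t) -` (\<phi> (- u) -` A \<inter> space \<mu>) \<inter> space \<mu> = \<phi> (- (t + u)) -` A \<inter> space \<mu>"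
      using phi_space phi_add[of _ "- u" "- t"] by (auto simp: add.commute)
    also have "emeasure \<mu> \<dots> = emeasure (shifted_measure \<mu> \<phi> (t + u)) A"
      unfolding shifted_measure_eq_distr by (rule emeasure_distr[symmetric]) auto
    finally show "emeasure (density \<mu> (\<lambda>x. rn t (\<phi> u x) * rn u x)) A = emeasure (shifted_measure \<mu> \<phi> (t + u)) A" .
  qed
  then have "AE x in \<mu>. rn t (\<phi> u x) * rn u x = rn (t + u) x"
    unfolding rn_def[of "t + u"] by (intro RN_deriv_unique) auto
  then show ?thesis by eventually_elim simp
qed

end

locale flow_kernel = nonsingular_flow \<mu> \<phi> for \<mu> :: "'s measure" and \<phi> :: "'t::{ab_group_add, countable} \<Rightarrow> 's \<Rightarrow> 's" +
  fixes \<alpha> :: real and c :: "'t \<Rightarrow> 's \<Rightarrow> real" and f :: "'s \<Rightarrow> real"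
  assumes alpha: "0 < \<alpha>" and cocycle: "sign_cocycle \<mu> \<phi> c"
    and kernel_in_Lp: "\<And>t. in_Lp \<alpha> \<mu> (action_kernel \<alpha> \<mu> \<phi> c f t)"
begin

text \<open>
  Everything that follows depends on the kernel through \<open>|F\<^sub>t|\<^sup>\<alpha>\<close> only; in this form the signs disappear and the
  derivative enters linearly.
\<close>

definition kernel_pow :: "'t \<Rightarrow> 's \<Rightarrow> real" where
  "kernel_pow t x = \<bar>action_kernel \<alpha> \<mu> \<phi> c f t x\<bar> powr \<alpha>"

lemma kernel_pow_integrable[intro, simp]: "integrable \<mu> (kernel_pow t)"
  using kernel_in_Lp[of t] by (simp add: in_Lp_def kernel_pow_def[abs_def])

lemma kernel_pow_measurable[measurable]: "kernel_pow t \<in> borel_measurable \<mu>"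
  by (rule borel_measurable_integrable[OF kernel_pow_integrable])

lemma kernel_pow_nonneg[simp]: "0 \<le> kernel_pow t x" by (simp add: kernel_pow_def)

lemma kernel_pow_eq: "x \<in> space \<mu> \<Longrightarrow> kernel_pow t x = enn2real (rn t x) * \<bar>f (\<phi> t x)\<bar> powr \<alpha>"
proof -
  assume x: "x \<in> space \<mu>"
  have "c t x \<in> {1, - 1}" using cocycle x unfolding sign_cocycle_def by blast
  then have "\<bar>c t x\<bar> = 1" by auto
  then show ?thesis
    using alpha by (simp add: kernel_pow_def action_kernel_def abs_mult powr_mult powr_powr rn_def)
qed

lemma kernel_pow_cocycle: "AE x in \<mu>. \<forall>t u. kernel_pow (t + u) x = kernel_pow t (\<phi> u x) * enn2real (rn u x)"
proof -
  have "AE x in \<mu>. kernel_pow (t + u) x = kernel_pow t (\<phi> u x) * enn2real (rn u x)" for t u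
    using rn_cocycle[of t u] AE_space
    by eventually_elim (simp add: kernel_pow_eq phi_space phi_add enn2real_mult mult_ac)
  then show ?thesis by (simp add: AE_all_countable)
qed

text \<open>
  A change of variables in the form of an inequality: \<open>enn2real\<close> can only decrease the derivative, which is
  enough for upper bounds.
\<close>

lemma integral_shift_le:
  assumes [measurable]: "h \<in> borel_measurable \<mu>" and h: "integrable \<mu> h" "\<And>x. x \<in> space \<mu> \<Longrightarrow> 0 \<le> h x"
    and [measurable]: "g \<in> borel_measurable \<mu>" and g: "AE x in \<mu>. 0 \<le> g x \<and> g x \<le> h (\<phi> u x) * enn2real (rn u x)"
  shows "integrable \<mu> g" and "(\<integral>x. g x \<partial>\<mu>) \<le> (\<integral>x. h x \<partial>\<mu>)"
proof -
  have "(\<integral>\<^sup>+x. ennreal (g x) \<partial>\<mu>) \<le> (\<integral>\<^sup>+x. rn u x * ennreal (h (\<phi> u x)) \<partial>\<mu>)"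
  proof (rule nn_integral_mono_AE, use g AE_space in eventually_elim)
    fix x assume x: "0 \<le> g x \<and> g x \<le> h (\<phi> u x) * enn2real (rn u x)" "x \<in> space \<mu>"
    then have "ennreal (g x) \<le> ennreal (h (\<phi> u x) * enn2real (rn u x))" by (intro ennreal_leI) auto
    also have "\<dots> = ennreal (enn2real (rn u x)) * ennreal (h (\<phi> u x))"
      using h(2) phi_space x(2) by (simp add: ennreal_mult mult.commute)
    also have "\<dots> \<le> rn u x * ennreal (h (\<phi> u x))"
    proof (rule mult_right_mono)
      show "ennreal (enn2real (rn u x)) \<le> rn u x" by (cases "rn u x") auto
    qed simp
    finally show "ennreal (g x) \<le> rn u x * ennreal (h (\<phi> u x))" .
  qed
  also have "\<dots> = (\<integral>\<^sup>+x. ennreal (h x) \<partial>\<mu>)"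
    by (rule nn_integral_shift) measurable
  also have "\<dots> = ennreal (\<integral>x. h x \<partial>\<mu>)"
    by (rule nn_integral_eq_integral) (use h in auto)
  finally have le: "(\<integral>\<^sup>+x. ennreal (g x) \<partial>\<mu>) \<le> ennreal (\<integral>x. h x \<partial>\<mu>)" .
  have g0: "AE x in \<mu>. 0 \<le> g x" using g by eventually_elim simp
  show i: "integrable \<mu> g"
    by (rule integrableI_nonneg[OF _ g0]) (use le in \<open>auto intro: le_less_trans\<close>)
  show "(\<integral>x. g x \<partial>\<mu>) \<le> (\<integral>x. h x \<partial>\<mu>)"
  proof -
    have "0 \<le> (\<integral>x. h x \<partial>\<mu>)" by (rule integral_nonneg_AE[OF AE_I2]) (rule h(2))
    then show ?thesis using le nn_integral_eq_integral[OF i g0] by simp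
  qed
qed

definition max_integral :: "'t set \<Rightarrow> real" where
  "max_integral A = (\<integral>x. Max ((\<lambda>t. kernel_pow t x) ` A) \<partial>\<mu>)"

lemma Max_kernel_pow_integrable: "finite A \<Longrightarrow> A \<noteq> {} \<Longrightarrow> integrable \<mu> (\<lambda>x. Max ((\<lambda>t. kernel_pow t x) ` A))"
  by (intro integrable_Max) auto

lemma Max_kernel_pow_nonneg: "finite A \<Longrightarrow> A \<noteq> {} \<Longrightarrow> 0 \<le> Max ((\<lambda>t. kernel_pow t x) ` A)"
  by (auto simp: Max_ge_iff)

lemma max_integral_nonneg: "finite A \<Longrightarrow> A \<noteq> {} \<Longrightarrow> 0 \<le> max_integral A"
  unfolding max_integral_def by (intro integral_nonneg_AE AE_I2 Max_kernel_pow_nonneg)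

lemma max_integral_translate_le:
  assumes A: "finite A" "A \<noteq> {}"
  shows "max_integral ((\<lambda>t. t + u) ` A) \<le> max_integral A"
  unfolding max_integral_def
proof (rule integral_shift_le(2)[where u=u])
  note [measurable] = borel_measurable_integrable[OF Max_kernel_pow_integrable]
  show "AE x in \<mu>. 0 \<le> Max ((\<lambda>t. kernel_pow t x) ` (\<lambda>t. t + u) ` A) \<and> Max ((\<lambda>t. kernel_pow t x) ` (\<lambda>t. t + u) ` A) \<le> Max ((\<lambda>t. kernel_pow t (\<phi> u x)) ` A) * enn2real (rn u x)"
    using kernel_pow_cocycle
  proof eventually_elim
    fix x assume co: "\<forall>t u. kernel_pow (t + u) x = kernel_pow t (\<phi> u x) * enn2real (rn u x)"
    have "Max ((\<lambda>t. kernel_pow t x) ` (\<lambda>t. t + u) ` A) \<le> Max ((\<lambda>t. kernel_pow t (\<phi> u x)) ` A) * enn2real (rn u x)"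
    proof (subst Max_le_iff, use A in simp, use A in simp, safe)
      fix t assume t: "t \<in> A"
      have "kernel_pow t (\<phi> u x) \<le> Max ((\<lambda>t. kernel_pow t (\<phi> u x)) ` A)" using A t by (intro Max_ge) auto
      then show "kernel_pow (t + u) x \<le> Max ((\<lambda>t. kernel_pow t (\<phi> u x)) ` A) * enn2real (rn u x)"
        by (simp add: co mult_right_mono)
    qed
    then show "0 \<le> Max ((\<lambda>t. kernel_pow t x) ` (\<lambda>t. t + u) ` A) \<and> Max ((\<lambda>t. kernel_pow t x) ` (\<lambda>t. t + u) ` A) \<le> Max ((\<lambda>t. kernel_pow t (\<phi> u x)) ` A) * enn2real (rn u x)"
      using A by (auto intro!: Max_kernel_pow_nonneg)
  qed
qed (use A Max_kernel_pow_integrable[OF A] Max_kernel_pow_integrable[of "(\<lambda>t. t + u) ` A"] in \<open>auto intro: Max_kernel_pow_nonneg borel_measurable_integrable\<close>)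

lemma max_integral_UN_le:
  assumes I: "finite I" "I \<noteq> {}" and A: "\<And>i. i \<in> I \<Longrightarrow> finite (A i) \<and> A i \<noteq> {}" and B: "B \<subseteq> (\<Union>i\<in>I. A i)" "B \<noteq> {}"
  shows "max_integral B \<le> (\<Sum>i\<in>I. max_integral (A i))"
proof -
  have fB: "finite B" using B I A by (meson finite_UN finite_subset)
  have "max_integral B \<le> (\<integral>x. (\<Sum>i\<in>I. Max ((\<lambda>t. kernel_pow t x) ` A i)) \<partial>\<mu>)"
    unfolding max_integral_def
  proof (rule integral_mono)
    fix x
    show "Max ((\<lambda>t. kernel_pow t x) ` B) \<le> (\<Sum>i\<in>I. Max ((\<lambda>t. kernel_pow t x) ` A i))"
    proof (subst Max_le_iff, use fB in simp, use B in simp, safe)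
      fix t assume "t \<in> B"
      then obtain i where i: "i \<in> I" "t \<in> A i" using B by auto
      have "kernel_pow t x \<le> Max ((\<lambda>t. kernel_pow t x) ` A i)" using A i by (intro Max_ge) auto
      also have "\<dots> \<le> (\<Sum>i\<in>I. Max ((\<lambda>t. kernel_pow t x) ` A i))"
        using I i A by (intro member_le_sum) (auto intro!: Max_kernel_pow_nonneg)
      finally show "kernel_pow t x \<le> (\<Sum>i\<in>I. Max ((\<lambda>t. kernel_pow t x) ` A i))" .
    qed
  qed (use A fB B in \<open>auto intro!: Max_kernel_pow_integrable\<close>)
  also have "\<dots> = (\<Sum>i\<in>I. max_integral (A i))"
    unfolding max_integral_def using A by (intro Bochner_Integration.integral_sum Max_kernel_pow_integrable) auto
  finally show ?thesis .
qed

lemma max_integral_singleton_le: "(\<integral>x. kernel_pow t x \<partial>\<mu>) \<le> (\<integral>x. kernel_pow 0 x \<partial>\<mu>)"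
  using max_integral_translate_le[of "{0}" t] by (simp add: max_integral_def)

end

section \<open>Cubes of the lattice and subadditivity\<close>

lemma mem_cube: "t \<in> cube n \<longleftrightarrow> (\<forall>i. 0 \<le> t $ i \<and> t $ i < int n)"
  by (auto simp: cube_def less_eq_vec_def)

lemma cube_eq_image: "(cube n :: (int ^ 'd) set) = vec_lambda ` (PiE UNIV (\<lambda>_. {0..<int n}))"
proof (intro set_eqI iffI)
  fix t :: "int ^ 'd" assume "t \<in> cube n"
  then show "t \<in> vec_lambda ` (PiE UNIV (\<lambda>_. {0..<int n}))"
    by (intro image_eqI[of _ _ "vec_nth t"]) (auto simp: mem_cube)
qed (auto simp: mem_cube PiE_def Pi_def)

lemma finite_cube[simp]: "finite (cube n :: (int ^ 'd) set)"
  unfolding cube_eq_image by (intro finite_imageI finite_PiE) auto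

lemma card_cube: "card (cube n :: (int ^ 'd) set) = n ^ CARD('d)"
proof -
  have "inj_on vec_lambda (PiE UNIV (\<lambda>_::'d. {0..<int n}))"
    by (rule inj_onI) (metis vec_lambda_inverse UNIV_I)
  then show ?thesis unfolding cube_eq_image by (subst card_image) (auto simp: card_PiE)
qed

lemma zero_in_cube: "n \<ge> 1 \<Longrightarrow> 0 \<in> cube n"
  by (simp add: mem_cube)

lemma cube_nonempty: "n \<ge> 1 \<Longrightarrow> cube n \<noteq> {}"
  using zero_in_cube by blast

lemma cube_covered:
  assumes "n \<ge> 1"
  shows "cube m \<subseteq> (\<Union>k\<in>cube (m div n + 1). (\<lambda>t. t + int n *s k) ` cube n)"
proof
  fix t :: "int ^ 'd" assume t: "t \<in> cube m"
  define k where "k = (\<chi> i. t $ i div int n)"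
  define r where "r = (\<chi> i. t $ i mod int n)"
  have "t = r + int n *s k" by (simp add: vec_eq_iff k_def r_def)
  moreover have "r \<in> cube n" using assms by (simp add: mem_cube r_def)
  moreover have "k \<in> cube (m div n + 1)"
  proof -
    have "t $ i div int n \<le> int (m div n)" for i
      using t zdiv_mono1[of "t $ i" "int m" "int n"] assms by (simp add: mem_cube zdiv_int less_imp_le)
    moreover have "0 \<le> t $ i div int n" for i using t assms by (simp add: mem_cube pos_imp_zdiv_nonneg_iff)
    ultimately show ?thesis by (simp add: mem_cube k_def) (smt (verit))
  qed
  ultimately show "t \<in> (\<Union>k\<in>cube (m div n + 1). (\<lambda>t. t + int n *s k) ` cube n)" by blast
qed

text \<open>
  Fekete's argument: \<open>a m / m\<^sup>d\<close> is eventually below \<open>a n / n\<^sup>d + \<epsilon>\<close> for each \<open>n\<close>, so the infimum of these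
  quotients is their limit.
\<close>

lemma subadditive_cube_limit:
  fixes a :: "nat \<Rightarrow> real" and d :: nat
  assumes nonneg: "\<And>n. n \<ge> 1 \<Longrightarrow> 0 \<le> a n" and sub: "\<And>m n. n \<ge> 1 \<Longrightarrow> m \<ge> 1 \<Longrightarrow> a m \<le> real (m div n + 1) ^ d * a n"
  obtains l where "l \<ge> 0" "(\<lambda>n. a n / real (n ^ d)) \<longlonglongrightarrow> l"
proof -
  define r where "r n = a n / real (n ^ d)" for n
  define l where "l = Inf (r ` {1..})"
  have r0: "0 \<le> r n" if "n \<ge> 1" for n using nonneg[OF that] by (simp add: r_def)
  have bdd: "bdd_below (r ` {1..})" using r0 by (intro bdd_belowI[of _ 0]) auto
  have l_le: "l \<le> r n" if "n \<ge> 1" for n unfolding l_def using bdd that by (intro cInf_lower) auto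
  have l0: "0 \<le> l" unfolding l_def using r0 by (intro cInf_greatest) auto
  have "r \<longlonglongrightarrow> l"
  proof (rule tendstoI)
    fix e :: real assume e: "e > 0"
    have "Inf (r ` {1..}) < l + e" using e by (simp add: l_def)
    then obtain n where n: "n \<ge> 1" "r n < l + e"
      by (subst (asm) cInf_less_iff) (use bdd in auto)
    have "(\<lambda>m. (1 + real n / real m) ^ d * r n) \<longlonglongrightarrow> (1 + 0) ^ d * r n"
      by (intro tendsto_intros real_tendsto_divide_at_top filterlim_real_sequentially)
    then have "\<forall>\<^sub>F m in sequentially. (1 + real n / real m) ^ d * r n < l + e"
      by (rule order_tendstoD(2)) (use n in simp)
    with eventually_ge_at_top[of 1] show "\<forall>\<^sub>F m in sequentially. dist (r m) l < e"
    proof eventually_elim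
      fix m :: nat assume m: "1 \<le> m" "(1 + real n / real m) ^ d * r n < l + e"
      have "r m \<le> real (m div n + 1) ^ d * a n / real (m ^ d)"
        unfolding r_def using sub[OF n(1) m(1)] by (intro divide_right_mono) auto
      also have "\<dots> = (real (m div n + 1) * real n / real m) ^ d * r n"
        using n m by (simp add: r_def power_divide power_mult_distrib)
      also have "\<dots> \<le> (1 + real n / real m) ^ d * r n"
      proof (intro mult_right_mono power_mono r0 n)
        have "real (m div n) * real n \<le> real m"
          by (simp add: of_nat_mult[symmetric] del: of_nat_mult)
        then show "real (m div n + 1) * real n / real m \<le> 1 + real n / real m"
          using m by (simp add: field_simps)
      qed simp
      finally show "dist (r m) l < e" using m l_le[OF m(1)] by (simp add: dist_real_def)
    qed
  qed
  then show ?thesis using that[OF l0] by (simp add: r_def[abs_def])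
qed

text \<open>
  The positive cone of a translation invariant total order of the lattice: the lexicographic order in which \<open>e\<close>
  ranks the coordinates. It serves to break ties between points at which a maximum is attained.
\<close>

definition lex_positive :: "('d \<Rightarrow> nat) \<Rightarrow> int ^ 'd \<Rightarrow> bool" where
  "lex_positive e u \<longleftrightarrow> (\<exists>i. 0 < u $ i \<and> (\<forall>j. e j < e i \<longrightarrow> u $ j = 0))"

lemma lex_positive_total:
  fixes u :: "int ^ 'd"
  assumes "u \<noteq> 0" shows "lex_positive e u \<or> lex_positive e (- u)"
proof -
  have "\<exists>i. u $ i \<noteq> 0" using assms by (auto simp: vec_eq_iff)
  then obtain i where i: "u $ i \<noteq> 0" "\<And>j. u $ j \<noteq> 0 \<Longrightarrow> e i \<le> e j"
    using ex_has_least_nat[of "\<lambda>i. u $ i \<noteq> 0" _ e] by blast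
  have "\<forall>j. e j < e i \<longrightarrow> u $ j = 0" using i(2) by (meson not_less)
  then show ?thesis using i(1) unfolding lex_positive_def by (cases "u $ i > 0") (auto intro!: exI[of _ i])
qed

lemma lex_positive_add:
  assumes e: "inj e" and u: "lex_positive e u" "lex_positive e v" shows "lex_positive e (u + v)"
proof -
  obtain i where i: "0 < u $ i" "\<forall>j. e j < e i \<longrightarrow> u $ j = 0" using u(1) by (auto simp: lex_positive_def)
  obtain k where k: "0 < v $ k" "\<forall>j. e j < e k \<longrightarrow> v $ j = 0" using u(2) by (auto simp: lex_positive_def)
  consider "e i < e k" | "e k < e i" | "i = k" using e by (metis injD nat_neq_iff)
  then show ?thesis
  proof cases
    case 1 then show ?thesis unfolding lex_positive_def using i k by (intro exI[of _ i]) auto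
  next
    case 2 then show ?thesis unfolding lex_positive_def using i k by (intro exI[of _ k]) auto
  next
    case 3 then show ?thesis unfolding lex_positive_def using i k by (intro exI[of _ i]) auto
  qed
qed

lemma lex_maximal_exists:
  assumes e: "inj e" and S: "finite S" "S \<noteq> {}"
  shows "\<exists>t\<in>S. \<forall>t'\<in>S. \<not> lex_positive e (t' - t)"
  using S
proof (induction S rule: finite_ne_induct)
  case (singleton x)
  then show ?case by (simp add: lex_positive_def)
next
  case (insert y S)
  then obtain t where t: "t \<in> S" "\<forall>t'\<in>S. \<not> lex_positive e (t' - t)" by blast
  have z: "\<not> lex_positive e 0" by (simp add: lex_positive_def)
  show ?case
  proof (cases "lex_positive e (y - t)")
    case True
    have "\<not> lex_positive e (t' - y)" if "t' \<in> S" for t'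
    proof
      assume "lex_positive e (t' - y)"
      from lex_positive_add[OF e this True] t that show False by simp
    qed
    then show ?thesis using z by auto
  next
    case False
    then show ?thesis using t by auto
  qed
qed

section \<open>Last maxima and conservative flows\<close>

locale lattice_kernel = flow_kernel \<mu> \<phi> \<alpha> c f
  for \<mu> :: "'s measure" and \<phi> :: "int ^ 'd \<Rightarrow> 's \<Rightarrow> 's" and \<alpha> c f
begin

lemma max_integral_cube_subadditive:
  assumes "n \<ge> 1" "m \<ge> 1"
  shows "max_integral (cube m) \<le> real (m div n + 1) ^ CARD('d) * max_integral (cube n)"
proof -
  have "max_integral (cube m) \<le> (\<Sum>k\<in>cube (m div n + 1). max_integral ((\<lambda>t. t + int n *s k) ` cube n))"
    by (rule max_integral_UN_le[OF _ _ _ cube_covered[OF assms(1)]]) (use assms cube_nonempty in auto)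
  also have "\<dots> \<le> (\<Sum>k\<in>(cube (m div n + 1) :: (int ^ 'd) set). max_integral (cube n))"
    by (intro sum_mono max_integral_translate_le finite_cube cube_nonempty assms)
  finally show ?thesis by (simp add: card_cube)
qed

lemma max_integral_cube_limit:
  obtains l where "l \<ge> 0" "(\<lambda>n. max_integral (cube n) / real (n ^ CARD('d))) \<longlonglongrightarrow> l"
proof (rule subadditive_cube_limit[of "\<lambda>n. max_integral (cube n)" "CARD('d)"])
  show "0 \<le> max_integral (cube n)" if "n \<ge> 1" for n
    by (rule max_integral_nonneg[OF finite_cube cube_nonempty[OF that]])
qed (use max_integral_cube_subadditive that in auto)

text \<open>
  If \<open>t\<close> dominates every \<open>u\<close> in a set containing \<open>t\<close>, then \<open>t\<close> is the lexicographically last point of the set at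
  which the maximum is attained.
\<close>

definition dominates :: "('d \<Rightarrow> nat) \<Rightarrow> int ^ 'd \<Rightarrow> int ^ 'd \<Rightarrow> 's \<Rightarrow> bool" where
  "dominates e t u x \<longleftrightarrow> kernel_pow u x \<le> kernel_pow t x \<and> (lex_positive e (u - t) \<longrightarrow> kernel_pow u x < kernel_pow t x)"

lemma dominates_sets[measurable]: "{x \<in> space \<mu>. dominates e t u x} \<in> sets \<mu>"
  unfolding dominates_def by measurable

definition box :: "nat \<Rightarrow> (int ^ 'd) set" where
  "box k = {v. \<forall>i. \<bar>v $ i\<bar> \<le> int k}"

definition peak :: "('d \<Rightarrow> nat) \<Rightarrow> (int ^ 'd) set \<Rightarrow> 's set" where
  "peak e A = {x \<in> space \<mu>. \<forall>v\<in>A. dominates e 0 v x}"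

lemma peak_sets[measurable]: "peak e A \<in> sets \<mu>"
  unfolding peak_def by (intro sets.sets_Collect_countable_Ball dominates_sets)

text \<open>
  The maximum is attained at the lexicographically last maximal point, so one of the summands equals it.
\<close>

lemma Max_le_sum_last_maximum:
  assumes e: "inj e" and A: "finite A" "A \<noteq> {}" and x: "x \<in> space \<mu>"
  shows "Max ((\<lambda>t. kernel_pow t x) ` A) \<le> (\<Sum>t\<in>A. kernel_pow t x * indicator {x \<in> space \<mu>. \<forall>u\<in>A. dominates e t u x} x)"
proof -
  define M where "M = Max ((\<lambda>t. kernel_pow t x) ` A)"
  have "M \<in> (\<lambda>t. kernel_pow t x) ` A" unfolding M_def using A by (intro Max_in) auto
  then have "{t \<in> A. kernel_pow t x = M} \<noteq> {}" by auto
  with lex_maximal_exists[OF e, of "{t \<in> A. kernel_pow t x = M}"] A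
  obtain t where t: "t \<in> A" "kernel_pow t x = M" "\<And>u. u \<in> A \<Longrightarrow> kernel_pow u x = M \<Longrightarrow> \<not> lex_positive e (u - t)" by auto
  have le: "kernel_pow u x \<le> M" if "u \<in> A" for u unfolding M_def using A that by (intro Max_ge) auto
  have "dominates e t u x" if "u \<in> A" for u
    using le[OF that] t(2) t(3)[OF that] by (auto simp: dominates_def less_le)
  then have "M = kernel_pow t x * indicator {x \<in> space \<mu>. \<forall>u\<in>A. dominates e t u x} x"
    using x t(2) by (simp add: indicator_def)
  also have "\<dots> \<le> (\<Sum>t\<in>A. kernel_pow t x * indicator {x \<in> space \<mu>. \<forall>u\<in>A. dominates e t u x} x)"
    using A t(1) by (intro member_le_sum[of t A "\<lambda>t. kernel_pow t x * indicator {x \<in> space \<mu>. \<forall>u\<in>A. dominates e t u x} x"]) auto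
  finally show ?thesis by (simp add: M_def)
qed

text \<open>
  By the cocycle identity \<open>kernel_pow (v + t) x\<close> is \<open>kernel_pow v (\<phi> t x)\<close> times a factor that does not depend on
  \<open>v\<close>. Where this factor is positive, \<open>t\<close> dominates \<open>A\<close> at \<open>x\<close> only if \<open>0\<close> dominates the translate of \<open>A\<close> by \<open>- t\<close>, and
  with it \<open>B\<close>, at \<open>\<phi> t x\<close>. Where it is \<open>0\<close>, the integrand vanishes.
\<close>

lemma last_maximum_integral_le:
  assumes A: "finite A" and B: "\<And>v. v \<in> B \<Longrightarrow> v + t \<in> A"
  shows "(\<integral>x. kernel_pow t x * indicator {x \<in> space \<mu>. \<forall>u\<in>A. dominates e t u x} x \<partial>\<mu>) \<le> (\<integral>x. kernel_pow 0 x * indicator (peak e B) x \<partial>\<mu>)"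
proof (rule integral_shift_le(2)[where u=t])
  have [measurable]: "{x \<in> space \<mu>. \<forall>u\<in>A. dominates e t u x} \<in> sets \<mu>"
    by (intro sets.sets_Collect_countable_Ball dominates_sets)
  show "(\<lambda>x. kernel_pow t x * indicator {x \<in> space \<mu>. \<forall>u\<in>A. dominates e t u x} x) \<in> borel_measurable \<mu>" by measurable
  show "(\<lambda>x. kernel_pow 0 x * indicator (peak e B) x) \<in> borel_measurable \<mu>" by measurable
  show "integrable \<mu> (\<lambda>x. kernel_pow 0 x * indicator (peak e B) x)"
    by (rule integrable_real_mult_indicator) auto
  show "AE x in \<mu>. 0 \<le> kernel_pow t x * indicator {x \<in> space \<mu>. \<forall>u\<in>A. dominates e t u x} x \<and>
      kernel_pow t x * indicator {x \<in> space \<mu>. \<forall>u\<in>A. dominates e t u x} x \<le> kernel_pow 0 (\<phi> t x) * indicator (peak e B) (\<phi> t x) * enn2real (rn t x)"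
    using kernel_pow_cocycle AE_space
  proof eventually_elim
    fix x assume co: "\<forall>t u. kernel_pow (t + u) x = kernel_pow t (\<phi> u x) * enn2real (rn u x)" and x: "x \<in> space \<mu>"
    have G0: "kernel_pow t x = kernel_pow 0 (\<phi> t x) * enn2real (rn t x)" using co[rule_format, of 0 t] by simp
    have "\<phi> t x \<in> peak e B" if d: "\<forall>u\<in>A. dominates e t u x" and \<rho>: "enn2real (rn t x) > 0"
    proof -
      have "dominates e 0 v (\<phi> t x)" if v: "v \<in> B" for v
      proof -
        have "dominates e t (v + t) x" using d B[OF v] by blast
        then show ?thesis using \<rho> unfolding dominates_def co[rule_format, of v t] G0 by auto
      qed
      then show ?thesis using phi_space[OF x] by (simp add: peak_def)
    qed
    then show "0 \<le> kernel_pow t x * indicator {x \<in> space \<mu>. \<forall>u\<in>A. dominates e t u x} x \<and>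
      kernel_pow t x * indicator {x \<in> space \<mu>. \<forall>u\<in>A. dominates e t u x} x \<le> kernel_pow 0 (\<phi> t x) * indicator (peak e B) (\<phi> t x) * enn2real (rn t x)"
      using x G0 enn2real_nonneg[of "rn t x"] by (cases "enn2real (rn t x) = 0") (auto simp: indicator_def)
  qed
qed auto

definition inner_cube :: "nat \<Rightarrow> nat \<Rightarrow> (int ^ 'd) set" where
  "inner_cube m k = (\<lambda>t. t + int k *s 1) ` cube (m - 2 * k)"

lemma inner_cube_box: "t \<in> inner_cube m k \<Longrightarrow> v \<in> box k \<Longrightarrow> v + t \<in> cube m"
proof -
  assume t: "t \<in> inner_cube m k" and v: "v \<in> box k"
  from t obtain r where r: "r \<in> cube (m - 2 * k)" "t = r + int k *s 1" by (auto simp: inner_cube_def)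
  show ?thesis unfolding mem_cube
  proof
    fix i
    have "0 \<le> r $ i" "r $ i < int (m - 2 * k)" using r by (auto simp: mem_cube)
    moreover have "\<bar>v $ i\<bar> \<le> int k" using v by (auto simp: box_def)
    ultimately show "0 \<le> (v + t) $ i \<and> (v + t) $ i < int m" using r(2) by (simp; linarith)
  qed
qed

lemma zero_in_box: "0 \<in> box k" by (simp add: box_def)

lemma inner_cube_subset: "inner_cube m k \<subseteq> cube m"
  using inner_cube_box[OF _ zero_in_box] by fastforce

lemma card_inner_cube: "card (inner_cube m k) = (m - 2 * k) ^ CARD('d)"
  unfolding inner_cube_def by (subst card_image) (auto simp: inj_on_def card_cube)

text \<open>
  The points at distance at least \<open>k\<close> from the boundary are compared with the box of radius \<open>k\<close>; all the others
  contribute at most \<open>\<integral> kernel_pow 0 d\<mu>\<close> each, and they are of lower order than the cube.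
\<close>

lemma max_integral_cube_le_peak:
  assumes e: "inj e" and m: "m \<ge> 1"
  shows "max_integral (cube m) \<le> real ((m - 2 * k) ^ CARD('d)) * (\<integral>x. kernel_pow 0 x * indicator (peak e (box k)) x \<partial>\<mu>)
     + (real (m ^ CARD('d)) - real ((m - 2 * k) ^ CARD('d))) * (\<integral>x. kernel_pow 0 x \<partial>\<mu>)"
proof -
  let ?F = "\<lambda>t. {x \<in> space \<mu>. \<forall>u\<in>cube m. dominates e t u x}"
  let ?w = "\<integral>x. kernel_pow 0 x * indicator (peak e (box k)) x \<partial>\<mu>"
  have [measurable]: "?F t \<in> sets \<mu>" for t
    by (intro sets.sets_Collect_countable_Ball dominates_sets)
  have int: "integrable \<mu> (\<lambda>x. kernel_pow t x * indicator (?F t) x)" for t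
    by (rule integrable_real_mult_indicator) auto
  have "max_integral (cube m) \<le> (\<integral>x. (\<Sum>t\<in>cube m. kernel_pow t x * indicator (?F t) x) \<partial>\<mu>)"
    unfolding max_integral_def using m
    by (intro integral_mono Max_kernel_pow_integrable Max_le_sum_last_maximum e Bochner_Integration.integrable_sum int finite_cube cube_nonempty) auto
  also have "\<dots> = (\<Sum>t\<in>cube m. \<integral>x. kernel_pow t x * indicator (?F t) x \<partial>\<mu>)"
    by (intro Bochner_Integration.integral_sum int)
  also have "\<dots> = (\<Sum>t\<in>inner_cube m k. \<integral>x. kernel_pow t x * indicator (?F t) x \<partial>\<mu>) + (\<Sum>t\<in>cube m - inner_cube m k. \<integral>x. kernel_pow t x * indicator (?F t) x \<partial>\<mu>)"
    using sum.subset_diff[OF inner_cube_subset finite_cube] by (simp add: add.commute)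
  also have "\<dots> \<le> (\<Sum>t\<in>inner_cube m k. ?w) + (\<Sum>t\<in>cube m - inner_cube m k. \<integral>x. kernel_pow 0 x \<partial>\<mu>)"
  proof (intro add_mono sum_mono)
    show "(\<integral>x. kernel_pow t x * indicator (?F t) x \<partial>\<mu>) \<le> ?w" if "t \<in> inner_cube m k" for t
      by (rule last_maximum_integral_le) (use inner_cube_box[OF that] in auto)
    show "(\<integral>x. kernel_pow t x * indicator (?F t) x \<partial>\<mu>) \<le> (\<integral>x. kernel_pow 0 x \<partial>\<mu>)" for t
    proof -
      have "(\<integral>x. kernel_pow t x * indicator (?F t) x \<partial>\<mu>) \<le> (\<integral>x. kernel_pow t x \<partial>\<mu>)"
        by (intro integral_mono int) (auto simp: indicator_def)
      also have "\<dots> \<le> (\<integral>x. kernel_pow 0 x \<partial>\<mu>)" by (rule max_integral_singleton_le)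
      finally show ?thesis .
    qed
  qed
  also have "real (card (cube m - inner_cube m k)) = real (m ^ CARD('d)) - real ((m - 2 * k) ^ CARD('d))"
    using card_mono[OF finite_cube inner_cube_subset[of m k]] finite_subset[OF inner_cube_subset finite_cube, of m k]
    by (subst card_Diff_subset) (auto simp: inner_cube_subset card_inner_cube card_cube of_nat_diff)
  then have "(\<Sum>t\<in>inner_cube m k. ?w) + (\<Sum>t\<in>cube m - inner_cube m k. \<integral>x. kernel_pow 0 x \<partial>\<mu>)
     = real ((m - 2 * k) ^ CARD('d)) * ?w + (real (m ^ CARD('d)) - real ((m - 2 * k) ^ CARD('d))) * (\<integral>x. kernel_pow 0 x \<partial>\<mu>)"
    by (simp add: card_inner_cube)
  finally show ?thesis .
qed

lemma limit_le_peak: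
  assumes e: "inj e" and l: "(\<lambda>n. max_integral (cube n) / real (n ^ CARD('d))) \<longlonglongrightarrow> l"
  shows "l \<le> (\<integral>x. kernel_pow 0 x * indicator (peak e (box k)) x \<partial>\<mu>)"
proof -
  let ?w = "\<integral>x. kernel_pow 0 x * indicator (peak e (box k)) x \<partial>\<mu>" and ?s = "\<integral>x. kernel_pow 0 x \<partial>\<mu>"
  have q: "(\<lambda>m. (real (m - 2 * k) / real m) ^ CARD('d)) \<longlonglongrightarrow> 1 ^ CARD('d)"
  proof (rule tendsto_power)
    have "(\<lambda>m. 1 - real (2 * k) / real m) \<longlonglongrightarrow> 1 - 0"
      by (rule tendsto_diff[OF tendsto_const real_tendsto_divide_at_top[OF tendsto_const filterlim_real_sequentially]])
    then have "(\<lambda>m. 1 - real (2 * k) / real m) \<longlonglongrightarrow> 1" by simp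
    then show "(\<lambda>m. real (m - 2 * k) / real m) \<longlonglongrightarrow> 1"
    proof (rule Lim_transform_eventually)
      show "\<forall>\<^sub>F m in sequentially. 1 - real (2 * k) / real m = real (m - 2 * k) / real m"
        using eventually_ge_at_top[of "2 * k + 1"]
        by eventually_elim (simp add: of_nat_diff diff_divide_distrib)
    qed
  qed
  have lim: "(\<lambda>m. (real (m - 2 * k) / real m) ^ CARD('d) * ?w + (1 - (real (m - 2 * k) / real m) ^ CARD('d)) * ?s) \<longlonglongrightarrow> 1 ^ CARD('d) * ?w + (1 - 1 ^ CARD('d)) * ?s"
    by (intro tendsto_intros q)
  have "l \<le> 1 ^ CARD('d) * ?w + (1 - 1 ^ CARD('d)) * ?s"
  proof (rule tendsto_le[OF _ lim l])
    show "\<forall>\<^sub>F m in sequentially. max_integral (cube m) / real (m ^ CARD('d)) \<le> (real (m - 2 * k) / real m) ^ CARD('d) * ?w + (1 - (real (m - 2 * k) / real m) ^ CARD('d)) * ?s"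
      using eventually_ge_at_top[of 1]
    proof eventually_elim
      fix m :: nat assume m: "1 \<le> m"
      have "max_integral (cube m) / real (m ^ CARD('d)) \<le> (real ((m - 2 * k) ^ CARD('d)) * ?w
         + (real (m ^ CARD('d)) - real ((m - 2 * k) ^ CARD('d))) * ?s) / real (m ^ CARD('d))"
        by (intro divide_right_mono max_integral_cube_le_peak e m) simp
      also have "\<dots> = (real (m - 2 * k) / real m) ^ CARD('d) * ?w + (1 - (real (m - 2 * k) / real m) ^ CARD('d)) * ?s"
        using m by (simp add: power_divide field_simps)
      finally show "max_integral (cube m) / real (m ^ CARD('d)) \<le> (real (m - 2 * k) / real m) ^ CARD('d) * ?w + (1 - (real (m - 2 * k) / real m) ^ CARD('d)) * ?s" .
    qed
  qed simp
  then show ?thesis by simp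
qed

lemma UN_box: "(\<Union>k. box k) = UNIV"
proof -
  have "v \<in> box (nat (\<Sum>i\<in>UNIV. \<bar>v $ i\<bar>))" for v :: "int ^ 'd"
    unfolding box_def by (auto simp: sum_nonneg intro!: member_le_sum)
  then show ?thesis by blast
qed

lemma box_mono: "k \<le> k' \<Longrightarrow> box k \<subseteq> box k'"
  by (auto simp: box_def intro: order_trans)

lemma limit_le_peak_UNIV:
  assumes e: "inj e" and l: "(\<lambda>n. max_integral (cube n) / real (n ^ CARD('d))) \<longlonglongrightarrow> l"
  shows "l \<le> (\<integral>x. kernel_pow 0 x * indicator (peak e UNIV) x \<partial>\<mu>)"
proof -
  have "(\<lambda>k. \<integral>x. kernel_pow 0 x * indicator (peak e (box k)) x \<partial>\<mu>) \<longlonglongrightarrow> (\<integral>x. kernel_pow 0 x * indicator (peak e UNIV) x \<partial>\<mu>)"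
  proof (rule integral_dominated_convergence[where w="kernel_pow 0"])
    show "AE x in \<mu>. (\<lambda>k. kernel_pow 0 x * indicator (peak e (box k)) x) \<longlonglongrightarrow> kernel_pow 0 x * indicator (peak e UNIV) x"
    proof (intro AE_I2 tendsto_mult tendsto_const)
      fix x assume x: "x \<in> space \<mu>"
      show "(\<lambda>k. indicator (peak e (box k)) x :: real) \<longlonglongrightarrow> indicator (peak e UNIV) x"
      proof (cases "x \<in> peak e UNIV")
        case True
        then have "x \<in> peak e (box k)" for k by (simp add: peak_def)
        then show ?thesis using True by (simp add: indicator_def)
      next
        case False
        then obtain v where v: "\<not> dominates e 0 v x" using x by (auto simp: peak_def)
        obtain k where k: "v \<in> box k" using UN_box by blast
        have "\<forall>\<^sub>F k' in sequentially. indicator (peak e (box k')) x = (0 :: real)"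
          using eventually_ge_at_top[of k]
          by eventually_elim (use v k box_mono in \<open>auto simp: peak_def indicator_def\<close>)
        then have "(\<lambda>k. indicator (peak e (box k)) x :: real) \<longlonglongrightarrow> 0" by (rule tendsto_eventually)
        then show ?thesis using False by simp
      qed
    qed
    show "AE x in \<mu>. norm (kernel_pow 0 x * indicator (peak e (box k)) x) \<le> kernel_pow 0 x" for k
      by (intro AE_I2) (auto simp: indicator_def)
  qed auto
  then show ?thesis by (rule LIMSEQ_le_const) (use limit_le_peak[OF e l] in auto)
qed

text \<open>
  If \<open>x\<close> and \<open>\<phi> u x\<close> are both peaks, then \<open>0\<close> and \<open>u\<close> are both the last maximum along the orbit of \<open>x\<close>, which forces
  \<open>u = 0\<close>. So the peaks form a wandering set, up to the null set where the cocycle identity fails.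
\<close>

lemma peak_null_if_conservative:
  assumes e: "inj e" and cons: "conservative_action \<mu> \<phi>"
  shows "emeasure \<mu> (peak e UNIV) = 0"
proof -
  obtain C D where hopf: "hopf_decomposition \<mu> \<phi> C D" and D: "D \<in> null_sets \<mu>"
    using cons by (auto simp: conservative_action_def)
  obtain X where X: "X \<in> null_sets \<mu>" "{x \<in> space \<mu>. \<not> (\<forall>t u. kernel_pow (t + u) x = kernel_pow t (\<phi> u x) * enn2real (rn u x))} \<subseteq> X"
    using kernel_pow_cocycle by (auto simp: eventually_ae_filter)
  have XC: "X \<in> sets \<mu>" "C \<in> sets \<mu>" "D \<in> sets \<mu>" "C \<union> D = space \<mu>" using X hopf by (auto simp: hopf_decomposition_def)
  define W where "W = (peak e UNIV - X) \<inter> C"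
  have W: "W \<in> sets \<mu>" using XC by (auto simp: W_def)
  have Wsp: "x \<in> W \<Longrightarrow> x \<in> space \<mu>" for x by (auto simp: W_def peak_def)
  \<comment> \<open>At \<open>x\<close> the value at \<open>u\<close> is below that at \<open>0\<close>; at \<open>\<phi> u x\<close> the value at \<open>- u\<close> is not above that at \<open>0\<close>. By the
    cocycle identity these are the same two values up to a common factor.\<close>
  have no_lex: False if x: "x \<in> W" "\<phi> u x \<in> W" and u: "lex_positive e u" for x u
  proof -
    have co: "kernel_pow (t + u) x = kernel_pow t (\<phi> u x) * enn2real (rn u x)" for t u
      using x(1) X(2) Wsp[OF x(1)] by (auto simp: W_def)
    have "kernel_pow u x < kernel_pow 0 x" using x(1) u by (auto simp: W_def peak_def dominates_def)
    moreover have "kernel_pow (- u) (\<phi> u x) \<le> kernel_pow 0 (\<phi> u x)" using x(2) by (auto simp: W_def peak_def dominates_def)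
    then have "kernel_pow (- u) (\<phi> u x) * enn2real (rn u x) \<le> kernel_pow 0 (\<phi> u x) * enn2real (rn u x)" by (intro mult_right_mono) auto
    then have "kernel_pow 0 x \<le> kernel_pow u x" using co[of "- u" u] co[of 0 u] by simp
    ultimately show False by simp
  qed
  have no_return: "u = 0" if x: "x \<in> W" "\<phi> u x \<in> W" for x u
  proof (rule ccontr)
    assume "u \<noteq> 0"
    then consider "lex_positive e u" | "lex_positive e (- u)" using lex_positive_total by blast
    then show False
    proof cases
      case 1 then show False using no_lex x by blast
    next
      case 2
      \<comment> \<open>Exchange the roles of \<open>x\<close> and \<open>\<phi> u x\<close>.\<close>
      have "\<phi> (- u) (\<phi> u x) = x" using phi_inverse(2) Wsp[OF x(1)] by simp
      then show False using no_lex[of "\<phi> u x" "- u"] x 2 by simp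
    qed
  qed
  have "wandering \<mu> \<phi> W"
    unfolding wandering_def disjoint_family_on_def
  proof (intro conjI W ballI impI)
    fix u v :: "int ^ 'd" assume uv: "u \<noteq> v"
    show "\<phi> u ` W \<inter> \<phi> v ` W = {}"
    proof (rule ccontr)
      assume "\<phi> u ` W \<inter> \<phi> v ` W \<noteq> {}"
      then obtain x y where xy: "x \<in> W" "y \<in> W" "\<phi> u x = \<phi> v y" by blast
      have "y = \<phi> (- v) (\<phi> u x)" using phi_inverse(2)[of y v] Wsp[OF xy(2)] xy(3) by simp
      then have "y = \<phi> (- v + u) x" unfolding phi_add[OF Wsp[OF xy(1)], of "- v" u] .
      then have "- v + u = 0" using no_return xy by blast
      then show False using uv by simp
    qed
  qed
  moreover have "W \<subseteq> C" by (simp add: W_def)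
  ultimately have "emeasure \<mu> W = 0" using hopf by (auto simp: hopf_decomposition_def)
  then have "W \<in> null_sets \<mu>" using W by auto
  then have "W \<union> (X \<union> D) \<in> null_sets \<mu>" using X D by auto
  moreover have "peak e UNIV \<subseteq> W \<union> (X \<union> D)"
    using XC by (auto simp: W_def peak_def)
  ultimately have "peak e UNIV \<in> null_sets \<mu>" by (rule null_sets_subset[OF _ peak_sets])
  then show ?thesis by auto
qed

lemma limit_zero_if_conservative:
  assumes cons: "conservative_action \<mu> \<phi>" and l: "(\<lambda>n. max_integral (cube n) / real (n ^ CARD('d))) \<longlonglongrightarrow> l" and l0: "l \<ge> 0"
  shows "l = 0"
proof -
  obtain e :: "'d \<Rightarrow> nat" where e: "inj e" using finite_imp_inj_to_nat_seg[of "UNIV :: 'd set"] by auto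
  have "AE x in \<mu>. x \<notin> peak e UNIV"
    using peak_null_if_conservative[OF e cons] by (intro AE_not_in) auto
  then have "(\<integral>x. kernel_pow 0 x * indicator (peak e UNIV) x \<partial>\<mu>) = (\<integral>x. 0 \<partial>\<mu>)"
    by (intro integral_cong_AE) (auto elim!: eventually_mono)
  then show ?thesis using limit_le_peak_UNIV[OF e l] l0 by simp
qed

end

section \<open>Moments of the partial maxima\<close>

text \<open>
  The event depends on the values at the points of \<open>T\<close> only, hence on the finite-dimensional distribution.
\<close>

lemma fdd_eq_prob_large:
  fixes Y :: "'t \<Rightarrow> 'a \<Rightarrow> real" and X :: "'t \<Rightarrow> 'b \<Rightarrow> real"
  assumes eq: "fdd_eq P Y Q X" and T: "finite T"
    and [measurable]: "\<And>t. Y t \<in> borel_measurable P" "\<And>t. X t \<in> borel_measurable Q"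
  shows "measure P {\<omega> \<in> space P. \<exists>t\<in>T. y < \<bar>Y t \<omega>\<bar>} = measure Q {\<omega> \<in> space Q. \<exists>t\<in>T. y < \<bar>X t \<omega>\<bar>}"
proof -
  define E where "E = {g \<in> space (PiM T (\<lambda>_. borel :: real measure)). \<exists>t\<in>T. y < \<bar>g t\<bar>}"
  have E: "E \<in> sets (PiM T (\<lambda>_. borel))"
    unfolding E_def by (intro sets.sets_Collect_finite_Ex T) measurable
  have law: "measure (fdd R Z T) E = measure R {\<omega> \<in> space R. \<exists>t\<in>T. y < \<bar>Z t \<omega>\<bar>}"
    if [measurable]: "\<And>t. Z t \<in> borel_measurable R" for R :: "'c measure" and Z :: "'t \<Rightarrow> 'c \<Rightarrow> real"
  proof -
    have m: "(\<lambda>\<omega>. \<lambda>t\<in>T. Z t \<omega>) \<in> measurable R (PiM T (\<lambda>_. borel))"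
      by (rule measurable_restrict) simp
    have "measure (fdd R Z T) E = measure R ((\<lambda>\<omega>. \<lambda>t\<in>T. Z t \<omega>) -` E \<inter> space R)"
      unfolding fdd_def by (rule measure_distr[OF m E])
    also have "(\<lambda>\<omega>. \<lambda>t\<in>T. Z t \<omega>) -` E \<inter> space R = {\<omega> \<in> space R. \<exists>t\<in>T. y < \<bar>Z t \<omega>\<bar>}"
      by (auto simp: E_def space_PiM)
    finally show ?thesis .
  qed
  have "fdd P Y T = fdd Q X T" using eq T by (simp add: fdd_eq_def)
  then show ?thesis using law[of Y P] law[of X Q] by simp
qed

text \<open>
  The tail limit and the uniform tail bound are the two hypotheses of \<open>moment_limit\<close>; the bound is the union bound
  over the \<open>V = L\<^sup>\<alpha>\<close> points of the cube.
\<close>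

theorem (in lattice_kernel) max_moment_limit:
  fixes Y :: "int ^ 'd \<Rightarrow> 'a \<Rightarrow> real" and N :: "'s set \<Rightarrow> 'b \<Rightarrow> real"
  assumes alpha2: "\<alpha> < 2" and Y: "random_field P Y"
    and rep: "integral_representation \<alpha> P Y Q \<mu> N (action_kernel \<alpha> \<mu> \<phi> c f)"
    and l0: "l \<ge> 0" and l: "(\<lambda>n. max_integral (cube n) / real (n ^ CARD('d))) \<longlonglongrightarrow> l"
    and \<beta>: "0 < \<beta>" "\<beta> < \<alpha>"
  shows "\<forall>n\<ge>1. integrable P (\<lambda>\<omega>. max_abs Y n \<omega> powr \<beta>)"
    and "(\<lambda>n. real n powr (- (real CARD('d) * \<beta> / \<alpha>)) * prob_space.expectation P (\<lambda>\<omega>. max_abs Y n \<omega> powr \<beta>))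
           \<longlonglongrightarrow> (stable_const \<alpha> * l) powr (\<beta> / \<alpha>) * (\<integral>z. z \<partial>frechet (\<alpha> / \<beta>))"
proof -
  interpret P: prob_space P using Y by (simp add: random_field_def)
  have Ym[measurable]: "Y t \<in> borel_measurable P" for t using Y by (simp add: random_field_def)
  obtain X where N: "SaS_random_measure \<alpha> Q \<mu> N" and X: "\<And>t. is_stable_integral \<alpha> Q \<mu> N (action_kernel \<alpha> \<mu> \<phi> c f t) (X t)"
    and eq: "fdd_eq P Y Q X"
    using rep by (auto simp: integral_representation_def)
  have Xm[measurable]: "X t \<in> borel_measurable Q" for t using X[of t] by (simp add: is_stable_integral_def)
  interpret Q: prob_space Q using N by (simp add: SaS_random_measure_def)
  define L where "L n = real (card (cube n :: (int ^ 'd) set)) powr (1 / \<alpha>)" for n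
  have C: "stable_const \<alpha> > 0" by (rule stable_const_pos[OF alpha alpha2])
  define s where "s = (\<integral>x. kernel_pow 0 x \<partial>\<mu>)"
  have s: "(\<integral>x. \<bar>action_kernel \<alpha> \<mu> \<phi> c f t x\<bar> powr \<alpha> \<partial>\<mu>) \<le> s" for t
    using max_integral_singleton_le[of t] by (simp add: kernel_pow_def s_def)
  have s0: "s \<ge> 0" unfolding s_def by (intro integral_nonneg_AE) simp
  obtain K where Kb: "stable_tail_bound \<alpha> K"
    using stable_law_tail_bound[OF alpha alpha2] by blast
  note K = stable_tail_boundD[OF Kb]
  have large: "{\<omega> \<in> space P. y < max_abs Y n \<omega>} = {\<omega> \<in> space P. \<exists>t\<in>cube n. y < \<bar>Y t \<omega>\<bar>}" if n: "n \<ge> 1" for n y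
    unfolding max_abs_def using cube_nonempty[OF n] by (subst Max_gr_iff) auto
  have PQ: "P.prob {\<omega> \<in> space P. y < max_abs Y n \<omega>} = Q.prob {\<omega> \<in> space Q. \<exists>t\<in>cube n. y < \<bar>X t \<omega>\<bar>}" if n: "n \<ge> 1" for n y
    unfolding large[OF n] by (rule fdd_eq_prob_large[OF eq]) auto
  have Lpow: "L n powr \<alpha> = real (card (cube n :: (int ^ 'd) set))" for n
    using alpha by (simp add: L_def powr_powr)
  have card_inf: "filterlim (\<lambda>n. real (card (cube n :: (int ^ 'd) set))) at_top sequentially"
    unfolding card_cube of_nat_power by (intro filterlim_pow_at_top filterlim_real_sequentially) simp
  have mm: "(\<lambda>\<omega>. max_abs Y n \<omega>) \<in> borel_measurable P" for n
  proof (cases "n \<ge> 1")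
    case True
    have "{\<omega> \<in> space P. y < max_abs Y n \<omega>} \<in> sets P" for y
      unfolding large[OF True] by (intro sets.sets_Collect_finite_Ex) auto
    then show ?thesis by (simp add: borel_measurable_iff_greater)
  next
    case False
    then have "card (cube n :: (int ^ 'd) set) = 0" by (simp add: card_cube)
    then have "cube n = ({} :: (int ^ 'd) set)" by (simp add: card_0_eq)
    then show ?thesis by (simp add: max_abs_def)
  qed
  have mM: "max_abs Y n \<in> borel_measurable P" for n using mm by simp
  have m0: "0 \<le> max_abs Y n \<omega>" if "n \<ge> 1" for n \<omega>
  proof -
    have "\<bar>Y 0 \<omega>\<bar> \<le> max_abs Y n \<omega>"
      unfolding max_abs_def using zero_in_cube[OF that] by (intro Max_ge) auto
    then show ?thesis by linarith
  qed
  have mL: "0 < L n" if "n \<ge> 1" for n using cube_nonempty[OF that] by (simp add: L_def)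
  have mb: "P.prob {\<omega> \<in> space P. x * L n < max_abs Y n \<omega>} \<le> K * s * x powr (- \<alpha>)" if n: "n \<ge> 1" and x: "x > 0" for n x
  proof -
    have Ln: "L n > 0" using cube_nonempty[OF n] by (simp add: L_def)
    have "{\<omega> \<in> space Q. \<exists>t\<in>cube n. x * L n < \<bar>X t \<omega>\<bar>} = (\<Union>t\<in>cube n. {\<omega> \<in> space Q. x * L n < \<bar>X t \<omega>\<bar>})" by auto
    then have "P.prob {\<omega> \<in> space P. x * L n < max_abs Y n \<omega>} = Q.prob (\<Union>t\<in>cube n. {\<omega> \<in> space Q. x * L n < \<bar>X t \<omega>\<bar>})"
      by (simp add: PQ[OF n])
    also have "\<dots> \<le> (\<Sum>t\<in>cube n. Q.prob {\<omega> \<in> space Q. x * L n < \<bar>X t \<omega>\<bar>})"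
      by (rule Q.finite_measure_subadditive_finite) auto
    also have "\<dots> \<le> (\<Sum>t\<in>(cube n :: (int ^ 'd) set). K * s * (x * L n) powr (- \<alpha>))"
    proof (rule sum_mono)
      fix t :: "int ^ 'd"
      have "Q.prob {\<omega> \<in> space Q. x * L n < \<bar>X t \<omega>\<bar>} \<le> K * (\<integral>y. \<bar>action_kernel \<alpha> \<mu> \<phi> c f t y\<bar> powr \<alpha> \<partial>\<mu>) * (x * L n) powr (- \<alpha>)"
        by (rule stable_integral_tail_bound[OF alpha alpha2 N X Kb]) (use x Ln in auto)
      also have "\<dots> \<le> K * s * (x * L n) powr (- \<alpha>)"
        using s K(1) by (intro mult_right_mono mult_left_mono) auto
      finally show "Q.prob {\<omega> \<in> space Q. x * L n < \<bar>X t \<omega>\<bar>} \<le> K * s * (x * L n) powr (- \<alpha>)" .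
    qed
    also have "\<dots> = (L n powr \<alpha>) * (K * s * (x * L n) powr (- \<alpha>))" by (simp add: Lpow)
    also have "\<dots> = K * s * x powr (- \<alpha>)"
      using x Ln by (simp add: powr_mult powr_minus)
    finally show ?thesis .
  qed
  have mlim: "(\<lambda>n. P.prob {\<omega> \<in> space P. x * L n < max_abs Y n \<omega>}) \<longlonglongrightarrow> 1 - exp (- (stable_const \<alpha> * l * x powr (- \<alpha>)))" if x: "x > 0" for x
  proof -
    have "(\<lambda>n. Q.prob {\<omega> \<in> space Q. \<exists>t\<in>cube n. x * real (card (cube n :: (int ^ 'd) set)) powr (1 / \<alpha>) < \<bar>X t \<omega>\<bar>}) \<longlonglongrightarrow> 1 - exp (- (stable_const \<alpha> * l * x powr (- \<alpha>)))"
      by (rule max_stable_tail_limit[OF alpha alpha2 N finite_cube X s card_inf _ x])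
         (use l in \<open>simp add: max_integral_def kernel_pow_def card_cube\<close>)
    then show ?thesis
      by (rule Lim_transform_eventually)
         (auto intro!: eventually_mono[OF eventually_ge_at_top[of 1]] simp: PQ L_def)
  qed
  have mK: "0 \<le> K * s" using K(1) s0 by simp
  have mA: "0 \<le> stable_const \<alpha> * l" using C l0 by simp
  note ml = moment_limit[OF P.prob_space_axioms mM m0 mL \<beta> mK mb mlim mA]
  show "\<forall>n\<ge>1. integrable P (\<lambda>\<omega>. max_abs Y n \<omega> powr \<beta>)" by (rule ml(1))
  have "L n powr (- \<beta>) = real n powr (- (real CARD('d) * \<beta> / \<alpha>))" for n
  proof (cases "n = 0")
    case False
    then have "real (n ^ CARD('d)) = real n powr real CARD('d)" by (simp add: powr_realpow)
    then show ?thesis by (simp add: L_def card_cube powr_powr)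
  qed (simp add: L_def card_cube)
  then show "(\<lambda>n. real n powr (- (real CARD('d) * \<beta> / \<alpha>)) * P.expectation (\<lambda>\<omega>. max_abs Y n \<omega> powr \<beta>))
           \<longlonglongrightarrow> (stable_const \<alpha> * l) powr (\<beta> / \<alpha>) * (\<integral>z. z \<partial>frechet (\<alpha> / \<beta>))"
    using ml(2) by simp
qed

theorem theorem3p1:
  fixes \<alpha> :: real
    and P :: "'a measure" and Y :: "int ^ 'd \<Rightarrow> 'a \<Rightarrow> real"
    and Q :: "'b measure" and \<mu> :: "'s measure" and N :: "'s set \<Rightarrow> 'b \<Rightarrow> real"
    and f :: "'s \<Rightarrow> real" and \<phi> :: "int ^ 'd \<Rightarrow> 's \<Rightarrow> 's" and c :: "int ^ 'd \<Rightarrow> 's \<Rightarrow> real"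
  assumes "0 < \<alpha>" and "\<alpha> < 2"
    and "SaS_field \<alpha> P Y" and "stationary_field P Y"
    and "standard_borel \<mu>" and "sigma_finite_measure \<mu>"
    and "in_Lp \<alpha> \<mu> f"
    and "nonsingular_action \<mu> \<phi>" and "sign_cocycle \<mu> \<phi> c" and "full_support \<mu> \<phi> f"
    and "integral_representation \<alpha> P Y Q \<mu> N (action_kernel \<alpha> \<mu> \<phi> c f)"
  shows
    "(dissipative_action \<mu> \<phi> \<or>
        (\<exists>(R :: 'r measure) (\<nu> :: 'w measure) N' g. mixed_moving_average \<alpha> P Y R \<nu> N' g)
      \<longrightarrow>
        (\<exists>c_lim. (\<lambda>n. real n powr (- (real CARD('d) / \<alpha>)) *
                       b_seq \<alpha> \<mu> (action_kernel \<alpha> \<mu> \<phi> c f) n) \<longlonglongrightarrow> c_lim \<and>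
          (\<forall>\<beta>. 0 < \<beta> \<and> \<beta> < \<alpha> \<longrightarrow>
             (\<forall>n\<ge>1. integrable P (\<lambda>\<omega>. max_abs Y n \<omega> powr \<beta>)) \<and>
             (\<lambda>n. real n powr (- (real CARD('d) * \<beta> / \<alpha>)) *
                  prob_space.expectation P (\<lambda>\<omega>. max_abs Y n \<omega> powr \<beta>))
               \<longlonglongrightarrow> c_lim powr \<beta> * stable_const \<alpha> powr (\<beta> / \<alpha>) *
                    (\<integral>z. z \<partial>frechet (\<alpha> / \<beta>))))) \<and>
     (conservative_action \<mu> \<phi> \<longrightarrow>
        (\<forall>\<beta>. 0 < \<beta> \<and> \<beta> < \<alpha> \<longrightarrow>
           (\<forall>n\<ge>1. integrable P (\<lambda>\<omega>. max_abs Y n \<omega> powr \<beta>)) \<and>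
           (\<lambda>n. real n powr (- (real CARD('d) * \<beta> / \<alpha>)) *
                prob_space.expectation P (\<lambda>\<omega>. max_abs Y n \<omega> powr \<beta>)) \<longlonglongrightarrow> 0))"
proof -
  note rep = assms(11)
  have rf: "random_field P Y" using assms(3) by (simp add: SaS_field_def)
  interpret sigma_finite_measure \<mu> by fact
  interpret lattice_kernel \<mu> \<phi> \<alpha> c f
  proof unfold_locales
    show "in_Lp \<alpha> \<mu> (action_kernel \<alpha> \<mu> \<phi> c f t)" for t
      using rep by (auto simp: integral_representation_def is_stable_integral_def)
  qed (use assms in auto)
  obtain l where l0: "l \<ge> 0" and l: "(\<lambda>n. max_integral (cube n) / real (n ^ CARD('d))) \<longlonglongrightarrow> l"
    by (rule max_integral_cube_limit)
  have C: "stable_const \<alpha> > 0" by (rule stable_const_pos[OF assms(1,2)])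
  note mml = max_moment_limit[OF assms(2) rf rep l0 l]
  define c_lim where "c_lim = l powr (1 / \<alpha>)"
  have "(\<lambda>n. (max_integral (cube n) / real (n ^ CARD('d))) powr (1 / \<alpha>)) \<longlonglongrightarrow> c_lim"
    unfolding c_lim_def using alpha max_integral_nonneg[OF finite_cube cube_nonempty]
    by (intro tendsto_powr'[OF l tendsto_const]) (auto intro!: eventually_mono[OF eventually_ge_at_top[of 1]])
  then have b_lim: "(\<lambda>n. real n powr (- (real CARD('d) / \<alpha>)) * b_seq \<alpha> \<mu> (action_kernel \<alpha> \<mu> \<phi> c f) n) \<longlonglongrightarrow> c_lim"
  proof (rule Lim_transform_eventually, intro eventually_mono[OF eventually_ge_at_top[of 1]])
    fix n :: nat assume n: "1 \<le> n"
    have "real (n ^ CARD('d)) powr (1 / \<alpha>) = real n powr (real CARD('d) / \<alpha>)"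
      using n by (simp add: powr_realpow[symmetric] powr_powr)
    then show "(max_integral (cube n) / real (n ^ CARD('d))) powr (1 / \<alpha>) = real n powr (- (real CARD('d) / \<alpha>)) * b_seq \<alpha> \<mu> (action_kernel \<alpha> \<mu> \<phi> c f) n"
      using max_integral_nonneg[OF finite_cube cube_nonempty[OF n]] n
      by (simp add: b_seq_def powr_divide powr_minus_divide max_integral_def kernel_pow_def)
  qed
  have const: "(stable_const \<alpha> * l) powr (\<beta> / \<alpha>) = c_lim powr \<beta> * stable_const \<alpha> powr (\<beta> / \<alpha>)" for \<beta>
    using l0 C by (simp add: c_lim_def powr_mult powr_powr)
  show ?thesis
  proof (intro conjI impI)
    show "\<exists>c_lim. (\<lambda>n. real n powr (- (real CARD('d) / \<alpha>)) * b_seq \<alpha> \<mu> (action_kernel \<alpha> \<mu> \<phi> c f) n) \<longlonglongrightarrow> c_lim \<and>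
          (\<forall>\<beta>. 0 < \<beta> \<and> \<beta> < \<alpha> \<longrightarrow>
             (\<forall>n\<ge>1. integrable P (\<lambda>\<omega>. max_abs Y n \<omega> powr \<beta>)) \<and>
             (\<lambda>n. real n powr (- (real CARD('d) * \<beta> / \<alpha>)) *
                  prob_space.expectation P (\<lambda>\<omega>. max_abs Y n \<omega> powr \<beta>))
               \<longlonglongrightarrow> c_lim powr \<beta> * stable_const \<alpha> powr (\<beta> / \<alpha>) * (\<integral>z. z \<partial>frechet (\<alpha> / \<beta>)))"
      using b_lim mml unfolding const by blast
  next
    assume cons: "conservative_action \<mu> \<phi>"
    have "l = 0" by (rule limit_zero_if_conservative[OF cons l l0])
    then show "\<forall>\<beta>. 0 < \<beta> \<and> \<beta> < \<alpha> \<longrightarrow>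
           (\<forall>n\<ge>1. integrable P (\<lambda>\<omega>. max_abs Y n \<omega> powr \<beta>)) \<and>
           (\<lambda>n. real n powr (- (real CARD('d) * \<beta> / \<alpha>)) *
                prob_space.expectation P (\<lambda>\<omega>. max_abs Y n \<omega> powr \<beta>)) \<longlonglongrightarrow> 0"
      using mml by simp
  qed
qed

end
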